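(* Let $Q$ be a Dynkin quiver with vertices $1,\dots,n$ and path matrix $(a_{ij})$, let $A=kQ$ with $k=\mathbb{F}_q$, and $v=\sqrt q$. Let $\mathfrak{K}_1$ be the two-sided ideal of the twisted Hall algebra $\mathcal{H}_{\mathrm{tw}}(C_1(\mathscr{P}))$ generated by all $[K_{P_i}]$, $1\le i\le n$, and $\underline{\mathcal{H}}_{\mathrm{tw}}(C_1(\mathscr{P})):=\mathcal{H}_{\mathrm{tw}}(C_1(\mathscr{P}))/\mathfrak{K}_1$, where the image of $[C_{P_i}]$ is again denoted $[C_{P_i}]$. For any $1\leq i\neq j\leq n$, the following hold in $\underline{\mathcal{H}}_{\mathrm{tw}}(C_1(\mathscr{P}))$: (1) if $a_{ij}=0$, then $[C_{P_i}]\ast[C_{P_j}]=[C_{P_j}]\ast[C_{P_i}]$; (2) if $|a_{ij}|=1$, then $$[C_{P_i}]\ast[C_{P_j}]^{\ast2}-(v+v^{-1})[C_{P_j}]\ast[C_{P_i}]\ast[C_{P_j}]+[C_{P_j}]^{\ast2}\ast[C_{P_i}]=0$$ and $$[C_{P_j}]\ast[C_{P_i}]^{\ast2}-(v+v^{-1})[C_{P_i}]\ast[C_{P_j}]\ast[C_{P_i}]+[C_{P_i}]^{\ast2}\ast[C_{P_j}]=0.$$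
   Context: Dynkin means that the underlying graph is of type $\mathbb{A}$, $\mathbb{D}$ or $\mathbb{E}$. Path matrix: if there is a directed path from $i$ to $j$ ($i\ne j$) then $a_{ij}=1$ and $a_{ji}=-1$; if there is no path between $i$ and $j$ in either direction, or $i=j$, then $a_{ij}=0$. $A$-modules are finite dimensional left modules, $\mathscr{P}$ is the category of projective $A$-modules, $S_i$ the simple module at $i$, $P_i$ its projective cover. Conventions are such that if there is a path from $i$ to $j$ ($i\neq j$) then $\operatorname{Hom}_A(P_j,P_i)\cong k$ and $\operatorname{Hom}_A(P_i,P_j)=0$. The Euler form is $\langle M,N\rangle=\dim_k\operatorname{Hom}_A(M,N)-\dim_k\operatorname{Ext}^1_A(M,N)$. A 1-cyclic complex is a pair $(M,d)$ with $M$ an $A$-module and $d\in\operatorname{End}_A(M)$, $d^2=0$; morphisms are $A$-homomorphisms commuting with the differentials. $C_1(\mathscr{P})$ is the exact category of 1-cyclic complexes of projective modules (exact sequences: those short exact on underlying modules). For $P\in\mathscr{P}$, $C_P=(P,0)$ and $K_P=\left(P\oplus P,\begin{pmatrix}0&1\\0&0\end{pmatrix}\right)$. Let $W_{XY}^Z$ be the set of pairs $(\varphi,\psi)$ with $0\to Y\xrightarrow{\varphi}Z\xrightarrow{\psi}X\to0$ exact in $C_1(\mathscr{P})$, and $F_{XY}^Z:=|W_{XY}^Z|/(|\operatorname{Aut}X||\operatorname{Aut}Y|)$. The twisted Hall algebra $\mathcal{H}_{\mathrm{tw}}(C_1(\mathscr{P}))$ is the $\mathbb{C}$-vector space with basis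 the isoclasses $[X^\cdot]$ of objects and (associative) multiplication $[X^\cdot]\ast[Y^\cdot]=v^{-\langle Y_0,X_0\rangle}\sum_{[Z^\cdot]}F_{X^\cdot Y^\cdot}^{Z^\cdot}[Z^\cdot]$ for $X^\cdot=(X_0,c)$, $Y^\cdot=(Y_0,d)$. $[X]^{\ast2}=[X]\ast[X]$. *)

theory Defs
  imports
    Complex_Main
    "Graph_Theory.Digraph"
    "Graph_Theory.Arc_Walk"
    "HOL-Algebra.QuotRing"
    "Jordan_Normal_Form.Missing_VectorSpace"
begin

section \<open>Dynkin quivers\<close>

text \<open>A quiver is a multi-digraph \<open>Q\<close>: arrows \<open>e \<in> arcs Q\<close> point from \<open>tail Q e\<close> to \<open>head Q e\<close>.\<close>

text \<open>Edge sets of the Dynkin diagrams on the vertex set \<open>{1..n}\<close>. For \<open>D\<close> the chain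
  \<open>1 - \<dots> - (n - 1)\<close> has the extra vertex \<open>n\<close> attached to \<open>n - 2\<close>; for \<open>E\<close> it is attached to \<open>3\<close>.\<close>

definition dynkin_A :: "nat \<Rightarrow> nat set set" where
  "dynkin_A n = {{i, i + 1} | i. 1 \<le> i \<and> i + 1 \<le> n}"

definition dynkin_D :: "nat \<Rightarrow> nat set set" where
  "dynkin_D n = insert {n - 2, n} (dynkin_A (n - 1))"

definition dynkin_E :: "nat \<Rightarrow> nat set set" where
  "dynkin_E n = insert {3, n} (dynkin_A (n - 1))"

definition dynkin_diagram :: "nat \<Rightarrow> nat set set \<Rightarrow> bool" where
  "dynkin_diagram n E \<longleftrightarrow>
     (1 \<le> n \<and> E = dynkin_A n) \<or> (4 \<le> n \<and> E = dynkin_D n) \<or> (n \<in> {6, 7, 8} \<and> E = dynkin_E n)"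

text \<open>Injectivity of the map to unordered end points excludes multiple edges (in either
  direction); loops are excluded because the edges of a diagram have two end points.\<close>

definition dynkin_quiver :: "('v, 'e) pre_digraph \<Rightarrow> bool" where
  "dynkin_quiver Q \<longleftrightarrow> fin_digraph Q \<and>
     inj_on (\<lambda>e. {tail Q e, head Q e}) (arcs Q) \<and>
     (\<exists>n E f. dynkin_diagram n E \<and> bij_betw f {1..n} (verts Q) \<and>
        (\<lambda>e. {tail Q e, head Q e}) ` arcs Q = (\<lambda>s. f ` s) ` E)"

definition path_matrix :: "('v, 'e) pre_digraph \<Rightarrow> 'v \<Rightarrow> 'v \<Rightarrow> int" where
  "path_matrix Q i j =
     (if i = j then 0 else if i \<rightarrow>\<^sup>*\<^bsub>Q\<^esub> j then 1 else if j \<rightarrow>\<^sup>*\<^bsub>Q\<^esub> i then -1 else 0)"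


section \<open>The path algebra\<close>

text \<open>A path is a triple (source, list of arrows in the order of travel, target).\<close>

type_synonym ('v, 'e) qpath = "'v \<times> 'e list \<times> 'v"

definition paths :: "('v, 'e) pre_digraph \<Rightarrow> ('v, 'e) qpath set" where
  "paths Q = {(u, p, w). pre_digraph.awalk Q u p w}"

text \<open>Paths are composed like functions: the product \<open>p q\<close> is ``first \<open>q\<close>, then \<open>p\<close>''.
  Hence the left module \<open>A e\<^sub>i\<close> is spanned by the paths starting at \<open>i\<close>, and
  \<open>Hom\<^sub>A (A e\<^sub>j, A e\<^sub>i) = e\<^sub>j A e\<^sub>i\<close> is spanned by the paths from \<open>i\<close> to \<open>j\<close>.\<close>

definition path_factorizations ::
  "('v, 'e) pre_digraph \<Rightarrow> ('v, 'e) qpath \<Rightarrow> (('v, 'e) qpath \<times> ('v, 'e) qpath) set" where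
  "path_factorizations Q r =
     {((m, p, w), (u, q, m)) | u m w p q.
        (m, p, w) \<in> paths Q \<and> (u, q, m) \<in> paths Q \<and> r = (u, q @ p, w)}"

definition path_algebra ::
  "('k, 'c) ring_scheme \<Rightarrow> ('v, 'e) pre_digraph \<Rightarrow> ('k, ('v, 'e) qpath \<Rightarrow> 'k) module" where
  "path_algebra K Q = \<lparr>
     carrier = {a. (\<forall>r. a r \<in> carrier K) \<and> finite {r. a r \<noteq> \<zero>\<^bsub>K\<^esub>} \<and> {r. a r \<noteq> \<zero>\<^bsub>K\<^esub>} \<subseteq> paths Q},
     mult = (\<lambda>a b r. \<Oplus>\<^bsub>K\<^esub>pq\<in>path_factorizations Q r. a (fst pq) \<otimes>\<^bsub>K\<^esub> b (snd pq)),
     one = (\<lambda>r. if r \<in> {(u, [], u) | u. u \<in> verts Q} then \<one>\<^bsub>K\<^esub> else \<zero>\<^bsub>K\<^esub>),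
     zero = (\<lambda>r. \<zero>\<^bsub>K\<^esub>),
     add = (\<lambda>a b r. a r \<oplus>\<^bsub>K\<^esub> b r),
     smult = (\<lambda>c a r. c \<otimes>\<^bsub>K\<^esub> a r)\<rparr>"


section \<open>Left modules over an algebra\<close>

text \<open>In this section \<open>A\<close> is a possibly non-commutative algebra over the field \<open>K\<close>; this is why
  the locale \<^locale>\<open>module\<close>, which asks for a commutative ring, is replaced. The fields
  \<^const>\<open>mult\<close> and \<^const>\<open>one\<close> of a record representing a module are irrelevant.\<close>

locale left_module = A?: ring A + M?: abelian_group M
  for A :: "('a, 'c) ring_scheme" (structure) and M :: "('a, 'm, 'd) module_scheme" (structure) +
  assumes smult_closed: "a \<in> carrier A \<Longrightarrow> x \<in> carrier M \<Longrightarrow> a \<odot>\<^bsub>M\<^esub> x \<in> carrier M"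
    and smult_l_distr: "a \<in> carrier A \<Longrightarrow> b \<in> carrier A \<Longrightarrow> x \<in> carrier M \<Longrightarrow>
      (a \<oplus>\<^bsub>A\<^esub> b) \<odot>\<^bsub>M\<^esub> x = a \<odot>\<^bsub>M\<^esub> x \<oplus>\<^bsub>M\<^esub> b \<odot>\<^bsub>M\<^esub> x"
    and smult_r_distr: "a \<in> carrier A \<Longrightarrow> x \<in> carrier M \<Longrightarrow> y \<in> carrier M \<Longrightarrow>
      a \<odot>\<^bsub>M\<^esub> (x \<oplus>\<^bsub>M\<^esub> y) = a \<odot>\<^bsub>M\<^esub> x \<oplus>\<^bsub>M\<^esub> a \<odot>\<^bsub>M\<^esub> y"
    and smult_assoc: "a \<in> carrier A \<Longrightarrow> b \<in> carrier A \<Longrightarrow> x \<in> carrier M \<Longrightarrow>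
      (a \<otimes>\<^bsub>A\<^esub> b) \<odot>\<^bsub>M\<^esub> x = a \<odot>\<^bsub>M\<^esub> (b \<odot>\<^bsub>M\<^esub> x)"
    and smult_one: "x \<in> carrier M \<Longrightarrow> \<one>\<^bsub>A\<^esub> \<odot>\<^bsub>M\<^esub> x = x"

definition left_submodule :: "('a, 'c) ring_scheme \<Rightarrow> 'm set \<Rightarrow> ('a, 'm) module \<Rightarrow> bool" where
  "left_submodule A N M \<longleftrightarrow> N \<subseteq> carrier M \<and> \<zero>\<^bsub>M\<^esub> \<in> N \<and>
     (\<forall>x\<in>N. \<forall>y\<in>N. x \<oplus>\<^bsub>M\<^esub> y \<in> N) \<and> (\<forall>a\<in>carrier A. \<forall>x\<in>N. a \<odot>\<^bsub>M\<^esub> x \<in> N)"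

definition scalar_restriction :: "('k, 'a) module \<Rightarrow> ('a, 'm) module \<Rightarrow> ('k, 'm) module" where
  "scalar_restriction A M = \<lparr>carrier = carrier M, mult = mult M, one = one M,
     zero = zero M, add = add M, smult = (\<lambda>c x. (c \<odot>\<^bsub>A\<^esub> \<one>\<^bsub>A\<^esub>) \<odot>\<^bsub>M\<^esub> x)\<rparr>"

definition fd_module :: "'k ring \<Rightarrow> ('k, 'a) module \<Rightarrow> ('a, 'm) module \<Rightarrow> bool" where
  "fd_module K A M \<longleftrightarrow> left_module A M \<and> vectorspace.fin_dim K (scalar_restriction A M)"

text \<open>\<^term>\<open>LinearCombinations.module_hom\<close> does not constrain a map outside the carrier. Wherever
  maps are counted or added, they are taken extensional.\<close>

definition hom_space ::
  "('k, 'a) module \<Rightarrow> ('a, 'm) module \<Rightarrow> ('a, 'n) module \<Rightarrow> ('k, 'm \<Rightarrow> 'n) module" where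
  "hom_space A M N = \<lparr>
     carrier = LinearCombinations.module_hom A M N \<inter> extensional (carrier M),
     mult = (\<lambda>f g. \<lambda>x\<in>carrier M. \<zero>\<^bsub>N\<^esub>),
     one = (\<lambda>x\<in>carrier M. \<zero>\<^bsub>N\<^esub>),
     zero = (\<lambda>x\<in>carrier M. \<zero>\<^bsub>N\<^esub>),
     add = (\<lambda>f g. \<lambda>x\<in>carrier M. f x \<oplus>\<^bsub>N\<^esub> g x),
     smult = (\<lambda>c f. \<lambda>x\<in>carrier M. (c \<odot>\<^bsub>A\<^esub> \<one>\<^bsub>A\<^esub>) \<odot>\<^bsub>N\<^esub> f x)\<rparr>"

text \<open>The quotient ring record \<^term>\<open>V Quot W\<close> of the library together with the induced scalar
  multiplication. It serves both for quotients of vector spaces by subspaces and for quotients of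
  algebras by two-sided ideals.\<close>

definition module_quot :: "('k, 'v) module \<Rightarrow> 'v set \<Rightarrow> ('k, 'v set) module" where
  "module_quot V W = \<lparr>carrier = carrier (V Quot W), mult = mult (V Quot W), one = one (V Quot W),
     zero = zero (V Quot W), add = add (V Quot W),
     smult = (\<lambda>c C. \<Union>x\<in>C. W +>\<^bsub>V\<^esub> (c \<odot>\<^bsub>V\<^esub> x))\<rparr>"

text \<open>\<open>Ext\<^sup>1\<^sub>A (M, N)\<close> is computed from the presentation \<open>0 \<rightarrow> \<Omega> \<rightarrow> F \<rightarrow> M \<rightarrow> 0\<close>, with \<open>F\<close> the free module
  on the underlying set of \<open>M\<close>: it is the cokernel of the restriction map
  \<open>Hom\<^sub>A (F, N) \<rightarrow> Hom\<^sub>A (\<Omega>, N)\<close>.\<close>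

definition free_module :: "('k, 'a) module \<Rightarrow> 'b set \<Rightarrow> ('a, 'b \<Rightarrow> 'a) module" where
  "free_module A B = \<lparr>
     carrier = {\<phi> \<in> B \<rightarrow>\<^sub>E carrier A. finite {b \<in> B. \<phi> b \<noteq> \<zero>\<^bsub>A\<^esub>}},
     mult = (\<lambda>\<phi> \<psi>. \<lambda>b\<in>B. \<zero>\<^bsub>A\<^esub>),
     one = (\<lambda>b\<in>B. \<zero>\<^bsub>A\<^esub>),
     zero = (\<lambda>b\<in>B. \<zero>\<^bsub>A\<^esub>),
     add = (\<lambda>\<phi> \<psi>. \<lambda>b\<in>B. \<phi> b \<oplus>\<^bsub>A\<^esub> \<psi> b),
     smult = (\<lambda>a \<phi>. \<lambda>b\<in>B. a \<otimes>\<^bsub>A\<^esub> \<phi> b)\<rparr>"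

definition free_cover :: "('k, 'a) module \<Rightarrow> ('a, 'm) module \<Rightarrow> ('m \<Rightarrow> 'a) \<Rightarrow> 'm" where
  "free_cover A M \<phi> = (\<Oplus>\<^bsub>M\<^esub>x\<in>{x \<in> carrier M. \<phi> x \<noteq> \<zero>\<^bsub>A\<^esub>}. \<phi> x \<odot>\<^bsub>M\<^esub> x)"

definition syzygy :: "('k, 'a) module \<Rightarrow> ('a, 'm) module \<Rightarrow> ('a, 'm \<Rightarrow> 'a) module" where
  "syzygy A M = (free_module A (carrier M))
     \<lparr>carrier := {\<phi> \<in> carrier (free_module A (carrier M)). free_cover A M \<phi> = \<zero>\<^bsub>M\<^esub>}\<rparr>"

definition ext1_space ::
  "('k, 'a) module \<Rightarrow> ('a, 'm) module \<Rightarrow> ('a, 'n) module \<Rightarrow> ('k, (('m \<Rightarrow> 'a) \<Rightarrow> 'n) set) module" where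
  "ext1_space A M N = module_quot (hom_space A (syzygy A M) N)
     ((\<lambda>f. restrict f (carrier (syzygy A M))) ` carrier (hom_space A (free_module A (carrier M)) N))"

definition euler_form ::
  "'k ring \<Rightarrow> ('k, 'a) module \<Rightarrow> ('a, 'm) module \<Rightarrow> ('a, 'n) module \<Rightarrow> int" where
  "euler_form K A M N =
     int (vectorspace.dim K (hom_space A M N)) - int (vectorspace.dim K (ext1_space A M N))"

text \<open>A projective object of the category of finite dimensional modules. Testing on modules whose
  elements are natural numbers loses nothing: the ground field will be finite, so a finite
  dimensional module is a finite set.\<close>

definition projective :: "'k ring \<Rightarrow> ('k, 'a) module \<Rightarrow> ('a, 'm) module \<Rightarrow> bool" where
  "projective K A P \<longleftrightarrow> fd_module K A P \<and>
     (\<forall>(M :: ('a, nat) module) (N :: ('a, nat) module).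
        fd_module K A M \<and> fd_module K A N \<longrightarrow>
        (\<forall>g\<in>LinearCombinations.module_hom A M N. g ` carrier M = carrier N \<longrightarrow>
          (\<forall>h\<in>LinearCombinations.module_hom A P N.
             \<exists>h'\<in>LinearCombinations.module_hom A P M. \<forall>x\<in>carrier P. g (h' x) = h x)))"

definition projective_cover ::
  "'k ring \<Rightarrow> ('k, 'a) module \<Rightarrow> ('a, 'm) module \<Rightarrow> ('a, 'n) module \<Rightarrow> bool" where
  "projective_cover K A P S \<longleftrightarrow> projective K A P \<and>
     (\<exists>\<pi>\<in>LinearCombinations.module_hom A P S. \<pi> ` carrier P = carrier S \<and>
        (\<forall>N. left_submodule A N P \<and> N <+>\<^bsub>P\<^esub> a_kernel P S \<pi> = carrier P \<longrightarrow> N = carrier P))"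

definition simple_module ::
  "'k ring \<Rightarrow> 'v \<Rightarrow> (('v, 'e) qpath \<Rightarrow> 'k, 'k) module" where
  "simple_module K i = \<lparr>carrier = carrier K, mult = mult K, one = one K,
     zero = zero K, add = add K, smult = (\<lambda>a x. a (i, [], i) \<otimes>\<^bsub>K\<^esub> x)\<rparr>"


section \<open>1-cyclic complexes of projective modules\<close>

type_synonym ('a, 'm) cyclic_complex = "('a, 'm) module \<times> ('m \<Rightarrow> 'm)"

definition C1_object :: "'k ring \<Rightarrow> ('k, 'a) module \<Rightarrow> ('a, 'm) cyclic_complex \<Rightarrow> bool" where
  "C1_object K A X \<longleftrightarrow> projective K A (fst X) \<and>
     snd X \<in> LinearCombinations.module_hom A (fst X) (fst X) \<and>
     (\<forall>x\<in>carrier (fst X). snd X (snd X x) = \<zero>\<^bsub>fst X\<^esub>)"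

definition C1_hom ::
  "('k, 'a) module \<Rightarrow> ('a, 'm) cyclic_complex \<Rightarrow> ('a, 'n) cyclic_complex \<Rightarrow> ('m \<Rightarrow> 'n) set" where
  "C1_hom A X Y = {f \<in> LinearCombinations.module_hom A (fst X) (fst Y) \<inter> extensional (carrier (fst X)).
     \<forall>x\<in>carrier (fst X). f (snd X x) = snd Y (f x)}"

definition C1_iso ::
  "('k, 'a) module \<Rightarrow> ('a, 'm) cyclic_complex \<Rightarrow> ('a, 'n) cyclic_complex \<Rightarrow> ('m \<Rightarrow> 'n) set" where
  "C1_iso A X Y = {f \<in> C1_hom A X Y. bij_betw f (carrier (fst X)) (carrier (fst Y))}"

definition C_complex :: "('a, 'm) module \<Rightarrow> ('a, 'm) cyclic_complex" where
  "C_complex P = (P, \<lambda>x. \<zero>\<^bsub>P\<^esub>)"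

definition K_complex :: "('a, 'm) module \<Rightarrow> ('a, 'm \<times> 'm) cyclic_complex" where
  "K_complex P = (direct_sum P P, \<lambda>(x, y). (y, \<zero>\<^bsub>P\<^esub>))"

text \<open>The set \<open>W\<^sup>Z\<^sub>X\<^sub>Y\<close> of short exact sequences \<open>0 \<rightarrow> Y \<rightarrow> Z \<rightarrow> X \<rightarrow> 0\<close>.\<close>

definition short_exact_pairs ::
  "('k, 'a) module \<Rightarrow> ('a, 'x) cyclic_complex \<Rightarrow> ('a, 'y) cyclic_complex \<Rightarrow> ('a, 'z) cyclic_complex
    \<Rightarrow> (('y \<Rightarrow> 'z) \<times> ('z \<Rightarrow> 'x)) set" where
  "short_exact_pairs A X Y Z = {(\<phi>, \<psi>). \<phi> \<in> C1_hom A Y Z \<and> \<psi> \<in> C1_hom A Z X \<and>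
     inj_on \<phi> (carrier (fst Y)) \<and> \<psi> ` carrier (fst Z) = carrier (fst X) \<and>
     \<phi> ` carrier (fst Y) = a_kernel (fst Z) (fst X) \<psi>}"

definition hall_number ::
  "('k, 'a) module \<Rightarrow> ('a, 'x) cyclic_complex \<Rightarrow> ('a, 'y) cyclic_complex \<Rightarrow> ('a, 'z) cyclic_complex
    \<Rightarrow> real" where
  "hall_number A X Y Z =
     real (card (short_exact_pairs A X Y Z)) / (real (card (C1_iso A X X)) * real (card (C1_iso A Y Y)))"


section \<open>The twisted Hall algebra\<close>

text \<open>Since every object is a finite set up to isomorphism, an isoclass is represented by its members
  with elements in \<^typ>\<open>nat\<close>. The object \<open>X\<close> itself may have elements of any type.\<close>

type_synonym 'a isoclass = "('a, nat) cyclic_complex set"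

definition isoclass :: "'k ring \<Rightarrow> ('k, 'a) module \<Rightarrow> ('a, 'm) cyclic_complex \<Rightarrow> 'a isoclass" where
  "isoclass K A X = {Y. C1_object K A Y \<and> C1_iso A X Y \<noteq> {}}"

definition isoclasses :: "'k ring \<Rightarrow> ('k, 'a) module \<Rightarrow> 'a isoclass set" where
  "isoclasses K A = {isoclass K A X | X :: ('a, nat) cyclic_complex. C1_object K A X}"

definition representative :: "'a isoclass \<Rightarrow> ('a, nat) cyclic_complex" where
  "representative \<gamma> = (SOME X. X \<in> \<gamma>)"

text \<open>The basis vector \<open>[X]\<close>, as a finitely supported function on isoclasses.\<close>

definition basis_vector ::
  "'k ring \<Rightarrow> ('k, 'a) module \<Rightarrow> ('a, 'm) cyclic_complex \<Rightarrow> 'a isoclass \<Rightarrow> complex" where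
  "basis_vector K A X = (\<lambda>\<gamma>. if \<gamma> = isoclass K A X then 1 else 0)"

definition zero_module :: "('a, nat) module" where
  "zero_module = \<lparr>carrier = {0}, mult = (\<lambda>x y. 0), one = 0, zero = 0, add = (\<lambda>x y. 0),
     smult = (\<lambda>a x. 0)\<rparr>"

definition twisting_parameter :: "'k ring \<Rightarrow> real" where
  "twisting_parameter K = sqrt (real (card (carrier K)))"

definition structure_constant ::
  "'k ring \<Rightarrow> ('k, 'a) module \<Rightarrow> 'a isoclass \<Rightarrow> 'a isoclass \<Rightarrow> 'a isoclass \<Rightarrow> real" where
  "structure_constant K A \<alpha> \<beta> \<gamma> =
     (let X = representative \<alpha>; Y = representative \<beta>; Z = representative \<gamma>
      in twisting_parameter K powi (- euler_form K A (fst Y) (fst X)) * hall_number A X Y Z)"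

definition twisted_hall_algebra ::
  "'k ring \<Rightarrow> ('k, 'a) module \<Rightarrow> (complex, 'a isoclass \<Rightarrow> complex) module" where
  "twisted_hall_algebra K A = \<lparr>
     carrier = {f. finite {\<gamma>. f \<gamma> \<noteq> 0} \<and> {\<gamma>. f \<gamma> \<noteq> 0} \<subseteq> isoclasses K A},
     mult = (\<lambda>f g \<gamma>. if \<gamma> \<in> isoclasses K A
       then \<Sum>\<alpha>\<in>{\<alpha>. f \<alpha> \<noteq> 0}. \<Sum>\<beta>\<in>{\<beta>. g \<beta> \<noteq> 0}.
              f \<alpha> * g \<beta> * complex_of_real (structure_constant K A \<alpha> \<beta> \<gamma>)
       else 0),
     one = basis_vector K A (C_complex zero_module),
     zero = (\<lambda>\<gamma>. 0),
     add = (\<lambda>f g \<gamma>. f \<gamma> + g \<gamma>),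
     smult = (\<lambda>c f \<gamma>. c * f \<gamma>)\<rparr>"

text \<open>The library's \<^const>\<open>genideal\<close> intersects only over sets satisfying \<^const>\<open>ideal\<close>, which asks
  that the ambient record be a ring; the definition below does not depend on a proof of
  associativity.\<close>

definition two_sided_ideal :: "(complex, 'h) module \<Rightarrow> 'h set \<Rightarrow> bool" where
  "two_sided_ideal H I \<longleftrightarrow> I \<subseteq> carrier H \<and> \<zero>\<^bsub>H\<^esub> \<in> I \<and>
     (\<forall>x\<in>I. \<forall>y\<in>I. x \<oplus>\<^bsub>H\<^esub> y \<in> I) \<and> (\<forall>c. \<forall>x\<in>I. c \<odot>\<^bsub>H\<^esub> x \<in> I) \<and>
     (\<forall>x\<in>I. \<forall>h\<in>carrier H. h \<otimes>\<^bsub>H\<^esub> x \<in> I \<and> x \<otimes>\<^bsub>H\<^esub> h \<in> I)"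

definition generated_ideal :: "(complex, 'h) module \<Rightarrow> 'h set \<Rightarrow> 'h set" where
  "generated_ideal H S = \<Inter> {I. two_sided_ideal H I \<and> S \<subseteq> I}"

text \<open>Here \<open>P l\<close>, for \<open>1 \<le> l \<le> n\<close>, are the indecomposable projective modules.\<close>

definition contractible_ideal ::
  "'k ring \<Rightarrow> ('k, 'a) module \<Rightarrow> nat \<Rightarrow> (nat \<Rightarrow> ('a, 'p) module) \<Rightarrow> ('a isoclass \<Rightarrow> complex) set" where
  "contractible_ideal K A n P = generated_ideal (twisted_hall_algebra K A)
     ((\<lambda>l. basis_vector K A (K_complex (P l))) ` {1..n})"

definition reduced_hall_algebra ::
  "'k ring \<Rightarrow> ('k, 'a) module \<Rightarrow> nat \<Rightarrow> (nat \<Rightarrow> ('a, 'p) module)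
    \<Rightarrow> (complex, ('a isoclass \<Rightarrow> complex) set) module" where
  "reduced_hall_algebra K A n P =
     module_quot (twisted_hall_algebra K A) (contractible_ideal K A n P)"

definition reduced_class ::
  "'k ring \<Rightarrow> ('k, 'a) module \<Rightarrow> nat \<Rightarrow> (nat \<Rightarrow> ('a, 'p) module) \<Rightarrow> ('a, 'm) cyclic_complex
    \<Rightarrow> ('a isoclass \<Rightarrow> complex) set" where
  "reduced_class K A n P X =
     contractible_ideal K A n P +>\<^bsub>twisted_hall_algebra K A\<^esub> basis_vector K A X"

end

theory Submission
  imports Defs "HOL-Library.Countable_Set"
begin

text \<open>
  Rescale the basis to \<open>e\<^sub>X = |Aut X| [X]\<close>. Exact sequences of complexes of projectives split as
  sequences of modules, and counting the split ones in two ways (Riedtmann's formula) gives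
  \<open>e\<^sub>X * e\<^sub>Y = |Hom (Y\<^sub>0, X\<^sub>0)|\<^sup>-\<^sup>1\<^sup>/\<^sup>2 |Hom (X\<^sub>0, Y\<^sub>0)|\<^sup>-\<^sup>1 \<Sum>\<^sub>h e\<^bsub>Z(h)\<^esub>\<close>, where \<open>h\<close> runs over the maps
  \<open>X\<^sub>0 \<rightarrow> Y\<^sub>0\<close> for which \<open>(y, x) \<mapsto> (d y + h x, c x)\<close> is a differential of \<open>Y\<^sub>0 \<oplus> X\<^sub>0\<close>, and \<open>Z(h)\<close> is the
  resulting complex. So no automorphism group has to be determined; the twist is a power of
  \<open>|Hom|\<close> because \<open>Ext\<^sup>1\<close> vanishes on projectives. A complex with a direct summand \<open>K\<^sub>P\<close> lies in the
  ideal, since \<open>e\<close> of \<open>K\<^sub>P \<oplus> C\<^sub>M\<close> is a multiple of \<open>e\<close> of \<open>K\<^sub>P\<close> times \<open>e\<close> of \<open>C\<^sub>M\<close>.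

  In a Dynkin quiver directed paths are unique. Hence \<open>End P\<^sub>i = k\<close>, and a path from \<open>i\<close> to \<open>j\<close> gives
  \<open>Hom (P\<^sub>j, P\<^sub>i) = k f\<close> and \<open>Hom (P\<^sub>i, P\<^sub>j) = 0\<close>. Modulo the ideal, the three products of two factors
  \<open>e\<^sub>j\<close> and one factor \<open>e\<^sub>i\<close> only involve \<open>a\<close>, the complex with zero differential, and \<open>b\<close>, the one with
  differential \<open>f\<close>; they are \<open>v\<^sup>-\<^sup>5 a\<close>, \<open>v\<^sup>-\<^sup>6 (a + (v\<^sup>2 - 1) b)\<close> and \<open>v\<^sup>-\<^sup>7 (a + (v\<^sup>4 - 1) b)\<close>, and so
  cancel with the coefficients \<open>1\<close>, \<open>- (v + v\<^sup>-\<^sup>1)\<close> and \<open>1\<close>. The same numbers occur when \<open>i\<close> and \<open>j\<close>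
  change places.
\<close>

section \<open>Modules over a finite algebra\<close>

text \<open>Only two classes survive modulo the ideal, for a linear algebra reason. Since End(P) = k
  for each projective that occurs, a nonzero component P -> P of a differential is invertible and
  splits off a K_P. What remains are maps M -> N, M^2 -> N or M -> N^2 between powers of two
  projectives with Hom(M, N) = k f, that is, vectors over k times f. The nonzero vectors form one
  orbit under automorphisms, so they all give the same complex b, and they only have to be counted:
  q - 1 = v^2 - 1 of them in k, and q^2 - 1 = v^4 - 1 in k^2. The coefficient of a then cancels
  because v^-5 - (v + v^-1) v^-6 + v^-7 = 0, and that of b because v^4 - 1 = (v^2 + 1)(v^2 - 1). An
  obstacle throughout is that the isoclasses and the modules testing projectivity live on natural
  numbers, whereas extensions live on product types. Invariants are therefore proved for complexes
  on arbitrary types and carried over by transport of structure.\<close>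

abbreviation mhom where "mhom \<equiv> LinearCombinations.module_hom"

lemma mhomI:
  assumes "\<And>x. x \<in> carrier M \<Longrightarrow> f x \<in> carrier N"
    and "\<And>x y. x \<in> carrier M \<Longrightarrow> y \<in> carrier M \<Longrightarrow> f (x \<oplus>\<^bsub>M\<^esub> y) = f x \<oplus>\<^bsub>N\<^esub> f y"
    and "\<And>a x. a \<in> carrier A \<Longrightarrow> x \<in> carrier M \<Longrightarrow> f (a \<odot>\<^bsub>M\<^esub> x) = a \<odot>\<^bsub>N\<^esub> f x"
  shows "f \<in> mhom A M N"
  using assms by (simp add: LinearCombinations.module_hom_def)

lemma mhom_closed: "f \<in> mhom A M N \<Longrightarrow> x \<in> carrier M \<Longrightarrow> f x \<in> carrier N"
  and mhom_add: "f \<in> mhom A M N \<Longrightarrow> x \<in> carrier M \<Longrightarrow> y \<in> carrier M \<Longrightarrow>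
    f (x \<oplus>\<^bsub>M\<^esub> y) = f x \<oplus>\<^bsub>N\<^esub> f y"
  and mhom_smult: "f \<in> mhom A M N \<Longrightarrow> a \<in> carrier A \<Longrightarrow> x \<in> carrier M \<Longrightarrow>
    f (a \<odot>\<^bsub>M\<^esub> x) = a \<odot>\<^bsub>N\<^esub> f x"
  by (auto simp: LinearCombinations.module_hom_def)

lemma mhom_compose:
  assumes "f \<in> mhom A L M" "g \<in> mhom A M N"
  shows "(\<lambda>x. g (f x)) \<in> mhom A L N"
  using assms by (intro mhomI) (simp_all add: mhom_closed mhom_add mhom_smult)

lemma mhom_id: "(\<lambda>x. x) \<in> mhom A M M"
  by (intro mhomI) auto

lemma mhom_cong:
  assumes "left_module A M" "f \<in> mhom A M N" "\<And>x. x \<in> carrier M \<Longrightarrow> g x = f x"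
  shows "g \<in> mhom A M N"
proof -
  interpret left_module A M by fact
  show ?thesis
    using assms by (intro mhomI) (simp_all add: mhom_closed mhom_add mhom_smult smult_closed)
qed

text \<open>Extensionality makes this a finite set for finite modules and makes equality a pointwise
  matter. It is kept apart from \<open>mhom\<close>, whose members may be plain lambda
  terms.\<close>

definition homs ::
  "('k, 'a) module \<Rightarrow> ('a, 'm) module \<Rightarrow> ('a, 'n) module \<Rightarrow> ('m \<Rightarrow> 'n) set" where
  "homs A M N = mhom A M N \<inter> extensional (carrier M)"

lemma carrier_hom_space: "carrier (hom_space A M N) = homs A M N"
  by (simp add: hom_space_def homs_def)

lemma homs_mhom: "f \<in> homs A M N \<Longrightarrow> f \<in> mhom A M N"
  by (simp add: homs_def)

lemma homs_restrict:
  assumes "left_module A M" "f \<in> mhom A M N"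
  shows "restrict f (carrier M) \<in> homs A M N"
  using assms by (auto simp: homs_def intro: mhom_cong)

lemma homs_eqI:
  assumes "f \<in> homs A M N" "g \<in> homs A M N" "\<And>x. x \<in> carrier M \<Longrightarrow> f x = g x"
  shows "f = g"
  using assms by (auto simp: homs_def intro: extensionalityI)

lemma finite_homs:
  assumes "finite (carrier M)" "finite (carrier N)"
  shows "finite (homs A M N)"
proof (rule finite_subset)
  show "homs A M N \<subseteq> carrier M \<rightarrow>\<^sub>E carrier N"
    by (auto simp: homs_def PiE_def mhom_closed)
  show "finite (carrier M \<rightarrow>\<^sub>E carrier N)"
    using assms by (intro finite_PiE) auto
qed

context left_module
begin

lemma smult_zero_right: "a \<in> carrier A \<Longrightarrow> a \<odot>\<^bsub>M\<^esub> \<zero>\<^bsub>M\<^esub> = \<zero>\<^bsub>M\<^esub>"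
  by (metis M.add.l_cancel_one' M.zero_closed M.r_zero smult_closed smult_r_distr)

lemma smult_zero_left: "x \<in> carrier M \<Longrightarrow> \<zero>\<^bsub>A\<^esub> \<odot>\<^bsub>M\<^esub> x = \<zero>\<^bsub>M\<^esub>"
  by (metis M.add.l_cancel_one' A.zero_closed A.r_zero smult_closed smult_l_distr)

lemma smult_minus_right:
  "a \<in> carrier A \<Longrightarrow> x \<in> carrier M \<Longrightarrow> a \<odot>\<^bsub>M\<^esub> (\<ominus>\<^bsub>M\<^esub> x) = \<ominus>\<^bsub>M\<^esub> (a \<odot>\<^bsub>M\<^esub> x)"
  by (metis M.a_inv_closed M.minus_equality M.l_neg smult_closed smult_r_distr smult_zero_right)

lemma smult_minus_left:
  "a \<in> carrier A \<Longrightarrow> x \<in> carrier M \<Longrightarrow> (\<ominus>\<^bsub>A\<^esub> a) \<odot>\<^bsub>M\<^esub> x = \<ominus>\<^bsub>M\<^esub> (a \<odot>\<^bsub>M\<^esub> x)"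
  by (metis A.a_inv_closed M.minus_equality A.l_neg smult_closed smult_l_distr smult_zero_left)

end

lemma mhom_zero:
  assumes "left_module A M" "left_module A N" "f \<in> mhom A M N"
  shows "f \<zero>\<^bsub>M\<^esub> = \<zero>\<^bsub>N\<^esub>"
proof -
  interpret M: left_module A M by fact
  interpret N: left_module A N by fact
  have "f \<zero>\<^bsub>M\<^esub> \<oplus>\<^bsub>N\<^esub> f \<zero>\<^bsub>M\<^esub> = f \<zero>\<^bsub>M\<^esub>"
    using mhom_add[OF assms(3), of "\<zero>\<^bsub>M\<^esub>" "\<zero>\<^bsub>M\<^esub>"] by simp
  then show ?thesis
    using mhom_closed[OF assms(3), of "\<zero>\<^bsub>M\<^esub>"] by (simp add: N.add.l_cancel_one')
qed

lemma mhom_uminus: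
  assumes "left_module A M" "left_module A N" "f \<in> mhom A M N" "x \<in> carrier M"
  shows "f (\<ominus>\<^bsub>M\<^esub> x) = \<ominus>\<^bsub>N\<^esub> f x"
proof -
  interpret M: left_module A M by fact
  interpret N: left_module A N by fact
  have "f (\<ominus>\<^bsub>M\<^esub> x) \<oplus>\<^bsub>N\<^esub> f x = \<zero>\<^bsub>N\<^esub>"
    using mhom_add[OF assms(3), of "\<ominus>\<^bsub>M\<^esub> x" x] assms
    by (simp add: M.M.l_neg mhom_zero)
  then show ?thesis
    using assms by (simp add: N.M.minus_equality mhom_closed)
qed

lemma mhom_minus:
  assumes "left_module A M" "left_module A N" "f \<in> mhom A M N" "x \<in> carrier M" "y \<in> carrier M"
  shows "f (x \<ominus>\<^bsub>M\<^esub> y) = f x \<ominus>\<^bsub>N\<^esub> f y"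
proof -
  interpret M: left_module A M by fact
  show ?thesis
    using assms by (simp add: a_minus_def mhom_add mhom_uminus)
qed

lemma mhom_zero_map:
  assumes "left_module A M" "left_module A N"
  shows "(\<lambda>x. \<zero>\<^bsub>N\<^esub>) \<in> mhom A M N"
proof -
  interpret N: left_module A N by fact
  show ?thesis by (intro mhomI) (auto simp: N.smult_zero_right)
qed

lemma mhom_add_map:
  assumes "left_module A M" "left_module A N" "f \<in> mhom A M N" "g \<in> mhom A M N"
  shows "(\<lambda>x. f x \<oplus>\<^bsub>N\<^esub> g x) \<in> mhom A M N"
proof -
  interpret N: left_module A N by fact
  show ?thesis
    using assms
    by (intro mhomI) (simp_all add: mhom_closed mhom_add mhom_smult N.smult_r_distr N.M.a_ac)
qed

lemma mhom_uminus_map: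
  assumes "left_module A M" "left_module A N" "f \<in> mhom A M N"
  shows "(\<lambda>x. \<ominus>\<^bsub>N\<^esub> f x) \<in> mhom A M N"
proof -
  interpret N: left_module A N by fact
  show ?thesis
    using assms
    by (intro mhomI)
      (simp_all add: mhom_closed mhom_add mhom_smult N.smult_minus_right N.M.minus_add N.M.a_ac)
qed

lemma mhom_inv_into:
  assumes M: "left_module A M" and f: "f \<in> mhom A M N" and bij: "bij_betw f (carrier M) (carrier N)"
  shows "inv_into (carrier M) f \<in> mhom A N M"
proof -
  interpret M: left_module A M by fact
  let ?g = "inv_into (carrier M) f"
  have g: "?g y \<in> carrier M" "f (?g y) = y" if "y \<in> carrier N" for y
    using that bij by (auto simp: bij_betw_def inv_into_into f_inv_into_f)
  have inj: "inj_on f (carrier M)"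
    using bij by (simp add: bij_betw_def)
  show ?thesis
  proof (rule mhomI)
    fix x y assume "x \<in> carrier N" "y \<in> carrier N"
    then show "?g (x \<oplus>\<^bsub>N\<^esub> y) = ?g x \<oplus>\<^bsub>M\<^esub> ?g y"
      using g f inj by (intro inv_into_f_eq) (simp_all add: mhom_add)
  next
    fix a x assume "a \<in> carrier A" "x \<in> carrier N"
    then show "?g (a \<odot>\<^bsub>N\<^esub> x) = a \<odot>\<^bsub>M\<^esub> ?g x"
      using g f inj by (intro inv_into_f_eq) (simp_all add: mhom_smult M.smult_closed)
  qed (use g in auto)
qed

lemma left_module_direct_sum:
  assumes "left_module A M" "left_module A N"
  shows "left_module A (direct_sum M N)"
proof -
  interpret M: left_module A M by fact
  interpret N: left_module A N by fact
  have "abelian_group (direct_sum M N)"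
  proof (rule abelian_groupI)
    fix x assume "x \<in> carrier (direct_sum M N)"
    then show "\<exists>y\<in>carrier (direct_sum M N). y \<oplus>\<^bsub>direct_sum M N\<^esub> x = \<zero>\<^bsub>direct_sum M N\<^esub>"
      by (intro bexI[of _ "(\<ominus>\<^bsub>M\<^esub> fst x, \<ominus>\<^bsub>N\<^esub> snd x)"])
        (auto simp: direct_sum_def M.M.l_neg N.M.l_neg)
  qed (auto simp: direct_sum_def M.M.a_ac N.M.a_ac)
  moreover have "left_module_axioms A (direct_sum M N)"
    by unfold_locales
      (auto simp: direct_sum_def M.smult_closed N.smult_closed M.smult_l_distr N.smult_l_distr
        M.smult_r_distr N.smult_r_distr M.smult_assoc N.smult_assoc M.smult_one N.smult_one)
  ultimately show ?thesis
    by (intro left_module.intro M.ring_axioms)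
qed

lemma carrier_direct_sum [simp]: "carrier (direct_sum M N) = carrier M \<times> carrier N"
  and zero_direct_sum [simp]: "\<zero>\<^bsub>direct_sum M N\<^esub> = (\<zero>\<^bsub>M\<^esub>, \<zero>\<^bsub>N\<^esub>)"
  and add_direct_sum [simp]: "(x, y) \<oplus>\<^bsub>direct_sum M N\<^esub> (x', y') = (x \<oplus>\<^bsub>M\<^esub> x', y \<oplus>\<^bsub>N\<^esub> y')"
  and smult_direct_sum [simp]: "a \<odot>\<^bsub>direct_sum M N\<^esub> (x, y) = (a \<odot>\<^bsub>M\<^esub> x, a \<odot>\<^bsub>N\<^esub> y)"
  by (simp_all add: direct_sum_def)

text \<open>\<open>projective\<close> tests lifting only against modules on \<open>nat\<close>, and
  isoclasses contain only complexes on \<open>nat\<close>. This copy moves a finite module of any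
  type there, by transport of structure; \<open>mult\<close> and \<open>one\<close> are
  fillers.\<close>

definition nat_copy :: "('a, 'm) module \<Rightarrow> ('a, nat) module" where
  "nat_copy M = (let g = to_nat_on (carrier M); h = inv_into (carrier M) g in
     \<lparr>carrier = g ` carrier M, mult = (\<lambda>x y. 0), one = 0, zero = g \<zero>\<^bsub>M\<^esub>,
      add = (\<lambda>x y. g (h x \<oplus>\<^bsub>M\<^esub> h y)), smult = (\<lambda>a x. g (a \<odot>\<^bsub>M\<^esub> h x))\<rparr>)"

lemma nat_copy:
  assumes "left_module A M" "finite (carrier M)"
  shows "left_module A (nat_copy M)" "finite (carrier (nat_copy M))"
    "to_nat_on (carrier M) \<in> mhom A M (nat_copy M)"
    "bij_betw (to_nat_on (carrier M)) (carrier M) (carrier (nat_copy M))"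
proof -
  interpret M: left_module A M by fact
  let ?g = "to_nat_on (carrier M)"
  have inj: "inj_on ?g (carrier M)"
    using assms by (intro inj_on_to_nat_on) (simp add: countable_finite)
  have h: "inv_into (carrier M) ?g (?g x) = x" if "x \<in> carrier M" for x
    using that inj by simp
  have "abelian_group (nat_copy M)"
  proof (rule abelian_groupI)
    fix x assume "x \<in> carrier (nat_copy M)"
    then obtain u where u: "u \<in> carrier M" "x = ?g u"
      by (auto simp: nat_copy_def Let_def)
    then show "\<exists>y\<in>carrier (nat_copy M). y \<oplus>\<^bsub>nat_copy M\<^esub> x = \<zero>\<^bsub>nat_copy M\<^esub>"
      by (intro bexI[of _ "?g (\<ominus>\<^bsub>M\<^esub> u)"]) (auto simp: nat_copy_def Let_def h M.M.l_neg)
  qed (auto simp: nat_copy_def Let_def h M.M.a_ac)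
  moreover have "left_module_axioms A (nat_copy M)"
    by unfold_locales
      (auto simp: nat_copy_def Let_def h M.smult_closed M.smult_l_distr M.smult_r_distr
        M.smult_assoc M.smult_one)
  ultimately show "left_module A (nat_copy M)"
    by (intro left_module.intro M.ring_axioms)
  show "finite (carrier (nat_copy M))"
    using assms by (simp add: nat_copy_def Let_def)
  show "?g \<in> mhom A M (nat_copy M)"
    by (intro mhomI) (auto simp: nat_copy_def Let_def h)
  show "bij_betw ?g (carrier M) (carrier (nat_copy M))"
    using inj by (simp add: nat_copy_def Let_def bij_betw_def)
qed

section \<open>Finite vector spaces: dimension and cardinality\<close>

lemma (in vectorspace) finite_carrier:
  assumes "finite (carrier K)" "fin_dim"
  shows "finite (carrier V)"
proof -
  obtain B where B: "finite B" "basis B"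
    using finite_basis_exists assms by blast
  then have BV: "B \<subseteq> carrier V" by (simp add: basis_def)
  have "carrier V \<subseteq> (\<lambda>a. lincomb a B) ` (B \<rightarrow>\<^sub>E carrier K)"
    using basis_criterion[OF B(1) BV] B(2) by blast
  then show ?thesis
    using B(1) assms(1) by (meson finite_PiE finite_imageI finite_subset)
qed

lemma (in vectorspace) fin_dimI:
  assumes "finite (carrier V)"
  shows "fin_dim"
proof -
  have "carrier V \<subseteq> span (carrier V)"
    using in_own_span[of "carrier V"] by blast
  then have "span (carrier V) = carrier V"
    using span_is_subset2[of "carrier V"] by blast
  then show ?thesis
    using assms by (auto simp: fin_dim_def)
qed

text \<open>Coordinates in a basis identify the space with the functions from the basis to the
  field. This is how the dimensions in the Euler form become numbers of homomorphisms.\<close>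

lemma (in vectorspace) card_carrier:
  assumes "finite (carrier V)"
  shows "card (carrier V) = card (carrier K) ^ dim"
proof -
  obtain B where B: "finite B" "basis B"
    using finite_basis_exists fin_dimI assms by blast
  then have BV: "B \<subseteq> carrier V" by (simp add: basis_def)
  have ex1: "\<exists>!a. a \<in> B \<rightarrow>\<^sub>E carrier K \<and> lincomb a B = v" if "v \<in> carrier V" for v
    using basis_criterion[OF B(1) BV] B(2) that by blast
  have cl: "lincomb a B \<in> carrier V" if "a \<in> B \<rightarrow>\<^sub>E carrier K" for a
    using BV that by (intro lincomb_closed) auto
  have "bij_betw (\<lambda>a. lincomb a B) (B \<rightarrow>\<^sub>E carrier K) (carrier V)"
  proof (rule bij_betw_imageI)
    show "inj_on (\<lambda>a. lincomb a B) (B \<rightarrow>\<^sub>E carrier K)"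
      using ex1 cl by (intro inj_onI) metis
    show "(\<lambda>a. lincomb a B) ` (B \<rightarrow>\<^sub>E carrier K) = carrier V"
      using ex1 cl by blast
  qed
  then have "card (B \<rightarrow>\<^sub>E carrier K) = card (carrier V)"
    by (rule bij_betw_same_card)
  then show ?thesis
    using B by (simp add: card_PiE dim_basis)
qed

section \<open>Finite algebras over a finite field: modules and projectivity\<close>

lemma a_kernel_eq: "a_kernel M N f = {x \<in> carrier M. f x = \<zero>\<^bsub>N\<^esub>}"
  by (auto simp: a_kernel_def kernel_def)

text \<open>The axioms mention scalars only in the form c 1_A, because
  \<open>scalar_restriction\<close> and \<open>hom_space\<close> let the field act in this way.
  Finiteness of \<open>A\<close> makes the free module on a finite set finite.\<close>

locale finite_algebra =
  fixes K :: "'k ring" and A :: "('k, 'a) module"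
  assumes field_K: "field K" and finite_K: "finite (carrier K)"
    and ring_A: "ring A" and finite_A: "finite (carrier A)"
    and scalar_closed: "c \<in> carrier K \<Longrightarrow> c \<odot>\<^bsub>A\<^esub> \<one>\<^bsub>A\<^esub> \<in> carrier A"
    and scalar_add: "c \<in> carrier K \<Longrightarrow> d \<in> carrier K \<Longrightarrow>
      (c \<oplus>\<^bsub>K\<^esub> d) \<odot>\<^bsub>A\<^esub> \<one>\<^bsub>A\<^esub> = (c \<odot>\<^bsub>A\<^esub> \<one>\<^bsub>A\<^esub>) \<oplus>\<^bsub>A\<^esub> (d \<odot>\<^bsub>A\<^esub> \<one>\<^bsub>A\<^esub>)"
    and scalar_mult: "c \<in> carrier K \<Longrightarrow> d \<in> carrier K \<Longrightarrow>
      (c \<otimes>\<^bsub>K\<^esub> d) \<odot>\<^bsub>A\<^esub> \<one>\<^bsub>A\<^esub> = (c \<odot>\<^bsub>A\<^esub> \<one>\<^bsub>A\<^esub>) \<otimes>\<^bsub>A\<^esub> (d \<odot>\<^bsub>A\<^esub> \<one>\<^bsub>A\<^esub>)"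
    and scalar_one: "\<one>\<^bsub>K\<^esub> \<odot>\<^bsub>A\<^esub> \<one>\<^bsub>A\<^esub> = \<one>\<^bsub>A\<^esub>"
    and scalar_central: "c \<in> carrier K \<Longrightarrow> a \<in> carrier A \<Longrightarrow>
      (c \<odot>\<^bsub>A\<^esub> \<one>\<^bsub>A\<^esub>) \<otimes>\<^bsub>A\<^esub> a = a \<otimes>\<^bsub>A\<^esub> (c \<odot>\<^bsub>A\<^esub> \<one>\<^bsub>A\<^esub>)"
begin

sublocale K: field K by (rule field_K)
sublocale A: ring A by (rule ring_A)

definition scal :: "('a, 'm) module \<Rightarrow> 'k \<Rightarrow> 'm \<Rightarrow> 'm" where
  "scal M c x = (c \<odot>\<^bsub>A\<^esub> \<one>\<^bsub>A\<^esub>) \<odot>\<^bsub>M\<^esub> x"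

lemma scal_closed: "left_module A M \<Longrightarrow> c \<in> carrier K \<Longrightarrow> x \<in> carrier M \<Longrightarrow> scal M c x \<in> carrier M"
  by (simp add: scal_def left_module.smult_closed scalar_closed)

lemma scal_add: "left_module A M \<Longrightarrow> c \<in> carrier K \<Longrightarrow> x \<in> carrier M \<Longrightarrow> y \<in> carrier M \<Longrightarrow>
    scal M c (x \<oplus>\<^bsub>M\<^esub> y) = scal M c x \<oplus>\<^bsub>M\<^esub> scal M c y"
  by (simp add: scal_def left_module.smult_r_distr scalar_closed)

lemma scal_left_add: "left_module A M \<Longrightarrow> c \<in> carrier K \<Longrightarrow> d \<in> carrier K \<Longrightarrow> x \<in> carrier M \<Longrightarrow>
    scal M (c \<oplus>\<^bsub>K\<^esub> d) x = scal M c x \<oplus>\<^bsub>M\<^esub> scal M d x"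
  by (simp add: scal_def left_module.smult_l_distr scalar_closed scalar_add)

lemma scal_scal: "left_module A M \<Longrightarrow> c \<in> carrier K \<Longrightarrow> d \<in> carrier K \<Longrightarrow> x \<in> carrier M \<Longrightarrow>
    scal M (c \<otimes>\<^bsub>K\<^esub> d) x = scal M c (scal M d x)"
  by (simp add: scal_def left_module.smult_assoc scalar_closed scalar_mult)

lemma scal_one: "left_module A M \<Longrightarrow> x \<in> carrier M \<Longrightarrow> scal M \<one>\<^bsub>K\<^esub> x = x"
  by (simp add: scal_def left_module.smult_one scalar_one)

lemma scal_smult: "left_module A M \<Longrightarrow> c \<in> carrier K \<Longrightarrow> a \<in> carrier A \<Longrightarrow> x \<in> carrier M \<Longrightarrow>
    scal M c (a \<odot>\<^bsub>M\<^esub> x) = a \<odot>\<^bsub>M\<^esub> scal M c x"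
  by (simp add: scal_def scalar_closed scalar_central flip: left_module.smult_assoc)

lemma scal_mhom: "left_module A M \<Longrightarrow> c \<in> carrier K \<Longrightarrow> scal M c \<in> mhom A M M"
  by (intro mhomI) (auto simp: scal_closed scal_add scal_smult)

lemma mhom_scal: "f \<in> mhom A M N \<Longrightarrow> c \<in> carrier K \<Longrightarrow> x \<in> carrier M \<Longrightarrow>
    f (scal M c x) = scal N c (f x)"
  by (simp add: scal_def mhom_smult scalar_closed)

lemma vectorspace_scalar_restriction:
  assumes "left_module A M"
  shows "vectorspace K (scalar_restriction A M)"
proof -
  interpret M: left_module A M by fact
  have "abelian_group (scalar_restriction A M)"
  proof (rule abelian_groupI)
    fix x assume "x \<in> carrier (scalar_restriction A M)"
    then show "\<exists>y\<in>carrier (scalar_restriction A M).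
        y \<oplus>\<^bsub>scalar_restriction A M\<^esub> x = \<zero>\<^bsub>scalar_restriction A M\<^esub>"
      by (intro bexI[of _ "\<ominus>\<^bsub>M\<^esub> x"]) (auto simp: scalar_restriction_def M.M.l_neg)
  qed (auto simp: scalar_restriction_def M.M.a_ac)
  then have "module K (scalar_restriction A M)"
    using assms
    by (intro moduleI K.is_cring)
      (auto simp: scalar_restriction_def scal_closed scal_add scal_left_add scal_scal scal_one
        simp flip: scal_def)
  then show ?thesis
    by (intro vectorspace.intro field_K)
qed

text \<open>Over a finite field, a vector space is finite-dimensional exactly when it is a finite
  set, so dimension arguments turn into counting.\<close>

lemma fd_module_iff: "fd_module K A M \<longleftrightarrow> left_module A M \<and> finite (carrier M)"
proof (cases "left_module A M")
  case True
  interpret vectorspace K "scalar_restriction A M"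
    using True by (rule vectorspace_scalar_restriction)
  have "carrier (scalar_restriction A M) = carrier M"
    by (simp add: scalar_restriction_def)
  then show ?thesis
    using True finite_carrier finite_K fin_dimI by (auto simp: fd_module_def)
qed (simp add: fd_module_def)

lemma projectiveD:
  assumes "projective K A P"
  shows "left_module A P" "finite (carrier P)"
  using assms by (auto simp: projective_def fd_module_iff)

text \<open>The definition lifts only along surjections between modules on \<open>nat\<close>.
  Conjugating g with the numberings of M and N reduces modules of any type to that case; N is finite
  as an image of M.\<close>

lemma projective_lift:
  fixes M :: "('a, 'm) module" and N :: "('a, 'n) module"
  assumes P: "projective K A P"
    and M: "left_module A M" "finite (carrier M)" and N: "left_module A N"
    and g: "g \<in> mhom A M N" "g ` carrier M = carrier N" and h: "h \<in> mhom A P N"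
  obtains h' where "h' \<in> mhom A P M" "\<And>x. x \<in> carrier P \<Longrightarrow> g (h' x) = h x"
proof -
  have N': "finite (carrier N)"
    using g M by (metis finite_imageI)
  let ?m = "to_nat_on (carrier M)" and ?n = "to_nat_on (carrier N)"
  let ?m' = "inv_into (carrier M) ?m"
  note cM = nat_copy[OF M] and cN = nat_copy[OF N N']
  have m': "?m' \<in> mhom A (nat_copy M) M"
    by (rule mhom_inv_into[OF M(1) cM(3,4)])
  have inv: "?m' (?m x) = x" if "x \<in> carrier M" for x
    using cM(4) that by (simp add: bij_betw_def)
  have sur: "?m' y \<in> carrier M \<and> ?m (?m' y) = y" if "y \<in> carrier (nat_copy M)" for y
    using cM(4) that by (metis bij_betw_def f_inv_into_f inv_into_into)
  let ?g = "\<lambda>x. ?n (g (?m' x))" and ?h = "\<lambda>x. ?n (h x)"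
  have g': "?g \<in> mhom A (nat_copy M) (nat_copy N)"
    by (intro mhom_compose[OF mhom_compose[OF m' g(1)] cN(3)])
  have h': "?h \<in> mhom A P (nat_copy N)"
    by (intro mhom_compose[OF h cN(3)])
  have "?m' ` carrier (nat_copy M) = carrier M"
    using cM(4) inv by (force simp: bij_betw_def)
  moreover have "?g ` carrier (nat_copy M) = ?n ` g ` ?m' ` carrier (nat_copy M)"
    by (simp add: image_image)
  ultimately have "?g ` carrier (nat_copy M) = carrier (nat_copy N)"
    using g(2) cN(4) by (simp add: bij_betw_def)
  moreover have "fd_module K A (nat_copy M)" "fd_module K A (nat_copy N)"
    using cM cN by (simp_all add: fd_module_iff)
  ultimately obtain k where k: "k \<in> mhom A P (nat_copy M)" "\<And>x. x \<in> carrier P \<Longrightarrow> ?g (k x) = ?h x"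
    using P g' h' unfolding projective_def by meson
  show ?thesis
  proof
    show "(\<lambda>x. ?m' (k x)) \<in> mhom A P M"
      by (rule mhom_compose[OF k(1) m'])
    fix x assume x: "x \<in> carrier P"
    then have "?n (g (?m' (k x))) = ?n (h x)" by (rule k(2))
    moreover have "g (?m' (k x)) \<in> carrier N" "h x \<in> carrier N"
      using x k(1) m' g(1) h by (simp_all add: mhom_closed)
    moreover have "inj_on ?n (carrier N)"
      using cN(4) by (simp add: bij_betw_def)
    ultimately show "g (?m' (k x)) = h x"
      by (simp add: inj_on_eq_iff)
  qed
qed

text \<open>A lift is found on each summand separately, and the two lifts are added.\<close>

lemma projective_direct_sum:
  assumes P: "projective K A P" and Q: "projective K A Q"
  shows "projective K A (direct_sum P Q)"
proof -
  note lP = projectiveD[OF P] and lQ = projectiveD[OF Q]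
  have "\<exists>h'\<in>mhom A (direct_sum P Q) M. \<forall>x\<in>carrier (direct_sum P Q). g (h' x) = h x"
    if M: "fd_module K A M" and N: "fd_module K A N" and g: "g \<in> mhom A M N"
      "g ` carrier M = carrier N" and h: "h \<in> mhom A (direct_sum P Q) N"
    for M N :: "('a, nat) module" and g h
  proof -
    interpret P: left_module A P by (rule lP)
    interpret Q: left_module A Q by (rule lQ)
    have lM: "left_module A M" "finite (carrier M)" and lN: "left_module A N"
      using M N by (auto simp: fd_module_iff)
    interpret M: left_module A M by fact
    have "(\<lambda>x. (x, \<zero>\<^bsub>Q\<^esub>)) \<in> mhom A P (direct_sum P Q)"
      by (intro mhomI) (auto simp: Q.smult_zero_right)
    from mhom_compose[OF this h] obtain k1 where k1: "k1 \<in> mhom A P M"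
        "\<And>x. x \<in> carrier P \<Longrightarrow> g (k1 x) = h (x, \<zero>\<^bsub>Q\<^esub>)"
      using projective_lift[OF P lM lN g] by metis
    have "(\<lambda>x. (\<zero>\<^bsub>P\<^esub>, x)) \<in> mhom A Q (direct_sum P Q)"
      by (intro mhomI) (auto simp: P.smult_zero_right)
    from mhom_compose[OF this h] obtain k2 where k2: "k2 \<in> mhom A Q M"
        "\<And>x. x \<in> carrier Q \<Longrightarrow> g (k2 x) = h (\<zero>\<^bsub>P\<^esub>, x)"
      using projective_lift[OF Q lM lN g] by metis
    show ?thesis
    proof (intro bexI ballI)
      show "(\<lambda>(x, y). k1 x \<oplus>\<^bsub>M\<^esub> k2 y) \<in> mhom A (direct_sum P Q) M"
        using k1(1) k2(1)
        by (intro mhomI)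
          (auto simp: mhom_closed mhom_add mhom_smult M.smult_r_distr M.M.a_ac)
      fix z assume "z \<in> carrier (direct_sum P Q)"
      then obtain x y where z: "z = (x, y)" "x \<in> carrier P" "y \<in> carrier Q" by auto
      then have "g (k1 x \<oplus>\<^bsub>M\<^esub> k2 y) = h (x, \<zero>\<^bsub>Q\<^esub>) \<oplus>\<^bsub>N\<^esub> h (\<zero>\<^bsub>P\<^esub>, y)"
        using k1 k2 g by (simp add: mhom_add mhom_closed)
      also have "\<dots> = h (x, y)"
        using mhom_add[OF h, of "(x, \<zero>\<^bsub>Q\<^esub>)" "(\<zero>\<^bsub>P\<^esub>, y)"] z by simp
      finally show "g ((\<lambda>(x, y). k1 x \<oplus>\<^bsub>M\<^esub> k2 y) z) = h z"
        by (simp add: z)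
    qed
  qed
  then show ?thesis
    using lP lQ by (auto simp: projective_def fd_module_iff left_module_direct_sum)
qed

lemma projective_iso:
  assumes P: "projective K A P" and Q: "left_module A Q"
    and f: "f \<in> mhom A P Q" "bij_betw f (carrier P) (carrier Q)"
  shows "projective K A Q"
proof -
  note lP = projectiveD[OF P]
  let ?f' = "inv_into (carrier P) f"
  have f': "?f' \<in> mhom A Q P"
    by (rule mhom_inv_into[OF lP(1) f])
  have inv: "f (?f' y) = y" if "y \<in> carrier Q" for y
    using f(2) that by (metis bij_betw_def f_inv_into_f)
  have "\<exists>h'\<in>mhom A Q M. \<forall>x\<in>carrier Q. g (h' x) = h x"
    if M: "fd_module K A M" and N: "fd_module K A N" and g: "g \<in> mhom A M N"
      "g ` carrier M = carrier N" and h: "h \<in> mhom A Q N"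
    for M N :: "('a, nat) module" and g h
  proof -
    have lM: "left_module A M" "finite (carrier M)" and lN: "left_module A N"
      using M N by (auto simp: fd_module_iff)
    obtain k where k: "k \<in> mhom A P M" "\<And>x. x \<in> carrier P \<Longrightarrow> g (k x) = h (f x)"
      using projective_lift[OF P lM lN g mhom_compose[OF f(1) h]] by metis
    show ?thesis
      using mhom_compose[OF f' k(1)] k(2) mhom_closed[OF f'] inv
      by (intro bexI[of _ "\<lambda>x. k (?f' x)"]) auto
  qed
  moreover have "finite (carrier Q)"
    using f(2) lP(2) by (simp add: bij_betw_finite)
  ultimately show ?thesis
    using Q by (auto simp: projective_def fd_module_iff)
qed

text \<open>The lift of the identity. All splittings below come from here: of the free cover, of an
  exact sequence of complexes, and of the surjection from the regular module onto a projective
  cover.\<close>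

lemma projective_split:
  fixes M :: "('a, 'm) module"
  assumes P: "projective K A P" and M: "left_module A M" "finite (carrier M)"
    and g: "g \<in> mhom A M P" "g ` carrier M = carrier P"
  obtains s where "s \<in> mhom A P M" "\<And>x. x \<in> carrier P \<Longrightarrow> g (s x) = x"
  using projective_lift[OF P M projectiveD(1)[OF P] g mhom_id] by metis

lemma vectorspace_hom_space:
  assumes M: "left_module A M" and N: "left_module A N"
  shows "vectorspace K (hom_space A M N)"
proof -
  interpret M: left_module A M by fact
  interpret N: left_module A N by fact
  have "abelian_group (hom_space A M N)"
  proof (rule abelian_groupI)
    fix f g assume "f \<in> carrier (hom_space A M N)" "g \<in> carrier (hom_space A M N)"
    then show "f \<oplus>\<^bsub>hom_space A M N\<^esub> g \<in> carrier (hom_space A M N)"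
      using M N
      by (auto simp: carrier_hom_space)
        (auto simp: hom_space_def homs_mhom intro!: homs_restrict mhom_add_map)
  next
    show "\<zero>\<^bsub>hom_space A M N\<^esub> \<in> carrier (hom_space A M N)"
      using M N unfolding carrier_hom_space
      by (auto simp: hom_space_def intro!: homs_restrict mhom_zero_map)
  next
    fix f assume f: "f \<in> carrier (hom_space A M N)"
    let ?g = "\<lambda>x\<in>carrier M. \<ominus>\<^bsub>N\<^esub> f x"
    have "?g \<in> carrier (hom_space A M N)"
      using M N f unfolding carrier_hom_space
      by (intro homs_restrict mhom_uminus_map) (auto simp: homs_mhom)
    moreover have "?g \<oplus>\<^bsub>hom_space A M N\<^esub> f = \<zero>\<^bsub>hom_space A M N\<^esub>"
      using f by (auto simp: hom_space_def mhom_closed N.M.l_neg intro!: restrict_ext)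
    ultimately show "\<exists>g\<in>carrier (hom_space A M N).
        g \<oplus>\<^bsub>hom_space A M N\<^esub> f = \<zero>\<^bsub>hom_space A M N\<^esub>"
      by blast
  next
    fix f assume "f \<in> carrier (hom_space A M N)"
    then show "\<zero>\<^bsub>hom_space A M N\<^esub> \<oplus>\<^bsub>hom_space A M N\<^esub> f = f"
      by (intro extensionalityI[of _ "carrier M"]) (auto simp: hom_space_def mhom_closed)
  qed (auto simp: hom_space_def mhom_closed N.M.a_ac intro!: restrict_ext)
  moreover have "c \<odot>\<^bsub>hom_space A M N\<^esub> f \<in> carrier (hom_space A M N)"
    if "c \<in> carrier K" "f \<in> carrier (hom_space A M N)" for c f
  proof -
    have "(\<lambda>x. scal N c (f x)) \<in> mhom A M N"
      using that N by (intro mhom_compose[OF _ scal_mhom]) (auto simp: carrier_hom_space homs_mhom)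
    from homs_restrict[OF M this] show ?thesis
      unfolding carrier_hom_space by (simp add: hom_space_def scal_def)
  qed
  ultimately have "module K (hom_space A M N)"
    using N
    apply (intro moduleI K.is_cring)
         apply assumption
        apply assumption
       apply (auto simp: hom_space_def mhom_closed scal_add scal_left_add scal_scal scal_closed
         simp flip: scal_def intro!: restrict_ext)[3]
    apply (rule extensionalityI[of _ "carrier M"])
      apply (auto simp: hom_space_def mhom_closed scal_one simp flip: scal_def)
    done
  then show ?thesis
    by (intro vectorspace.intro field_K)
qed

lemma card_homs_dim:
  assumes "left_module A M" "left_module A N" "finite (carrier M)" "finite (carrier N)"
  shows "card (homs A M N) = card (carrier K) ^ vectorspace.dim K (hom_space A M N)"
  using vectorspace.card_carrier[OF vectorspace_hom_space[OF assms(1,2)], unfolded carrier_hom_space,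
      OF finite_homs[OF assms(3,4)]] .

end

section \<open>Vanishing of Ext^1 on projectives, and the twist as a number of homomorphisms\<close>

lemma PiE_carrier: "f \<in> B \<rightarrow>\<^sub>E S \<Longrightarrow> b \<in> B \<Longrightarrow> f b \<in> S"
  by auto

lemma (in left_module) smult_finsum:
  assumes "a \<in> carrier A" "finite S" "f \<in> S \<rightarrow> carrier M"
  shows "a \<odot>\<^bsub>M\<^esub> (\<Oplus>\<^bsub>M\<^esub>i\<in>S. f i) = (\<Oplus>\<^bsub>M\<^esub>i\<in>S. a \<odot>\<^bsub>M\<^esub> f i)"
  using assms(2,3)
proof (induction S rule: finite_induct)
  case (insert x S)
  then have "f x \<in> carrier M" "f \<in> S \<rightarrow> carrier M" by auto
  then show ?case
    using insert assms(1)
    by (subst (1 2) M.finsum_insert) (auto simp: smult_closed smult_r_distr Pi_iff)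
qed (simp add: assms smult_zero_right)

lemma left_module_submodule:
  fixes M :: "('a, 'm) module"
  assumes "left_module A M" "left_submodule A N M"
  shows "left_module A (M\<lparr>carrier := N\<rparr>)"
proof -
  interpret left_module A M by fact
  have sub: "x \<in> carrier M" if "x \<in> N" for x
    using assms that by (auto simp: left_submodule_def)
  have inv: "\<ominus>\<^bsub>M\<^esub> x \<in> N" if "x \<in> N" for x
  proof -
    have "(\<ominus>\<^bsub>A\<^esub> \<one>\<^bsub>A\<^esub>) \<odot>\<^bsub>M\<^esub> x \<in> N"
      using assms that by (auto simp: left_submodule_def)
    then show ?thesis
      using that sub by (simp add: smult_minus_left smult_one)
  qed
  have "abelian_group (M\<lparr>carrier := N\<rparr>)"
  proof (rule abelian_groupI)
    fix x assume "x \<in> carrier (M\<lparr>carrier := N\<rparr>)"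
    then show "\<exists>y\<in>carrier (M\<lparr>carrier := N\<rparr>). y \<oplus>\<^bsub>M\<lparr>carrier := N\<rparr>\<^esub> x = \<zero>\<^bsub>M\<lparr>carrier := N\<rparr>\<^esub>"
      using inv sub by (intro bexI[of _ "\<ominus>\<^bsub>M\<^esub> x"]) (auto simp: M.l_neg)
  qed (use assms in \<open>auto simp: left_submodule_def sub M.a_ac\<close>)
  moreover have "left_module_axioms A (M\<lparr>carrier := N\<rparr>)"
    using assms
    by unfold_locales
      (auto simp: left_submodule_def sub smult_l_distr smult_r_distr smult_assoc smult_one)
  ultimately show ?thesis
    by (intro left_module.intro A.ring_axioms)
qed

lemma (in abelian_group) carrier_rcos:
  assumes "a \<in> carrier G"
  shows "carrier G +> a = carrier G"
proof
  show "carrier G +> a \<subseteq> carrier G"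
    using assms by (auto simp: a_r_coset_def r_coset_def)
  show "carrier G \<subseteq> carrier G +> a"
  proof
    fix y assume y: "y \<in> carrier G"
    then have "y = (y \<oplus> \<ominus> a) \<oplus> a"
      using assms by (simp add: a_assoc l_neg)
    then show "y \<in> carrier G +> a"
      using y assms by (auto simp: a_r_coset_def r_coset_def intro!: bexI[of _ "y \<oplus> \<ominus> a"])
  qed
qed

context finite_algebra
begin

lemma left_module_free_module: "left_module A (free_module A B)"
proof -
  have "abelian_group (free_module A B)"
  proof (rule abelian_groupI)
    fix f g assume f: "f \<in> carrier (free_module A B)" and g: "g \<in> carrier (free_module A B)"
    have "{b \<in> B. f b \<oplus>\<^bsub>A\<^esub> g b \<noteq> \<zero>\<^bsub>A\<^esub>} \<subseteq> {b \<in> B. f b \<noteq> \<zero>\<^bsub>A\<^esub>} \<union> {b \<in> B. g b \<noteq> \<zero>\<^bsub>A\<^esub>}"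
      by auto
    then have "finite {b \<in> B. f b \<oplus>\<^bsub>A\<^esub> g b \<noteq> \<zero>\<^bsub>A\<^esub>}"
      using f g by (elim finite_subset) (auto simp: free_module_def)
    then show "f \<oplus>\<^bsub>free_module A B\<^esub> g \<in> carrier (free_module A B)"
      using f g by (auto simp: free_module_def PiE_carrier cong: conj_cong)
  next
    fix f assume f: "f \<in> carrier (free_module A B)"
    then show "\<zero>\<^bsub>free_module A B\<^esub> \<oplus>\<^bsub>free_module A B\<^esub> f = f"
      by (intro extensionalityI[of _ B]) (auto simp: free_module_def PiE_def Pi_iff)
    let ?g = "\<lambda>b\<in>B. \<ominus>\<^bsub>A\<^esub> f b"
    have "{b \<in> B. \<ominus>\<^bsub>A\<^esub> f b \<noteq> \<zero>\<^bsub>A\<^esub>} \<subseteq> {b \<in> B. f b \<noteq> \<zero>\<^bsub>A\<^esub>}"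
      by auto
    then have "finite {b \<in> B. \<ominus>\<^bsub>A\<^esub> f b \<noteq> \<zero>\<^bsub>A\<^esub>}"
      using f by (elim finite_subset) (auto simp: free_module_def)
    then have "?g \<in> carrier (free_module A B)"
      using f by (auto simp: free_module_def PiE_carrier cong: conj_cong)
    moreover have "?g \<oplus>\<^bsub>free_module A B\<^esub> f = \<zero>\<^bsub>free_module A B\<^esub>"
      using f by (auto simp: free_module_def PiE_carrier A.l_neg intro!: restrict_ext)
    ultimately show "\<exists>g\<in>carrier (free_module A B).
        g \<oplus>\<^bsub>free_module A B\<^esub> f = \<zero>\<^bsub>free_module A B\<^esub>"
      by blast
  qed (auto simp: free_module_def PiE_carrier A.a_ac cong: conj_cong intro!: restrict_ext)
  moreover have "left_module_axioms A (free_module A B)"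
  proof (unfold_locales, goal_cases)
    case (1 a f)
    have "{b \<in> B. a \<otimes>\<^bsub>A\<^esub> f b \<noteq> \<zero>\<^bsub>A\<^esub>} \<subseteq> {b \<in> B. f b \<noteq> \<zero>\<^bsub>A\<^esub>}"
      using 1 by auto
    then have "finite {b \<in> B. a \<otimes>\<^bsub>A\<^esub> f b \<noteq> \<zero>\<^bsub>A\<^esub>}"
      using 1 by (elim finite_subset) (auto simp: free_module_def)
    then show ?case
      using 1 by (auto simp: free_module_def PiE_carrier cong: conj_cong)
  next
    case (5 f)
    then show ?case
      by (intro extensionalityI[of _ B]) (auto simp: free_module_def PiE_def Pi_iff)
  qed (auto simp: free_module_def PiE_carrier A.l_distr A.r_distr A.m_assoc intro!: restrict_ext)
  ultimately show ?thesis
    by (intro left_module.intro ring_A)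
qed

lemma carrier_free_module: "finite B \<Longrightarrow> carrier (free_module A B) = B \<rightarrow>\<^sub>E carrier A"
  by (auto simp: free_module_def)

text \<open>The support of \<phi> varies with \<phi>. Summing over the whole finite carrier gives a
  fixed index set, so that additivity can be checked term by term.\<close>

lemma free_cover_finite:
  assumes "left_module A M" "finite (carrier M)" "\<phi> \<in> carrier (free_module A (carrier M))"
  shows "free_cover A M \<phi> = (\<Oplus>\<^bsub>M\<^esub>x\<in>carrier M. \<phi> x \<odot>\<^bsub>M\<^esub> x)"
proof -
  interpret M: left_module A M by fact
  have \<phi>: "\<phi> x \<in> carrier A" if "x \<in> carrier M" for x
    using assms that by (auto simp: carrier_free_module)
  show ?thesis
    unfolding free_cover_def
    by (rule M.M.add.finprod_mono_neutral_cong_left)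
      (use assms \<phi> in \<open>auto simp: M.smult_zero_left M.smult_closed\<close>)
qed

lemma free_cover_mhom:
  assumes M: "left_module A M" "finite (carrier M)"
  shows "free_cover A M \<in> mhom A (free_module A (carrier M)) M"
proof -
  interpret M: left_module A M by fact
  interpret F: left_module A "free_module A (carrier M)" by (rule left_module_free_module)
  note C = carrier_free_module[OF M(2)]
  have cl: "(\<lambda>x. \<phi> x \<odot>\<^bsub>M\<^esub> x) \<in> carrier M \<rightarrow> carrier M"
    if "\<phi> \<in> carrier (free_module A (carrier M))" for \<phi>
    using that by (auto simp: C intro!: M.smult_closed dest: PiE_carrier)
  show ?thesis
  proof (rule mhomI)
    fix \<phi> assume "\<phi> \<in> carrier (free_module A (carrier M))"
    then show "free_cover A M \<phi> \<in> carrier M"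
      using M cl by (simp add: free_cover_finite M.M.finsum_closed)
  next
    fix \<phi> \<psi> assume p: "\<phi> \<in> carrier (free_module A (carrier M))" "\<psi> \<in> carrier (free_module A (carrier M))"
    have "free_cover A M (\<phi> \<oplus>\<^bsub>free_module A (carrier M)\<^esub> \<psi>) =
        (\<Oplus>\<^bsub>M\<^esub>x\<in>carrier M. (\<phi> \<oplus>\<^bsub>free_module A (carrier M)\<^esub> \<psi>) x \<odot>\<^bsub>M\<^esub> x)"
      using M p by (intro free_cover_finite) auto
    also have "\<dots> = (\<Oplus>\<^bsub>M\<^esub>x\<in>carrier M. \<phi> x \<odot>\<^bsub>M\<^esub> x \<oplus>\<^bsub>M\<^esub> \<psi> x \<odot>\<^bsub>M\<^esub> x)"
      using p cl by (intro M.M.finsum_cong') (auto simp: C free_module_def PiE_carrier M.smult_l_distr)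
    also have "\<dots> = free_cover A M \<phi> \<oplus>\<^bsub>M\<^esub> free_cover A M \<psi>"
      using M p cl by (subst M.M.finsum_addf) (auto simp: free_cover_finite)
    finally show "free_cover A M (\<phi> \<oplus>\<^bsub>free_module A (carrier M)\<^esub> \<psi>) =
        free_cover A M \<phi> \<oplus>\<^bsub>M\<^esub> free_cover A M \<psi>" .
  next
    fix a \<phi> assume p: "a \<in> carrier A" "\<phi> \<in> carrier (free_module A (carrier M))"
    have "free_cover A M (a \<odot>\<^bsub>free_module A (carrier M)\<^esub> \<phi>) =
        (\<Oplus>\<^bsub>M\<^esub>x\<in>carrier M. (a \<odot>\<^bsub>free_module A (carrier M)\<^esub> \<phi>) x \<odot>\<^bsub>M\<^esub> x)"
      using M p by (intro free_cover_finite) (auto simp: F.smult_closed)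
    also have "\<dots> = (\<Oplus>\<^bsub>M\<^esub>x\<in>carrier M. a \<odot>\<^bsub>M\<^esub> (\<phi> x \<odot>\<^bsub>M\<^esub> x))"
      using p cl
      by (intro M.M.finsum_cong')
        (auto simp: C free_module_def PiE_carrier M.smult_assoc M.smult_closed)
    also have "\<dots> = a \<odot>\<^bsub>M\<^esub> free_cover A M \<phi>"
      using M p cl by (simp add: free_cover_finite M.smult_finsum)
    finally show "free_cover A M (a \<odot>\<^bsub>free_module A (carrier M)\<^esub> \<phi>) = a \<odot>\<^bsub>M\<^esub> free_cover A M \<phi>" .
  qed
qed

lemma free_cover_surj:
  assumes M: "left_module A M" "finite (carrier M)"
  shows "free_cover A M ` carrier (free_module A (carrier M)) = carrier M"
proof
  interpret M: left_module A M by fact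
  show "free_cover A M ` carrier (free_module A (carrier M)) \<subseteq> carrier M"
    using free_cover_mhom[OF M] by (auto simp: mhom_closed)
  show "carrier M \<subseteq> free_cover A M ` carrier (free_module A (carrier M))"
  proof
    fix m assume m: "m \<in> carrier M"
    let ?\<phi> = "\<lambda>x\<in>carrier M. if m = x then \<one>\<^bsub>A\<^esub> else \<zero>\<^bsub>A\<^esub>"
    have p: "?\<phi> \<in> carrier (free_module A (carrier M))"
      by (auto simp: carrier_free_module[OF M(2)])
    have "free_cover A M ?\<phi> = (\<Oplus>\<^bsub>M\<^esub>x\<in>carrier M. if m = x then x else \<zero>\<^bsub>M\<^esub>)"
      unfolding free_cover_finite[OF M p]
      by (intro M.M.finsum_cong') (auto simp: M.smult_one M.smult_zero_left)
    also have "\<dots> = m"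
      using m M(2) by (intro M.M.add.finprod_singleton) auto
    finally show "m \<in> free_cover A M ` carrier (free_module A (carrier M))"
      using p by (metis imageI)
  qed
qed

lemma left_module_syzygy:
  assumes M: "left_module A M" "finite (carrier M)"
  shows "left_module A (syzygy A M)"
proof -
  let ?F = "free_module A (carrier M)"
  interpret M: left_module A M by fact
  interpret F: left_module A ?F by (rule left_module_free_module)
  note c = free_cover_mhom[OF M]
  have "left_submodule A {\<phi> \<in> carrier ?F. free_cover A M \<phi> = \<zero>\<^bsub>M\<^esub>} ?F"
    using c mhom_zero[OF left_module_free_module M(1) c]
    by (auto simp: left_submodule_def mhom_add mhom_smult F.smult_closed M.smult_zero_right)
  from left_module_submodule[OF left_module_free_module this] show ?thesis
    by (simp add: syzygy_def)
qed

text \<open>The vanishing of Ext^1(P, N). A splitting s of the free cover c gives the retraction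
  \<phi> - s(c(\<phi>)) of F onto the syzygy, and composition with it extends every map on the
  syzygy to F.\<close>

lemma carrier_ext1_space:
  assumes P: "projective K A P" and N: "left_module A (N :: ('a, 'n) module)"
  shows "(\<lambda>f. restrict f (carrier (syzygy A P))) ` carrier (hom_space A (free_module A (carrier P)) N)
    = carrier (hom_space A (syzygy A P) N)"
proof -
  note lP = projectiveD[OF P]
  let ?F = "free_module A (carrier P)" and ?S = "syzygy A P"
  interpret P: left_module A P by (rule lP)
  interpret N: left_module A N by fact
  interpret F: left_module A ?F by (rule left_module_free_module)
  have lF: "left_module A ?F" and lS: "left_module A ?S"
    using lP by (auto intro: left_module_free_module left_module_syzygy)
  have fF: "finite (carrier ?F)"
    using lP finite_A by (auto simp: carrier_free_module intro!: finite_PiE)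
  have S: "carrier ?S = {\<phi> \<in> carrier ?F. free_cover A P \<phi> = \<zero>\<^bsub>P\<^esub>}"
    and opS: "add ?S = add ?F" "smult ?S = smult ?F"
    by (simp_all add: syzygy_def)
  note c = free_cover_mhom[OF lP]
  obtain s where s: "s \<in> mhom A P ?F" "\<And>x. x \<in> carrier P \<Longrightarrow> free_cover A P (s x) = x"
    using projective_split[OF P lF fF c free_cover_surj[OF lP]] by metis
  let ?p = "\<lambda>\<phi>. \<phi> \<ominus>\<^bsub>?F\<^esub> s (free_cover A P \<phi>)"
  have sc: "s (free_cover A P \<phi>) \<in> carrier ?F" if "\<phi> \<in> carrier ?F" for \<phi>
    using that s(1) c by (simp add: mhom_closed)
  have "(\<lambda>\<phi>. \<phi> \<oplus>\<^bsub>?F\<^esub> (\<ominus>\<^bsub>?F\<^esub> s (free_cover A P \<phi>))) \<in> mhom A ?F ?F"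
    by (intro mhom_add_map mhom_uminus_map lF mhom_id mhom_compose[OF c s(1)])
  then have pF: "?p \<in> mhom A ?F ?F"
    by (simp add: a_minus_def)
  have pS: "?p \<phi> \<in> carrier ?S" if "\<phi> \<in> carrier ?F" for \<phi>
  proof -
    have "free_cover A P (?p \<phi>) = free_cover A P \<phi> \<ominus>\<^bsub>P\<^esub> free_cover A P (s (free_cover A P \<phi>))"
      using that sc by (intro mhom_minus[OF lF lP(1) c])
    also have "\<dots> = \<zero>\<^bsub>P\<^esub>"
      using that s(2) mhom_closed[OF c] by (simp add: P.M.r_neg a_minus_def)
    finally show ?thesis
      using that sc by (simp add: S)
  qed
  have p: "?p \<in> mhom A ?F ?S"
    using pF pS by (simp add: LinearCombinations.module_hom_def opS)
  show ?thesis
  proof (intro equalityI subsetI)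
    fix f assume "f \<in> (\<lambda>f. restrict f (carrier ?S)) ` carrier (hom_space A ?F N)"
    then obtain g where g: "g \<in> homs A ?F N" "f = restrict g (carrier ?S)"
      by (auto simp: carrier_hom_space)
    have "g \<in> mhom A ?S N"
      using g(1) by (auto simp: homs_def LinearCombinations.module_hom_def S opS)
    then show "f \<in> carrier (hom_space A ?S N)"
      using g(2) lS by (simp add: carrier_hom_space homs_restrict)
  next
    fix f assume "f \<in> carrier (hom_space A ?S N)"
    then have f: "f \<in> homs A ?S N" by (simp add: carrier_hom_space)
    have "(\<lambda>\<phi>. f (?p \<phi>)) \<in> mhom A ?F N"
      using p f by (intro mhom_compose[OF p]) (simp add: homs_mhom)
    then have "restrict (\<lambda>\<phi>. f (?p \<phi>)) (carrier ?F) \<in> carrier (hom_space A ?F N)"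
      using lF by (simp add: carrier_hom_space homs_restrict)
    moreover have "f = restrict (restrict (\<lambda>\<phi>. f (?p \<phi>)) (carrier ?F)) (carrier ?S)"
    proof (rule extensionalityI[of _ "carrier ?S"])
      fix \<phi> assume "\<phi> \<in> carrier ?S"
      then have "\<phi> \<in> carrier ?F" "?p \<phi> = \<phi>"
        using mhom_zero[OF lP(1) lF s(1)] by (auto simp: S a_minus_def F.M.r_zero)
      then show "f \<phi> = restrict (restrict (\<lambda>\<phi>. f (?p \<phi>)) (carrier ?F)) (carrier ?S) \<phi>"
        using \<open>\<phi> \<in> carrier ?S\<close> by simp
    qed (use f in \<open>auto simp: homs_def\<close>)
    ultimately show "f \<in> (\<lambda>f. restrict f (carrier ?S)) ` carrier (hom_space A ?F N)"
      by blast
  qed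
qed

text \<open>The subspace divided out is the whole space, so the quotient has one element and q^dim =
  1. The vector space laws are checked directly on that single coset.\<close>

lemma dim_ext1_space:
  assumes P: "projective K A P" and N: "left_module A (N :: ('a, 'n) module)"
  shows "vectorspace.dim K (ext1_space A P N) = 0"
proof -
  let ?V = "hom_space A (syzygy A P) N"
  let ?E = "ext1_space A P N" and ?W = "carrier ?V"
  note lP = projectiveD[OF P]
  interpret V: vectorspace K ?V
    by (rule vectorspace_hom_space[OF left_module_syzygy[OF lP] N])
  have E: "?E = module_quot ?V ?W"
    unfolding ext1_space_def carrier_ext1_space[OF P N] ..
  have W: "?W +>\<^bsub>?V\<^esub> a = ?W" if "a \<in> ?W" for a
    using that by (rule V.carrier_rcos)
  have ne: "?W \<noteq> {}" by auto
  have cE: "carrier ?E = {?W}"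
    using W ne by (auto simp: E module_quot_def FactRing_def A_RCOSETS_def' a_r_coset_def)
  have zE: "\<zero>\<^bsub>?E\<^esub> = ?W"
    by (simp add: E module_quot_def FactRing_def)
  have "set_add ?V ?W ?W = ?W"
  proof -
    have "set_add ?V ?W ?W = (\<Union>a\<in>?W. ?W +>\<^bsub>?V\<^esub> a)"
      by (auto simp: set_add_def' a_r_coset_def')
    then show ?thesis using W ne by simp
  qed
  then have aE: "?W \<oplus>\<^bsub>?E\<^esub> ?W = ?W"
    by (simp add: E module_quot_def FactRing_def)
  have sE: "c \<odot>\<^bsub>?E\<^esub> ?W = ?W" if "c \<in> carrier K" for c
    using that W ne by (simp add: E module_quot_def V.smult_closed)
  have "abelian_group ?E"
    by (rule abelian_groupI) (auto simp: cE zE aE)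
  then have "module K ?E"
    by (intro moduleI K.is_cring) (auto simp: cE zE aE sE)
  then interpret E: vectorspace K ?E
    by (intro vectorspace.intro field_K)
  have "card (carrier K) ^ E.dim = 1"
    using E.card_carrier by (simp add: cE)
  moreover have "card (carrier K) \<noteq> 1"
    using K.one_not_zero by (metis K.one_closed K.zero_closed card_1_singletonE singletonD)
  ultimately show ?thesis
    by simp
qed

text \<open>With Ext^1 gone, the exponent is the dimension d of a Hom space, and v^d = sqrt(q^d) is
  the square root of its cardinality.\<close>

lemma twist_eq:
  assumes P: "projective K A P" and N: "left_module A (N :: ('a, 'n) module)" "finite (carrier N)"
  shows "twisting_parameter K powi (- euler_form K A P N) = 1 / sqrt (real (card (homs A P N)))"
proof -
  let ?d = "vectorspace.dim K (hom_space A P N)"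
  have "twisting_parameter K powi (- euler_form K A P N) = 1 / twisting_parameter K ^ ?d"
    by (simp add: euler_form_def dim_ext1_space[OF P N(1)] power_int_minus divide_inverse)
  also have "twisting_parameter K ^ ?d = sqrt (real (card (homs A P N)))"
    using card_homs_dim[OF projectiveD(1)[OF P] N(1) projectiveD(2)[OF P] N(2)]
    by (simp add: twisting_parameter_def real_sqrt_power)
  finally show ?thesis .
qed

end

section \<open>1-cyclic complexes\<close>

lemma (in abelian_group) minus_add_cancel:
  "x \<in> carrier G \<Longrightarrow> y \<in> carrier G \<Longrightarrow> (x \<ominus> y) \<oplus> y = x"
  by (simp add: a_minus_def a_assoc l_neg)

lemma (in abelian_group) minus_self: "x \<in> carrier G \<Longrightarrow> x \<ominus> x = \<zero>"
  by (simp add: a_minus_def r_neg)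

lemma C1_hom_iff: "f \<in> C1_hom A X Y \<longleftrightarrow> f \<in> homs A (fst X) (fst Y) \<and>
    (\<forall>x\<in>carrier (fst X). f (snd X x) = snd Y (f x))"
  by (auto simp: C1_hom_def homs_def)

lemma C1_isoI:
  assumes "left_module A (fst X)" "snd X \<in> mhom A (fst X) (fst X)"
    and "f \<in> mhom A (fst X) (fst Y)"
    and "\<And>x. x \<in> carrier (fst X) \<Longrightarrow> f (snd X x) = snd Y (f x)"
    and "bij_betw f (carrier (fst X)) (carrier (fst Y))"
  shows "restrict f (carrier (fst X)) \<in> C1_iso A X Y"
  using assms
  by (auto simp: C1_iso_def C1_hom_iff homs_restrict mhom_closed cong: bij_betw_cong)

lemma C1_isoD:
  assumes "f \<in> C1_iso A X Y"
  shows "f \<in> homs A (fst X) (fst Y)" "f \<in> mhom A (fst X) (fst Y)"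
    "x \<in> carrier (fst X) \<Longrightarrow> f x \<in> carrier (fst Y)"
    "x \<in> carrier (fst X) \<Longrightarrow> f (snd X x) = snd Y (f x)"
    "bij_betw f (carrier (fst X)) (carrier (fst Y))"
  using assms by (auto simp: C1_iso_def C1_hom_iff homs_mhom bij_betw_def)

lemma mhom_factor:
  assumes Y: "left_module A Y" and X: "left_module A X" and Z: "left_module A Z"
    and \<phi>: "\<phi> \<in> mhom A Y Z" "inj_on \<phi> (carrier Y)"
    and f: "f \<in> mhom A X Z" "\<And>x. x \<in> carrier X \<Longrightarrow> f x \<in> \<phi> ` carrier Y"
  obtains h where "h \<in> homs A X Y" "\<And>x. x \<in> carrier X \<Longrightarrow> \<phi> (h x) = f x"
proof
  interpret X: left_module A X by fact
  interpret Y: left_module A Y by fact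
  let ?h = "\<lambda>x. inv_into (carrier Y) \<phi> (f x)"
  have h: "?h x \<in> carrier Y" "\<phi> (?h x) = f x" if "x \<in> carrier X" for x
    using f(2)[OF that] by (auto simp: inv_into_into f_inv_into_f)
  have "?h \<in> mhom A X Y"
  proof (rule mhomI)
    fix x y assume "x \<in> carrier X" "y \<in> carrier X"
    then show "?h (x \<oplus>\<^bsub>X\<^esub> y) = ?h x \<oplus>\<^bsub>Y\<^esub> ?h y"
      using h \<phi> f(1) by (intro inv_into_f_eq) (simp_all add: mhom_add)
  next
    fix a x assume "a \<in> carrier A" "x \<in> carrier X"
    then show "?h (a \<odot>\<^bsub>X\<^esub> x) = a \<odot>\<^bsub>Y\<^esub> ?h x"
      using h \<phi> f(1) by (intro inv_into_f_eq) (simp_all add: mhom_smult Y.smult_closed)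
  qed (use h in auto)
  then show "restrict ?h (carrier X) \<in> homs A X Y"
    by (rule homs_restrict[OF X])
  show "\<phi> (restrict ?h (carrier X) x) = f x" if "x \<in> carrier X" for x
    using h that by simp
qed

text \<open>An inequality suffices: applied to the inverse isomorphisms it gives the opposite one.
  The same device is used for isomorphisms and for exact pairs.\<close>

lemma card_homs_le:
  fixes M :: "('a, 'm) module" and M' :: "('a, 'm') module"
    and N :: "('a, 'n) module" and N' :: "('a, 'n') module"
  assumes "left_module A M'" "finite (carrier M')" "finite (carrier N')"
    and \<alpha>: "\<alpha> \<in> mhom A M' M" "bij_betw \<alpha> (carrier M') (carrier M)"
    and \<beta>: "\<beta> \<in> mhom A N N'" "bij_betw \<beta> (carrier N) (carrier N')"
  shows "card (homs A M N) \<le> card (homs A M' N')"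
proof (rule card_inj_on_le)
  let ?F = "\<lambda>f. \<lambda>x\<in>carrier M'. \<beta> (f (\<alpha> x))"
  show "inj_on ?F (homs A M N)"
  proof (rule inj_onI)
    fix f g assume f: "f \<in> homs A M N" and g: "g \<in> homs A M N" and eq: "?F f = ?F g"
    show "f = g"
    proof (rule homs_eqI[OF f g])
      fix x assume "x \<in> carrier M"
      then obtain y where y: "y \<in> carrier M'" "x = \<alpha> y"
        using \<alpha>(2) by (auto simp: bij_betw_def)
      then have "\<beta> (f x) = \<beta> (g x)"
        using fun_cong[OF eq, of y] by simp
      then show "f x = g x"
        using \<beta>(2) f g \<open>x \<in> carrier M\<close>
        by (auto simp: bij_betw_def inj_on_eq_iff mhom_closed dest!: homs_mhom)
    qed
  qed
  have "?F f \<in> homs A M' N'" if "f \<in> homs A M N" for f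
    by (intro homs_restrict assms(1) mhom_compose[OF \<alpha>(1) mhom_compose[OF homs_mhom[OF that] \<beta>(1)]])
  then show "?F ` homs A M N \<subseteq> homs A M' N'"
    by blast
  show "finite (homs A M' N')"
    using assms by (intro finite_homs)
qed

definition ext_complex ::
  "('a, 'x) cyclic_complex \<Rightarrow> ('a, 'y) cyclic_complex \<Rightarrow> ('x \<Rightarrow> 'y) \<Rightarrow> ('a, 'y \<times> 'x) cyclic_complex" where
  "ext_complex X Y h = (direct_sum (fst Y) (fst X), \<lambda>(y, x). (snd Y y \<oplus>\<^bsub>fst Y\<^esub> h x, snd X x))"

lemma ext_complex_simps [simp]:
  "fst (ext_complex X Y h) = direct_sum (fst Y) (fst X)"
  "snd (ext_complex X Y h) (y, x) = (snd Y y \<oplus>\<^bsub>fst Y\<^esub> h x, snd X x)"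
  by (simp_all add: ext_complex_def)

text \<open>The equation is the off-diagonal entry of D^2 = 0 for the triangular differential D of
  \<open>ext_complex\<close>; the diagonal entries vanish because X and Y are complexes.\<close>

definition ext_maps ::
  "('k, 'a) module \<Rightarrow> ('a, 'x) cyclic_complex \<Rightarrow> ('a, 'y) cyclic_complex \<Rightarrow> ('x \<Rightarrow> 'y) set" where
  "ext_maps A X Y = {h \<in> homs A (fst X) (fst Y).
     \<forall>x\<in>carrier (fst X). snd Y (h x) \<oplus>\<^bsub>fst Y\<^esub> h (snd X x) = \<zero>\<^bsub>fst Y\<^esub>}"

section \<open>Isomorphisms and isoclasses of complexes\<close>

context finite_algebra
begin

lemma C1_objectD:
  assumes "C1_object K A X"
  shows "projective K A (fst X)" "left_module A (fst X)" "finite (carrier (fst X))"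
    "snd X \<in> mhom A (fst X) (fst X)"
    "x \<in> carrier (fst X) \<Longrightarrow> snd X x \<in> carrier (fst X)"
    "x \<in> carrier (fst X) \<Longrightarrow> snd X (snd X x) = \<zero>\<^bsub>fst X\<^esub>"
  using assms by (auto simp: C1_object_def mhom_closed dest: projectiveD)

lemma finite_C1_iso:
  assumes "C1_object K A X" "C1_object K A Y"
  shows "finite (C1_iso A X Y)"
  using finite_homs[OF C1_objectD(3)[OF assms(1)] C1_objectD(3)[OF assms(2)], of A]
  by (rule finite_subset[rotated]) (auto simp: C1_isoD)

lemma C1_iso_refl:
  assumes "C1_object K A X"
  shows "restrict (\<lambda>x. x) (carrier (fst X)) \<in> C1_iso A X X"
  using C1_objectD[OF assms] by (intro C1_isoI) (auto simp: mhom_id bij_betw_def)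

lemma C1_iso_compose:
  assumes X: "C1_object K A X" and f: "f \<in> C1_iso A X Y" and g: "g \<in> C1_iso A Y Z"
  shows "compose (carrier (fst X)) g f \<in> C1_iso A X Z"
  unfolding compose_def
  using C1_objectD[OF X] C1_isoD[OF f] C1_isoD[OF g]
  by (intro C1_isoI mhom_compose[of f A _ _ g]) (auto intro: bij_betw_trans[unfolded comp_def])

lemma C1_iso_sym:
  assumes X: "C1_object K A X" and Y: "C1_object K A Y" and f: "f \<in> C1_iso A X Y"
  shows "restrict (inv_into (carrier (fst X)) f) (carrier (fst Y)) \<in> C1_iso A Y X"
proof (rule C1_isoI)
  note oX = C1_objectD[OF X] and oY = C1_objectD[OF Y] and F = C1_isoD[OF f]
  let ?g = "inv_into (carrier (fst X)) f"
  show "?g \<in> mhom A (fst Y) (fst X)"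
    by (rule mhom_inv_into[OF oX(2) F(2,5)])
  show "bij_betw ?g (carrier (fst Y)) (carrier (fst X))"
    by (rule bij_betw_inv_into[OF F(5)])
  fix y assume "y \<in> carrier (fst Y)"
  then obtain x where x: "x \<in> carrier (fst X)" "y = f x"
    using F(5) by (auto simp: bij_betw_def)
  have inv: "?g (f u) = u" if "u \<in> carrier (fst X)" for u
    using F(5) that by (simp add: bij_betw_def)
  show "?g (snd Y y) = snd X (?g y)"
    using inv x oX(5) F(4)[OF x(1)] by (metis)
qed (use C1_objectD[OF Y] in auto)

text \<open>Being an object is built in, which makes this an equivalence relation even between
  complexes on different types.\<close>

definition cpx_iso :: "('a, 'm) cyclic_complex \<Rightarrow> ('a, 'n) cyclic_complex \<Rightarrow> bool" where
  "cpx_iso X Y \<longleftrightarrow> C1_object K A X \<and> C1_object K A Y \<and> C1_iso A X Y \<noteq> {}"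

lemma cpx_iso_refl: "C1_object K A X \<Longrightarrow> cpx_iso X X"
  using C1_iso_refl[of X] unfolding cpx_iso_def by blast

lemma cpx_iso_sym: "cpx_iso X Y \<Longrightarrow> cpx_iso Y X"
  unfolding cpx_iso_def using C1_iso_sym[of X Y] by blast

lemma cpx_iso_trans: "cpx_iso X Y \<Longrightarrow> cpx_iso Y Z \<Longrightarrow> cpx_iso X Z"
  unfolding cpx_iso_def using C1_iso_compose[of X _ Y _ Z] by blast

lemma card_C1_iso_le:
  assumes X: "C1_object K A X" and Y: "C1_object K A Y" and Z: "C1_object K A Z"
    and f: "f \<in> C1_iso A X Y"
  shows "card (C1_iso A Y Z) \<le> card (C1_iso A X Z)"
proof (rule card_inj_on_le)
  let ?F = "\<lambda>g. compose (carrier (fst X)) g f"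
  show "?F ` C1_iso A Y Z \<subseteq> C1_iso A X Z"
    using C1_iso_compose[OF X f] by blast
  show "inj_on ?F (C1_iso A Y Z)"
  proof (rule inj_onI)
    fix g h assume g: "g \<in> C1_iso A Y Z" and h: "h \<in> C1_iso A Y Z" and eq: "?F g = ?F h"
    show "g = h"
    proof (rule homs_eqI[OF C1_isoD(1)[OF g] C1_isoD(1)[OF h]])
      fix y assume "y \<in> carrier (fst Y)"
      then obtain x where "x \<in> carrier (fst X)" "y = f x"
        using C1_isoD(5)[OF f] by (auto simp: bij_betw_def)
      then show "g y = h y"
        using fun_cong[OF eq, of x] by (simp add: compose_def)
    qed
  qed
qed (rule finite_C1_iso[OF X Z])

lemma card_C1_iso_left:
  assumes "cpx_iso X Y" "C1_object K A Z"
  shows "card (C1_iso A X Z) = card (C1_iso A Y Z)"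
  using assms card_C1_iso_le[OF _ _ assms(2)] cpx_iso_sym[OF assms(1)]
  unfolding cpx_iso_def by (metis antisym ex_in_conv)

lemma card_C1_iso_sym_le:
  assumes X: "C1_object K A X" and Y: "C1_object K A Y"
  shows "card (C1_iso A X Y) \<le> card (C1_iso A Y X)"
proof (rule card_inj_on_le)
  let ?F = "\<lambda>f. restrict (inv_into (carrier (fst X)) f) (carrier (fst Y))"
  show "?F ` C1_iso A X Y \<subseteq> C1_iso A Y X"
    using C1_iso_sym[OF X Y] by blast
  show "inj_on ?F (C1_iso A X Y)"
  proof (rule inj_onI)
    fix f g assume f: "f \<in> C1_iso A X Y" and g: "g \<in> C1_iso A X Y" and eq: "?F f = ?F g"
    show "f = g"
    proof (rule homs_eqI[OF C1_isoD(1)[OF f] C1_isoD(1)[OF g]])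
      fix x assume x: "x \<in> carrier (fst X)"
      have "inv_into (carrier (fst X)) g (f x) = inv_into (carrier (fst X)) f (f x)"
        using fun_cong[OF eq, of "f x"] C1_isoD(3)[OF f x] by simp
      also have "\<dots> = x"
        using C1_isoD(5)[OF f] x by (simp add: bij_betw_def)
      finally show "f x = g x"
        using C1_isoD(3)[OF f x] C1_isoD(5)[OF g] by (metis bij_betw_inv_into_right)
    qed
  qed
qed (rule finite_C1_iso[OF Y X])

text \<open>Isomorphisms from X to Y form a torsor under the automorphisms of either end. In
  numbers: |Iso(X, Y)| = |Aut Y| and |Iso(Y, X)| = |Aut X| by composition, and inversion exchanges
  the two sets of isomorphisms.\<close>

lemma card_C1_iso_aut:
  assumes "cpx_iso X Y"
  shows "card (C1_iso A X Y) = card (C1_iso A X X)" "card (C1_iso A Y Y) = card (C1_iso A X X)"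
proof -
  have X: "C1_object K A X" and Y: "C1_object K A Y"
    using assms by (auto simp: cpx_iso_def)
  have "card (C1_iso A X Y) = card (C1_iso A Y Y)"
    using card_C1_iso_left[OF assms Y] .
  moreover have "card (C1_iso A Y X) = card (C1_iso A X X)"
    using card_C1_iso_left[OF assms X] by simp
  moreover have "card (C1_iso A X Y) = card (C1_iso A Y X)"
    using card_C1_iso_sym_le X Y by (metis antisym)
  ultimately show "card (C1_iso A X Y) = card (C1_iso A X X)"
    "card (C1_iso A Y Y) = card (C1_iso A X X)" by simp_all
qed

lemma card_aut_pos: "C1_object K A X \<Longrightarrow> card (C1_iso A X X) > 0"
  using finite_C1_iso C1_iso_refl by (metis card_gt_0_iff empty_iff)

lemma C1_object_transport:
  assumes X: "C1_object K A X" and M: "left_module A M"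
    and f: "f \<in> mhom A (fst X) M" "bij_betw f (carrier (fst X)) (carrier M)"
  defines "Y \<equiv> (M, \<lambda>y. f (snd X (inv_into (carrier (fst X)) f y)))"
  shows "cpx_iso X Y"
proof -
  note oX = C1_objectD[OF X]
  let ?g = "inv_into (carrier (fst X)) f"
  have g: "?g \<in> mhom A M (fst X)"
    by (rule mhom_inv_into[OF oX(2) f])
  have inv: "?g (f u) = u" if "u \<in> carrier (fst X)" for u
    using f(2) that by (simp add: bij_betw_def)
  have "projective K A M"
    using oX f M by (intro projective_iso[OF oX(1)])
  moreover have "(\<lambda>y. f (snd X (?g y))) \<in> mhom A M M"
    by (intro mhom_compose[OF mhom_compose[OF g oX(4)] f(1)])
  moreover have "f (snd X (?g (f (snd X (?g y))))) = \<zero>\<^bsub>M\<^esub>" if "y \<in> carrier M" for y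
    using oX mhom_closed[OF g that] mhom_zero[OF oX(2) M f(1)] by (simp add: inv)
  ultimately have Y: "C1_object K A Y"
    by (simp add: C1_object_def Y_def)
  have "restrict f (carrier (fst X)) \<in> C1_iso A X Y"
    using oX f by (intro C1_isoI) (auto simp: Y_def inv)
  then show ?thesis
    using X Y by (auto simp: cpx_iso_def)
qed

lemma cpx_iso_nat_copy:
  assumes "C1_object K A X"
  obtains Y :: "('a, nat) cyclic_complex" where "cpx_iso X Y"
  using C1_object_transport[OF assms nat_copy(1,3,4)] C1_objectD[OF assms] by metis

lemma isoclass_iff: "C1_object K A X \<Longrightarrow> Y \<in> isoclass K A X \<longleftrightarrow> cpx_iso X Y"
  by (auto simp: isoclass_def cpx_iso_def)

text \<open>X need not belong to its own class, which contains complexes on \<open>nat\<close> only.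
  Equal classes are compared through a copy of X on \<open>nat\<close>, which lies in both.\<close>

lemma isoclass_eq_iff:
  assumes "C1_object K A X" "C1_object K A Y"
  shows "isoclass K A X = isoclass K A Y \<longleftrightarrow> cpx_iso X Y"
proof
  assume eq: "isoclass K A X = isoclass K A Y"
  obtain Z :: "('a, nat) cyclic_complex" where Z: "cpx_iso X Z"
    using cpx_iso_nat_copy assms(1) by metis
  then have "cpx_iso Y Z"
    using eq isoclass_iff[OF assms(1), of Z] isoclass_iff[OF assms(2), of Z] by simp
  then show "cpx_iso X Y"
    using cpx_iso_trans[OF Z] cpx_iso_sym by metis
next
  assume XY: "cpx_iso X Y"
  show "isoclass K A X = isoclass K A Y"
  proof (rule Set.set_eqI)
    fix Z :: "('a, nat) cyclic_complex"
    show "Z \<in> isoclass K A X \<longleftrightarrow> Z \<in> isoclass K A Y"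
      unfolding isoclass_iff[OF assms(1)] isoclass_iff[OF assms(2)]
      using cpx_iso_trans[OF XY] cpx_iso_trans[OF cpx_iso_sym[OF XY]] by metis
  qed
qed

lemma isoclass_in_isoclasses:
  assumes "C1_object K A X"
  shows "isoclass K A X \<in> isoclasses K A"
proof -
  obtain Z :: "('a, nat) cyclic_complex" where Z: "cpx_iso X Z"
    using cpx_iso_nat_copy assms by metis
  then have "C1_object K A Z" by (simp add: cpx_iso_def)
  then show ?thesis
    using isoclass_eq_iff[OF assms] Z unfolding isoclasses_def by blast
qed

lemma representative:
  assumes "\<gamma> \<in> isoclasses K A"
  shows "C1_object K A (representative \<gamma>)" "isoclass K A (representative \<gamma>) = \<gamma>"
proof -
  obtain X :: "('a, nat) cyclic_complex" where X: "C1_object K A X" "\<gamma> = isoclass K A X"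
    using assms by (auto simp: isoclasses_def)
  then have "X \<in> \<gamma>"
    by (simp add: isoclass_iff cpx_iso_refl)
  then have "cpx_iso X (representative \<gamma>)"
    using X unfolding representative_def by (metis isoclass_iff someI)
  then show "C1_object K A (representative \<gamma>)" "isoclass K A (representative \<gamma>) = \<gamma>"
    using X isoclass_eq_iff by (metis cpx_iso_def)+
qed

lemma cpx_iso_representative:
  assumes "C1_object K A X"
  shows "cpx_iso X (representative (isoclass K A X))"
  using representative[OF isoclass_in_isoclasses[OF assms]] isoclass_eq_iff[OF assms] by metis

lemma card_homs_iso:
  assumes "cpx_iso X X'" "cpx_iso Y Y'"
  shows "card (homs A (fst X) (fst Y)) = card (homs A (fst X') (fst Y'))"
proof -
  have le: "card (homs A (fst X) (fst Y)) \<le> card (homs A (fst X') (fst Y'))"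
    if iX: "cpx_iso X X'" and iY: "cpx_iso Y Y'" for X X' Y Y'
  proof -
    obtain f g where f: "f \<in> C1_iso A X' X" and g: "g \<in> C1_iso A Y Y'"
      using cpx_iso_sym[OF iX] iY by (auto simp: cpx_iso_def)
    show ?thesis
      using iX iY C1_isoD[OF f] C1_isoD[OF g] unfolding cpx_iso_def
      by (intro card_homs_le[where \<alpha> = f and \<beta> = g]) (auto dest: C1_objectD)
  qed
  show ?thesis
    using le[OF assms] le[OF assms[THEN cpx_iso_sym]] by simp
qed

section \<open>Exact pairs up to isomorphism of the end terms\<close>

lemma finite_short_exact_pairs:
  assumes "C1_object K A X" "C1_object K A Y" "C1_object K A Z"
  shows "finite (short_exact_pairs A X Y Z)"
proof (rule finite_subset)
  show "short_exact_pairs A X Y Z \<subseteq> homs A (fst Y) (fst Z) \<times> homs A (fst Z) (fst X)"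
    by (auto simp: short_exact_pairs_def C1_hom_iff)
  show "finite (homs A (fst Y) (fst Z) \<times> homs A (fst Z) (fst X))"
    using assms by (auto intro!: finite_homs dest: C1_objectD)
qed

text \<open>Composing the injection with \<eta> and the surjection with \<xi> maps exact pairs to
  exact pairs, injectively. This is why \<xi> starts at X while \<eta> ends at Y. The kernel is
  unchanged because \<xi> is injective.\<close>

lemma card_short_exact_pairs_le:
  assumes X: "C1_object K A X" and X': "C1_object K A X'" and Y: "C1_object K A Y"
    and Y': "C1_object K A Y'" and Z: "C1_object K A Z"
    and \<xi>: "\<xi> \<in> C1_iso A X X'" and \<eta>: "\<eta> \<in> C1_iso A Y' Y"
  shows "card (short_exact_pairs A X Y Z) \<le> card (short_exact_pairs A X' Y' Z)"
proof (rule card_inj_on_le)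
  let ?F = "\<lambda>(\<phi>, \<psi>). (\<lambda>y\<in>carrier (fst Y'). \<phi> (\<eta> y), \<lambda>z\<in>carrier (fst Z). \<xi> (\<psi> z))"
  note oX = C1_objectD[OF X] and oX' = C1_objectD[OF X'] and oY = C1_objectD[OF Y]
    and oY' = C1_objectD[OF Y'] and oZ = C1_objectD[OF Z]
  note x = C1_isoD[OF \<xi>] and y = C1_isoD[OF \<eta>]
  have im: "\<eta> ` carrier (fst Y') = carrier (fst Y)" "\<xi> ` carrier (fst X) = carrier (fst X')"
    using x(5) y(5) by (auto simp: bij_betw_def)
  have inj: "inj_on \<xi> (carrier (fst X))" "inj_on \<eta> (carrier (fst Y'))"
    using x(5) y(5) by (auto simp: bij_betw_def)
  have x0: "\<xi> u = \<zero>\<^bsub>fst X'\<^esub> \<longleftrightarrow> u = \<zero>\<^bsub>fst X\<^esub>" if "u \<in> carrier (fst X)" for u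
  proof -
    interpret X: left_module A "fst X" by (rule oX)
    have "\<xi> \<zero>\<^bsub>fst X\<^esub> = \<zero>\<^bsub>fst X'\<^esub>"
      using mhom_zero[OF oX(2) oX'(2) x(2)] .
    then show ?thesis
      using inj_onD[OF inj(1)] that X.M.zero_closed by metis
  qed
  show "?F ` short_exact_pairs A X Y Z \<subseteq> short_exact_pairs A X' Y' Z"
  proof clarify
    fix \<phi> \<psi> assume w: "(\<phi>, \<psi>) \<in> short_exact_pairs A X Y Z"
    then have p: "\<phi> \<in> homs A (fst Y) (fst Z)" "\<psi> \<in> homs A (fst Z) (fst X)"
      and pc: "\<And>y. y \<in> carrier (fst Y) \<Longrightarrow> \<phi> (snd Y y) = snd Z (\<phi> y)"
        "\<And>z. z \<in> carrier (fst Z) \<Longrightarrow> \<psi> (snd Z z) = snd X (\<psi> z)"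
      and e: "inj_on \<phi> (carrier (fst Y))" "\<psi> ` carrier (fst Z) = carrier (fst X)"
        "\<phi> ` carrier (fst Y) = a_kernel (fst Z) (fst X) \<psi>"
      by (auto simp: short_exact_pairs_def C1_hom_iff)
    let ?\<phi> = "\<lambda>y\<in>carrier (fst Y'). \<phi> (\<eta> y)" and ?\<psi> = "\<lambda>z\<in>carrier (fst Z). \<xi> (\<psi> z)"
    have "?\<phi> \<in> C1_hom A Y' Z"
      using p(1) pc oY' y
      by (auto simp: C1_hom_iff intro!: homs_restrict mhom_compose[OF y(2) homs_mhom])
    moreover have "?\<psi> \<in> C1_hom A Z X'"
      using p pc oZ x
      by (auto simp: C1_hom_iff mhom_closed[OF homs_mhom] intro!: homs_restrict mhom_compose[OF homs_mhom x(2)])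
    moreover have "inj_on ?\<phi> (carrier (fst Y'))"
      using comp_inj_on[OF inj(2)] e(1) im(1) by (auto simp: inj_on_def)
    moreover have "?\<psi> ` carrier (fst Z) = carrier (fst X')"
      using e(2) im(2) by (metis (no_types, lifting) image_cong image_image restrict_apply')
    moreover have "?\<phi> ` carrier (fst Y') = \<phi> ` carrier (fst Y)"
      using im(1) by (metis (no_types, lifting) image_cong image_image restrict_apply')
    moreover have "a_kernel (fst Z) (fst X') ?\<psi> = a_kernel (fst Z) (fst X) \<psi>"
      using x0 mhom_closed[OF homs_mhom[OF p(2)]] by (auto simp: a_kernel_eq)
    ultimately show "(?\<phi>, ?\<psi>) \<in> short_exact_pairs A X' Y' Z"
      using e by (simp add: short_exact_pairs_def)
  qed
  show "inj_on ?F (short_exact_pairs A X Y Z)"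
  proof (rule inj_onI, clarify)
    fix \<phi> \<psi> \<phi>' \<psi>' assume w: "(\<phi>, \<psi>) \<in> short_exact_pairs A X Y Z" "(\<phi>', \<psi>') \<in> short_exact_pairs A X Y Z"
      and eq: "(\<lambda>y\<in>carrier (fst Y'). \<phi> (\<eta> y)) = (\<lambda>y\<in>carrier (fst Y'). \<phi>' (\<eta> y))"
        "(\<lambda>z\<in>carrier (fst Z). \<xi> (\<psi> z)) = (\<lambda>z\<in>carrier (fst Z). \<xi> (\<psi>' z))"
    have p: "\<phi> \<in> homs A (fst Y) (fst Z)" "\<psi> \<in> homs A (fst Z) (fst X)"
      "\<phi>' \<in> homs A (fst Y) (fst Z)" "\<psi>' \<in> homs A (fst Z) (fst X)"
      using w by (auto simp: short_exact_pairs_def C1_hom_iff)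
    show "\<phi> = \<phi>' \<and> \<psi> = \<psi>'"
    proof
      show "\<phi> = \<phi>'"
      proof (rule homs_eqI[OF p(1,3)])
        fix u assume "u \<in> carrier (fst Y)"
        then obtain v where "v \<in> carrier (fst Y')" "u = \<eta> v"
          using im(1) by (metis imageE)
        then show "\<phi> u = \<phi>' u" using fun_cong[OF eq(1), of v] by simp
      qed
      show "\<psi> = \<psi>'"
      proof (rule homs_eqI[OF p(2,4)])
        fix z assume z: "z \<in> carrier (fst Z)"
        then have "\<xi> (\<psi> z) = \<xi> (\<psi>' z)" using fun_cong[OF eq(2), of z] by simp
        then show "\<psi> z = \<psi>' z"
          using inj_onD[OF inj(1)] z p by (auto simp: mhom_closed[OF homs_mhom])
      qed
    qed
  qed
qed (rule finite_short_exact_pairs[OF X' Y' Z])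

lemma card_short_exact_pairs_iso:
  assumes "cpx_iso X X'" "cpx_iso Y Y'" "C1_object K A Z"
  shows "card (short_exact_pairs A X Y Z) = card (short_exact_pairs A X' Y' Z)"
proof -
  have le: "card (short_exact_pairs A X Y Z) \<le> card (short_exact_pairs A X' Y' Z)"
    if iX: "cpx_iso X X'" and iY: "cpx_iso Y Y'" for X X' Y Y'
    using iX iY cpx_iso_sym[OF iY] card_short_exact_pairs_le[OF _ _ _ _ assms(3)]
    unfolding cpx_iso_def by blast
  show ?thesis
    using le[OF assms(1,2)] le[OF assms(1,2)[THEN cpx_iso_sym]] by simp
qed

end

section \<open>Extension complexes and the count of split exact sequences\<close>

context finite_algebra
begin

lemma ext_maps_homs: "h \<in> ext_maps A X Y \<Longrightarrow> h \<in> homs A (fst X) (fst Y)"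
  by (simp add: ext_maps_def)

lemma C1_object_ext_complex:
  assumes X: "C1_object K A X" and Y: "C1_object K A Y" and h: "h \<in> ext_maps A X Y"
  shows "C1_object K A (ext_complex X Y h)"
proof -
  note oX = C1_objectD[OF X] and oY = C1_objectD[OF Y] and hm = homs_mhom[OF ext_maps_homs[OF h]]
  interpret X: left_module A "fst X" by (rule oX)
  interpret Y: left_module A "fst Y" by (rule oY)
  let ?E = "ext_complex X Y h"
  have "snd ?E \<in> mhom A (fst ?E) (fst ?E)"
    using oX(4,5) oY(4,5) hm
    by (intro mhomI) (auto simp: mhom_closed mhom_add mhom_smult Y.M.a_ac Y.smult_r_distr Y.smult_closed)
  moreover have "snd ?E (snd ?E z) = \<zero>\<^bsub>fst ?E\<^esub>" if zE: "z \<in> carrier (fst ?E)" for z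
  proof -
    obtain y x where z: "z = (y, x)" "y \<in> carrier (fst Y)" "x \<in> carrier (fst X)"
      using zE by auto
    have hx: "snd Y (h x) \<oplus>\<^bsub>fst Y\<^esub> h (snd X x) = \<zero>\<^bsub>fst Y\<^esub>"
      using h z by (simp add: ext_maps_def)
    have "snd Y (snd Y y \<oplus>\<^bsub>fst Y\<^esub> h x) \<oplus>\<^bsub>fst Y\<^esub> h (snd X x) =
        snd Y (snd Y y) \<oplus>\<^bsub>fst Y\<^esub> (snd Y (h x) \<oplus>\<^bsub>fst Y\<^esub> h (snd X x))"
      using z oY oX hm by (simp add: mhom_add[OF oY(4)] mhom_closed Y.M.a_assoc)
    also have "\<dots> = \<zero>\<^bsub>fst Y\<^esub>"
      using z oY by (simp add: hx)
    finally show ?thesis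
      using z oX by simp
  qed
  ultimately show ?thesis
    using projective_direct_sum[OF oY(1) oX(1)] by (simp add: C1_object_def)
qed

lemma finite_ext_maps:
  assumes "C1_object K A X" "C1_object K A Y"
  shows "finite (ext_maps A X Y)"
  using finite_homs[OF assms[THEN C1_objectD(3)], of A]
  by (rule finite_subset[rotated]) (auto simp: ext_maps_def)

text \<open>Both sides count the pairs of an exact sequence in \<open>W\<close> and a splitting of it as a sequence of
  modules: a splitting turns \<open>Z\<close> into an extension complex, and the splittings of a given
  sequence form a torsor under the group of homomorphisms from \<open>X\<close> to \<open>Y\<close>.\<close>

lemma card_short_exact_pairs:
  assumes X: "C1_object K A X" and Y: "C1_object K A Y" and Z: "C1_object K A Z"
  shows "card (short_exact_pairs A X Y Z) * card (homs A (fst X) (fst Y)) =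
    (\<Sum>h\<in>ext_maps A X Y. card (C1_iso A (ext_complex X Y h) Z))"
proof -
  note oX = C1_objectD[OF X] and oY = C1_objectD[OF Y] and oZ = C1_objectD[OF Z]
  let ?X = "fst X" and ?Y = "fst Y" and ?Z = "fst Z"
  let ?W = "short_exact_pairs A X Y Z"
  interpret X: left_module A ?X by (rule oX)
  interpret Y: left_module A ?Y by (rule oY)
  interpret Z: left_module A ?Z by (rule oZ)
  have lD: "left_module A (direct_sum ?Y ?X)"
    by (rule left_module_direct_sum[OF oY(2) oX(2)])
  \<comment> \<open>One splitting per exact pair is fixed by choice. It serves as the origin of the
    torsor: the other splittings are \<open>sec w\<close> plus the injection applied to some g from
    X to Y.\<close>
  define is_sec where "is_sec w s \<longleftrightarrow> s \<in> mhom A ?X ?Z \<and> (\<forall>x\<in>carrier ?X. snd w (s x) = x)"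
    for w :: "('c \<Rightarrow> 'd) \<times> ('d \<Rightarrow> 'b)" and s
  define sec where "sec w = (SOME s. is_sec w s)" for w
  \<comment> \<open>The map Y + X -> Z that is the injection on Y and the splitting with parameter g
    on X.\<close>
  define F where "F w g = (\<lambda>(y, x)\<in>carrier (direct_sum ?Y ?X).
      fst w y \<oplus>\<^bsub>?Z\<^esub> (sec w x \<oplus>\<^bsub>?Z\<^esub> fst w (g x)))" for w g
  define I where "I h = C1_iso A (ext_complex X Y h) Z" for h
  have W: "\<phi> \<in> mhom A ?Y ?Z" "\<psi> \<in> mhom A ?Z ?X" "\<phi> \<in> homs A ?Y ?Z" "\<psi> \<in> homs A ?Z ?X"
      "inj_on \<phi> (carrier ?Y)" "\<psi> ` carrier ?Z = carrier ?X"
      "\<And>z. z \<in> carrier ?Z \<Longrightarrow> \<psi> z = \<zero>\<^bsub>?X\<^esub> \<longleftrightarrow> z \<in> \<phi> ` carrier ?Y"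
      "\<And>y. y \<in> carrier ?Y \<Longrightarrow> \<phi> (snd Y y) = snd Z (\<phi> y)"
      "\<And>z. z \<in> carrier ?Z \<Longrightarrow> \<psi> (snd Z z) = snd X (\<psi> z)"
      "\<And>y. y \<in> carrier ?Y \<Longrightarrow> \<psi> (\<phi> y) = \<zero>\<^bsub>?X\<^esub>"
    if "(\<phi>, \<psi>) \<in> ?W" for \<phi> \<psi>
    using that by (auto simp: short_exact_pairs_def C1_hom_iff a_kernel_eq homs_mhom)
  have sec: "sec (\<phi>, \<psi>) \<in> mhom A ?X ?Z" "\<And>x. x \<in> carrier ?X \<Longrightarrow> \<psi> (sec (\<phi>, \<psi>) x) = x"
    if w: "(\<phi>, \<psi>) \<in> ?W" for \<phi> \<psi>
  proof -
    obtain s where "s \<in> mhom A ?X ?Z" "\<And>x. x \<in> carrier ?X \<Longrightarrow> \<psi> (s x) = x"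
      using projective_split[OF oX(1) oZ(2,3) W(2,6)[OF w]] by metis
    then have "is_sec (\<phi>, \<psi>) (sec (\<phi>, \<psi>))"
      unfolding sec_def by (intro someI[of "is_sec (\<phi>, \<psi>)" s]) (simp add: is_sec_def)
    then show "sec (\<phi>, \<psi>) \<in> mhom A ?X ?Z" "\<And>x. x \<in> carrier ?X \<Longrightarrow> \<psi> (sec (\<phi>, \<psi>) x) = x"
      by (auto simp: is_sec_def)
  qed
  have t: "(\<lambda>x. sec (\<phi>, \<psi>) x \<oplus>\<^bsub>?Z\<^esub> \<phi> (g x)) \<in> mhom A ?X ?Z"
      "\<And>x. x \<in> carrier ?X \<Longrightarrow> \<psi> (sec (\<phi>, \<psi>) x \<oplus>\<^bsub>?Z\<^esub> \<phi> (g x)) = x"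
    if w: "(\<phi>, \<psi>) \<in> ?W" and g: "g \<in> homs A ?X ?Y" for \<phi> \<psi> g
  proof -
    note g' = homs_mhom[OF g]
    show "(\<lambda>x. sec (\<phi>, \<psi>) x \<oplus>\<^bsub>?Z\<^esub> \<phi> (g x)) \<in> mhom A ?X ?Z"
      by (intro mhom_add_map oX oZ sec(1)[OF w] mhom_compose[OF g' W(1)[OF w]])
    fix x assume x: "x \<in> carrier ?X"
    then have "\<psi> (sec (\<phi>, \<psi>) x \<oplus>\<^bsub>?Z\<^esub> \<phi> (g x)) = \<psi> (sec (\<phi>, \<psi>) x) \<oplus>\<^bsub>?X\<^esub> \<psi> (\<phi> (g x))"
      using mhom_closed[OF sec(1)[OF w]] mhom_closed[OF g'] mhom_closed[OF W(1)[OF w]]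
      by (intro mhom_add[OF W(2)[OF w]]) auto
    then show "\<psi> (sec (\<phi>, \<psi>) x \<oplus>\<^bsub>?Z\<^esub> \<phi> (g x)) = x"
      using x sec(2)[OF w] W(10)[OF w] mhom_closed[OF g'] by simp
  qed
  have into: "\<exists>h\<in>ext_maps A X Y. F (\<phi>, \<psi>) g \<in> I h"
    if w: "(\<phi>, \<psi>) \<in> ?W" and g: "g \<in> homs A ?X ?Y" for \<phi> \<psi> g
  proof -
    note W' = W[OF w]
    define t where "t x = sec (\<phi>, \<psi>) x \<oplus>\<^bsub>?Z\<^esub> \<phi> (g x)" for x
    have tm: "t \<in> mhom A ?X ?Z" and tx: "\<And>x. x \<in> carrier ?X \<Longrightarrow> \<psi> (t x) = x"
      using t[OF w g] unfolding t_def by auto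
    have \<phi>c: "\<phi> y \<in> carrier ?Z" if "y \<in> carrier ?Y" for y
      using that W'(1) by (rule mhom_closed[rotated])
    have tc: "t x \<in> carrier ?Z" if "x \<in> carrier ?X" for x
      using that tm by (rule mhom_closed[rotated])
    \<comment> \<open>The failure of the splitting t to commute with the differentials. It is killed
      by \<psi> and hence factors through \<phi>; the factor h becomes the off-diagonal entry of the
      extension complex.\<close>
    let ?f = "\<lambda>x. snd Z (t x) \<oplus>\<^bsub>?Z\<^esub> (\<ominus>\<^bsub>?Z\<^esub> t (snd X x))"
    have fm: "?f \<in> mhom A ?X ?Z"
      by (intro mhom_add_map mhom_uminus_map oX oZ mhom_compose[OF tm oZ(4)] mhom_compose[OF oX(4) tm])
    have fc: "?f x \<in> \<phi> ` carrier ?Y" if x: "x \<in> carrier ?X" for x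
    proof -
      have "\<psi> (?f x) = \<psi> (snd Z (t x)) \<ominus>\<^bsub>?X\<^esub> \<psi> (t (snd X x))"
        using mhom_minus[OF oZ(2) oX(2) W'(2), of "snd Z (t x)" "t (snd X x)"] x oX oZ tc
        by (simp add: a_minus_def)
      also have "\<dots> = \<zero>\<^bsub>?X\<^esub>"
        using x tx tc oX W'(9) by (simp add: X.M.minus_self)
      finally show ?thesis
        using W'(7)[of "?f x"] mhom_closed[OF fm x] by simp
    qed
    obtain h where h: "h \<in> homs A ?X ?Y" "\<And>x. x \<in> carrier ?X \<Longrightarrow> \<phi> (h x) = ?f x"
      using mhom_factor[OF oY(2) oX(2) oZ(2) W'(1,5) fm fc] by metis
    note hm = homs_mhom[OF h(1)]
    have hc: "h x \<in> carrier ?Y" if "x \<in> carrier ?X" for x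
      using that hm by (rule mhom_closed[rotated])
    have dt: "snd Z (t x) = \<phi> (h x) \<oplus>\<^bsub>?Z\<^esub> t (snd X x)" if x: "x \<in> carrier ?X" for x
      using h(2)[OF x] x tc oX oZ Z.M.minus_add_cancel[of "snd Z (t x)" "t (snd X x)"]
      by (simp add: a_minus_def)
    have hE: "h \<in> ext_maps A X Y"
    proof -
      \<comment> \<open>Expanding d_Z d_Z t = 0 by d_Z t = \<phi> h + t d_X leaves \<phi> applied to
        this sum, and \<phi> is injective.\<close>
      have "snd Y (h x) \<oplus>\<^bsub>?Y\<^esub> h (snd X x) = \<zero>\<^bsub>?Y\<^esub>" if x: "x \<in> carrier ?X" for x
      proof -
        have "\<zero>\<^bsub>?Z\<^esub> = snd Z (snd Z (t x))"
          using x tc oZ by simp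
        also have "\<dots> = snd Z (\<phi> (h x)) \<oplus>\<^bsub>?Z\<^esub> snd Z (t (snd X x))"
          using dt[OF x] x hc \<phi>c tc oX by (simp add: mhom_add[OF oZ(4)])
        also have "snd Z (t (snd X x)) = \<phi> (h (snd X x)) \<oplus>\<^bsub>?Z\<^esub> t (snd X (snd X x))"
          using x oX by (intro dt)
        also have "t (snd X (snd X x)) = \<zero>\<^bsub>?Z\<^esub>"
          using x oX mhom_zero[OF oX(2) oZ(2) tm] by simp
        finally have "\<zero>\<^bsub>?Z\<^esub> = \<phi> (snd Y (h x)) \<oplus>\<^bsub>?Z\<^esub> \<phi> (h (snd X x))"
          using x hc oX W'(8) \<phi>c by simp
        moreover have c: "snd Y (h x) \<in> carrier ?Y" "h (snd X x) \<in> carrier ?Y"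
          using x hc oX(5) oY(5) by auto
        ultimately have "\<phi> (snd Y (h x) \<oplus>\<^bsub>?Y\<^esub> h (snd X x)) = \<phi> \<zero>\<^bsub>?Y\<^esub>"
          using mhom_zero[OF oY(2) oZ(2) W'(1)] by (simp add: mhom_add[OF W'(1)])
        then show ?thesis
          by (rule inj_onD[OF W'(5)]) (use c in auto)
      qed
      then show ?thesis
        using h(1) by (simp add: ext_maps_def)
    qed
    let ?T = "\<lambda>(y, x). \<phi> y \<oplus>\<^bsub>?Z\<^esub> t x"
    have "?T \<in> mhom A (direct_sum ?Y ?X) ?Z"
      using W'(1) tm
      by (intro mhomI) (auto simp: mhom_closed mhom_add mhom_smult Z.M.a_ac Z.smult_r_distr Z.smult_closed)
    moreover have "?T (snd (ext_complex X Y h) u) = snd Z (?T u)"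
      if "u \<in> carrier (direct_sum ?Y ?X)" for u
    proof -
      obtain y x where u: "u = (y, x)" "y \<in> carrier ?Y" "x \<in> carrier ?X"
        using \<open>u \<in> _\<close> by auto
      have "snd Z (\<phi> y \<oplus>\<^bsub>?Z\<^esub> t x) = snd Z (\<phi> y) \<oplus>\<^bsub>?Z\<^esub> (\<phi> (h x) \<oplus>\<^bsub>?Z\<^esub> t (snd X x))"
        using u \<phi>c tc by (simp add: mhom_add[OF oZ(4)] dt)
      also have "\<dots> = \<phi> (snd Y y \<oplus>\<^bsub>?Y\<^esub> h x) \<oplus>\<^bsub>?Z\<^esub> t (snd X x)"
        using u \<phi>c tc hc oX oY oZ W'(1,8) by (simp add: mhom_add Z.M.a_assoc flip: W'(8))
      finally show ?thesis
        by (simp add: u)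
    qed
    moreover have "bij_betw ?T (carrier (direct_sum ?Y ?X)) (carrier ?Z)"
    proof (rule bij_betw_imageI)
      have \<psi>T: "\<psi> (\<phi> y \<oplus>\<^bsub>?Z\<^esub> t x) = x" if "y \<in> carrier ?Y" "x \<in> carrier ?X" for y x
        using that W'(10) tx tc \<phi>c by (simp add: mhom_add[OF W'(2)])
      show "inj_on ?T (carrier (direct_sum ?Y ?X))"
      proof (rule inj_onI, clarsimp)
        fix y x y' x' assume c: "y \<in> carrier ?Y" "x \<in> carrier ?X" "y' \<in> carrier ?Y" "x' \<in> carrier ?X"
          and eq: "\<phi> y \<oplus>\<^bsub>?Z\<^esub> t x = \<phi> y' \<oplus>\<^bsub>?Z\<^esub> t x'"
        have "x = x'"
          using \<psi>T[OF c(1,2)] \<psi>T[OF c(3,4)] eq by simp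
        moreover from this have "\<phi> y = \<phi> y'"
          using eq c \<phi>c tc by (simp)
        ultimately show "y = y' \<and> x = x'"
          using inj_onD[OF W'(5) _ c(1,3)] by simp
      qed
      show "?T ` carrier (direct_sum ?Y ?X) = carrier ?Z"
      proof (intro equalityI subsetI)
        fix z assume z: "z \<in> carrier ?Z"
        define x where "x = \<psi> z"
        have x: "x \<in> carrier ?X" using z W'(2) by (simp add: x_def mhom_closed)
        have "\<psi> (z \<ominus>\<^bsub>?Z\<^esub> t x) = \<zero>\<^bsub>?X\<^esub>"
          using x z tc tx mhom_minus[OF oZ(2) oX(2) W'(2) z tc[OF x]] by (simp add: x_def X.M.minus_self)
        then obtain y where y: "y \<in> carrier ?Y" "z \<ominus>\<^bsub>?Z\<^esub> t x = \<phi> y"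
          using W'(7)[of "z \<ominus>\<^bsub>?Z\<^esub> t x"] z tc[OF x] by (auto simp: a_minus_def)
        then have "z = \<phi> y \<oplus>\<^bsub>?Z\<^esub> t x"
          using Z.M.minus_add_cancel[OF z tc[OF x]] by simp
        then show "z \<in> ?T ` carrier (direct_sum ?Y ?X)"
          using x y by (intro image_eqI[of _ _ "(y, x)"]) auto
      qed (auto simp: \<phi>c tc)
    qed
    moreover have "F (\<phi>, \<psi>) g = restrict ?T (carrier (direct_sum ?Y ?X))"
      by (auto simp: F_def t_def)
    ultimately have "F (\<phi>, \<psi>) g \<in> I h"
      using C1_isoI[of A "ext_complex X Y h" ?T Z] C1_objectD[OF C1_object_ext_complex[OF X Y hE]]
      by (simp add: I_def)
    then show ?thesis using hE by blast
  qed
  \<comment> \<open>All data can be read off F w g: it restricts to \<phi> on Y and to the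
    splitting, hence to g, on X, and \<psi> is the second coordinate of its inverse.\<close>
  have F0: "F (\<phi>, \<psi>) g (y, \<zero>\<^bsub>?X\<^esub>) = \<phi> y"
      "x \<in> carrier ?X \<Longrightarrow> F (\<phi>, \<psi>) g (\<zero>\<^bsub>?Y\<^esub>, x) = sec (\<phi>, \<psi>) x \<oplus>\<^bsub>?Z\<^esub> \<phi> (g x)"
      "x \<in> carrier ?X \<Longrightarrow> \<psi> (F (\<phi>, \<psi>) g (y, x)) = x"
    if w: "(\<phi>, \<psi>) \<in> ?W" and g: "g \<in> homs A ?X ?Y" and y: "y \<in> carrier ?Y" for \<phi> \<psi> g y x
  proof -
    note t' = t[OF w g]
    have "sec (\<phi>, \<psi>) \<zero>\<^bsub>?X\<^esub> \<oplus>\<^bsub>?Z\<^esub> \<phi> (g \<zero>\<^bsub>?X\<^esub>) = \<zero>\<^bsub>?Z\<^esub>"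
      by (rule mhom_zero[OF oX(2) oZ(2) t'(1)])
    then show "F (\<phi>, \<psi>) g (y, \<zero>\<^bsub>?X\<^esub>) = \<phi> y"
      using y mhom_closed[OF W(1)[OF w]] by (simp add: F_def)
    assume x: "x \<in> carrier ?X"
    have c: "sec (\<phi>, \<psi>) x \<oplus>\<^bsub>?Z\<^esub> \<phi> (g x) \<in> carrier ?Z"
      by (rule mhom_closed[OF t'(1) x])
    show "F (\<phi>, \<psi>) g (\<zero>\<^bsub>?Y\<^esub>, x) = sec (\<phi>, \<psi>) x \<oplus>\<^bsub>?Z\<^esub> \<phi> (g x)"
      using x c mhom_zero[OF oY(2) oZ(2) W(1)[OF w]] by (simp add: F_def)
    show "\<psi> (F (\<phi>, \<psi>) g (y, x)) = x"
      using x y c t'(2)[OF x] mhom_closed[OF W(1)[OF w] y] W(10)[OF w y]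
      by (simp add: F_def mhom_add[OF W(2)[OF w]])
  qed
  have inj: "inj_on (\<lambda>(w, g). F w g) (?W \<times> homs A ?X ?Y)"
  proof (rule inj_onI, clarify)
    fix \<phi> \<psi> g \<phi>' \<psi>' g'
    assume w: "(\<phi>, \<psi>) \<in> ?W" and g: "g \<in> homs A ?X ?Y" and w': "(\<phi>', \<psi>') \<in> ?W"
      and g': "g' \<in> homs A ?X ?Y" and eq: "F (\<phi>, \<psi>) g = F (\<phi>', \<psi>') g'"
    have "\<phi> = \<phi>'"
      using F0(1)[OF w g] F0(1)[OF w' g'] eq by (intro homs_eqI[OF W(3)[OF w] W(3)[OF w']]) simp
    moreover have "\<psi> = \<psi>'"
    proof (rule homs_eqI[OF W(4)[OF w] W(4)[OF w']])
      fix z assume z: "z \<in> carrier ?Z"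
      obtain h where "F (\<phi>, \<psi>) g \<in> I h" using into[OF w g] by blast
      then have "F (\<phi>, \<psi>) g ` (carrier ?Y \<times> carrier ?X) = carrier ?Z"
        using C1_isoD(5)[of "F (\<phi>, \<psi>) g" A "ext_complex X Y h" Z] by (simp add: I_def bij_betw_def)
      then obtain y x where "z = F (\<phi>, \<psi>) g (y, x)" "y \<in> carrier ?Y" "x \<in> carrier ?X"
        using z by (metis (no_types, lifting) SigmaE imageE)
      then show "\<psi> z = \<psi>' z"
        using F0(3)[OF w g] F0(3)[OF w' g'] eq by metis
    qed
    moreover have "g = g'"
    proof (rule homs_eqI[OF g g'])
      fix x assume x: "x \<in> carrier ?X"
      have gc: "g x \<in> carrier ?Y" "g' x \<in> carrier ?Y"
        using mhom_closed[OF homs_mhom[OF g] x] mhom_closed[OF homs_mhom[OF g'] x] .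
      have "sec (\<phi>, \<psi>) x \<oplus>\<^bsub>?Z\<^esub> \<phi> (g x) = sec (\<phi>, \<psi>) x \<oplus>\<^bsub>?Z\<^esub> \<phi> (g' x)"
        using F0(2)[OF w g Y.M.zero_closed x] F0(2)[OF w' g' Y.M.zero_closed x] eq
          \<open>\<phi> = \<phi>'\<close> \<open>\<psi> = \<psi>'\<close> by simp
      then have "\<phi> (g x) = \<phi> (g' x)"
        using gc mhom_closed[OF sec(1)[OF w] x] mhom_closed[OF W(1)[OF w]] by simp
      then show "g x = g' x"
        using inj_onD[OF W(5)[OF w]] gc by simp
    qed
    ultimately show "(\<phi>, \<psi>) = (\<phi>', \<psi>') \<and> g = g'" by blast
  qed
  have onto: "\<exists>w\<in>?W. \<exists>g\<in>homs A ?X ?Y. \<theta> = F w g"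
    if h: "h \<in> ext_maps A X Y" and \<theta>: "\<theta> \<in> I h" for h \<theta>
  proof -
    have hm: "h \<in> mhom A ?X ?Y" using h by (simp add: ext_maps_def homs_mhom)
    note T = C1_isoD[OF \<theta>[unfolded I_def], simplified]
    have T4: "\<theta> (snd Y y \<oplus>\<^bsub>?Y\<^esub> h x, snd X x) = snd Z (\<theta> (y, x))"
      if "y \<in> carrier ?Y" "x \<in> carrier ?X" for y x
      using T(4)[of "(y, x)"] that by simp
    have Tinj: "inj_on \<theta> (carrier ?Y \<times> carrier ?X)" and Tim: "\<theta> ` (carrier ?Y \<times> carrier ?X) = carrier ?Z"
      using T(5) by (auto simp: bij_betw_def)
    define \<theta>' where "\<theta>' = inv_into (carrier ?Y \<times> carrier ?X) \<theta>"
    have inv: "\<theta>' (\<theta> (y, x)) = (y, x)" if "y \<in> carrier ?Y" "x \<in> carrier ?X" for y x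
      using Tinj that by (simp add: \<theta>'_def)
    have zE: "\<exists>y\<in>carrier ?Y. \<exists>x\<in>carrier ?X. z = \<theta> (y, x)" if "z \<in> carrier ?Z" for z
      using that Tim by (metis (no_types, lifting) SigmaE imageE)
    have T': "\<theta>' \<in> mhom A ?Z (direct_sum ?Y ?X)"
      using mhom_inv_into[OF lD T(2)] T(5) by (simp add: \<theta>'_def)
    \<comment> \<open>The isomorphism \<theta> carries the canonical exact sequence of the extension
      complex over to Z.\<close>
    let ?\<phi> = "\<lambda>y\<in>carrier ?Y. \<theta> (y, \<zero>\<^bsub>?X\<^esub>)" and ?\<psi> = "\<lambda>z\<in>carrier ?Z. snd (\<theta>' z)"
    have i1: "(\<lambda>y. (y, \<zero>\<^bsub>?X\<^esub>)) \<in> mhom A ?Y (direct_sum ?Y ?X)"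
      by (intro mhomI) (auto simp: X.smult_zero_right)
    have i2: "(\<lambda>x. (\<zero>\<^bsub>?Y\<^esub>, x)) \<in> mhom A ?X (direct_sum ?Y ?X)"
      by (intro mhomI) (auto simp: Y.smult_zero_right)
    have p2: "snd \<in> mhom A (direct_sum ?Y ?X) ?X"
      by (intro mhomI) auto
    have \<phi>: "?\<phi> \<in> homs A ?Y ?Z"
      by (intro homs_restrict oY mhom_compose[OF i1 T(2)])
    have \<psi>: "?\<psi> \<in> homs A ?Z ?X"
      by (intro homs_restrict oZ mhom_compose[OF T' p2])
    have h0: "h \<zero>\<^bsub>?X\<^esub> = \<zero>\<^bsub>?Y\<^esub>" "snd X \<zero>\<^bsub>?X\<^esub> = \<zero>\<^bsub>?X\<^esub>"
      using mhom_zero[OF oX(2) oY(2) hm] mhom_zero[OF oX(2) oX(2) oX(4)] by auto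
    have \<phi>\<psi>: "?\<psi> (\<theta> (y, x)) = x" if "y \<in> carrier ?Y" "x \<in> carrier ?X" for y x
      using that inv T(3) by simp
    have w: "(?\<phi>, ?\<psi>) \<in> ?W"
    proof -
      have "?\<phi> \<in> C1_hom A Y Z"
        using \<phi> oY T4[OF _ X.M.zero_closed] by (simp add: C1_hom_iff h0)
      moreover have "?\<psi> (snd Z z) = snd X (?\<psi> z)" if zc: "z \<in> carrier ?Z" for z
      proof -
        obtain y x where z: "y \<in> carrier ?Y" "x \<in> carrier ?X" "z = \<theta> (y, x)"
          using zE[OF zc] by blast
        then have "snd Z z = \<theta> (snd Y y \<oplus>\<^bsub>?Y\<^esub> h x, snd X x)"
          using T4 by simp
        then show ?thesis
          using z \<phi>\<psi> oX oY mhom_closed[OF hm] by simp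
      qed
      then have "?\<psi> \<in> C1_hom A Z X"
        using \<psi> by (simp add: C1_hom_iff)
      moreover have "inj_on ?\<phi> (carrier ?Y)"
      proof (rule inj_onI)
        fix y y' assume "y \<in> carrier ?Y" "y' \<in> carrier ?Y" "?\<phi> y = ?\<phi> y'"
        then show "y = y'"
          using inj_onD[OF Tinj, of "(y, \<zero>\<^bsub>?X\<^esub>)" "(y', \<zero>\<^bsub>?X\<^esub>)"] by simp
      qed
      moreover have "?\<psi> ` carrier ?Z = carrier ?X"
      proof (intro equalityI subsetI)
        fix x assume "x \<in> ?\<psi> ` carrier ?Z"
        then show "x \<in> carrier ?X"
          using mhom_closed[OF homs_mhom[OF \<psi>]] by blast
      next
        fix x assume x: "x \<in> carrier ?X"
        show "x \<in> ?\<psi> ` carrier ?Z"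
        proof (rule image_eqI)
          show "x = ?\<psi> (\<theta> (\<zero>\<^bsub>?Y\<^esub>, x))"
            using \<phi>\<psi>[OF Y.M.zero_closed x] by (rule sym)
          show "\<theta> (\<zero>\<^bsub>?Y\<^esub>, x) \<in> carrier ?Z"
            using T(3)[of "(\<zero>\<^bsub>?Y\<^esub>, x)"] x by simp
        qed
      qed
      moreover have "?\<phi> ` carrier ?Y = a_kernel ?Z ?X ?\<psi>"
      proof (intro equalityI subsetI)
        fix z assume "z \<in> ?\<phi> ` carrier ?Y"
        then show "z \<in> a_kernel ?Z ?X ?\<psi>"
          using T(3) \<phi>\<psi> by (auto simp: a_kernel_eq inv)
      next
        fix z assume "z \<in> a_kernel ?Z ?X ?\<psi>"
        then have z: "z \<in> carrier ?Z" "?\<psi> z = \<zero>\<^bsub>?X\<^esub>" by (auto simp: a_kernel_eq)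
        then show "z \<in> ?\<phi> ` carrier ?Y"
          using zE[OF z(1)] \<phi>\<psi> by force
      qed
      ultimately show ?thesis
        by (simp add: short_exact_pairs_def)
    qed
    let ?s = "sec (?\<phi>, ?\<psi>)"
    \<comment> \<open>The splitting given by \<theta> minus the chosen one. It is killed by the
      surjection, so it is the injection applied to some g.\<close>
    let ?f = "\<lambda>x. \<theta> (\<zero>\<^bsub>?Y\<^esub>, x) \<oplus>\<^bsub>?Z\<^esub> (\<ominus>\<^bsub>?Z\<^esub> ?s x)"
    have fm: "?f \<in> mhom A ?X ?Z"
      by (intro mhom_add_map mhom_uminus_map oX oZ mhom_compose[OF i2 T(2)] sec(1)[OF w])
    have sc: "?s x \<in> carrier ?Z" if "x \<in> carrier ?X" for x
      using that by (rule mhom_closed[OF sec(1)[OF w]])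
    have fc: "?f x \<in> ?\<phi> ` carrier ?Y" if x: "x \<in> carrier ?X" for x
    proof -
      have Tc: "\<theta> (\<zero>\<^bsub>?Y\<^esub>, x) \<in> carrier ?Z" using x T(3) by simp
      have "?\<psi> (?f x) = ?\<psi> (\<theta> (\<zero>\<^bsub>?Y\<^esub>, x)) \<ominus>\<^bsub>?X\<^esub> ?\<psi> (?s x)"
        using mhom_minus[OF oZ(2) oX(2) homs_mhom[OF \<psi>] Tc sc[OF x]]
        by (simp only: a_minus_def)
      also have "\<dots> = x \<ominus>\<^bsub>?X\<^esub> x"
        using sec(2)[OF w x] \<phi>\<psi>[OF Y.M.zero_closed x] by simp
      also have "\<dots> = \<zero>\<^bsub>?X\<^esub>"
        using x by (rule X.M.minus_self)
      finally show ?thesis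
        using W(7)[OF w mhom_closed[OF fm x]] by simp
    qed
    obtain g where g: "g \<in> homs A ?X ?Y" "\<And>x. x \<in> carrier ?X \<Longrightarrow> ?\<phi> (g x) = ?f x"
      using mhom_factor[OF oY(2) oX(2) oZ(2) W(1,5)[OF w] fm fc] by metis
    have "\<theta> = F (?\<phi>, ?\<psi>) g"
    proof (rule extensionalityI[of _ "carrier ?Y \<times> carrier ?X"])
      show "\<theta> \<in> extensional (carrier ?Y \<times> carrier ?X)"
        using T(1) by (simp add: homs_def)
      show "F (?\<phi>, ?\<psi>) g \<in> extensional (carrier ?Y \<times> carrier ?X)"
        by (simp add: F_def)
      fix u assume "u \<in> carrier ?Y \<times> carrier ?X"
      then obtain y x where u: "u = (y, x)" "y \<in> carrier ?Y" "x \<in> carrier ?X" by auto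
      have Tc: "\<theta> (\<zero>\<^bsub>?Y\<^esub>, x) \<in> carrier ?Z" using u T(3) by simp
      have "?s x \<oplus>\<^bsub>?Z\<^esub> ?\<phi> (g x) = \<theta> (\<zero>\<^bsub>?Y\<^esub>, x)"
        unfolding g(2)[OF u(3)] using Z.M.minus_add_cancel[OF Tc sc[OF u(3)]] Tc sc[OF u(3)]
        by (simp add: a_minus_def Z.M.a_ac)
      then have "F (?\<phi>, ?\<psi>) g u = ?\<phi> y \<oplus>\<^bsub>?Z\<^esub> \<theta> (\<zero>\<^bsub>?Y\<^esub>, x)"
        using u by (simp only: F_def) simp
      also have "\<dots> = \<theta> (y, x)"
        using u mhom_add[OF T(2), of "(y, \<zero>\<^bsub>?X\<^esub>)" "(\<zero>\<^bsub>?Y\<^esub>, x)"] by simp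
      finally show "\<theta> u = F (?\<phi>, ?\<psi>) g u" by (simp add: u)
    qed
    then show ?thesis using w g by blast
  qed
  \<comment> \<open>At (0, x), compatibility with the differentials reads \<theta>(h x, d x) = d_Z
    \<theta>(0, x). As \<theta> is injective, it determines h.\<close>
  have disj: "h = h'"
    if h: "h \<in> ext_maps A X Y" "h' \<in> ext_maps A X Y" and \<theta>: "\<theta> \<in> I h" "\<theta> \<in> I h'" for h h' \<theta>
  proof (rule homs_eqI[OF h[THEN ext_maps_homs]])
    fix x assume x: "x \<in> carrier ?X"
    note T = C1_isoD[OF \<theta>(1)[unfolded I_def], simplified] and T' = C1_isoD[OF \<theta>(2)[unfolded I_def], simplified]
    have hc: "h x \<in> carrier ?Y" "h' x \<in> carrier ?Y"
      using mhom_closed[OF homs_mhom[OF ext_maps_homs[OF h(1)]] x]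
        mhom_closed[OF homs_mhom[OF ext_maps_homs[OF h(2)]] x] by auto
    have "snd Y \<zero>\<^bsub>?Y\<^esub> = \<zero>\<^bsub>?Y\<^esub>"
      using mhom_zero[OF oY(2) oY(2) oY(4)] .
    then have "\<theta> (h x, snd X x) = \<theta> (h' x, snd X x)"
      using T(4)[of "(\<zero>\<^bsub>?Y\<^esub>, x)"] T'(4)[of "(\<zero>\<^bsub>?Y\<^esub>, x)"] x hc by simp
    then show "h x = h' x"
      using T(5) x oX hc by (auto simp: bij_betw_def dest: inj_onD)
  qed
  have "(\<lambda>(w, g). F w g) ` (?W \<times> homs A ?X ?Y) = (\<Union>h\<in>ext_maps A X Y. I h)"
  proof (intro equalityI subsetI)
    fix \<theta> assume "\<theta> \<in> (\<lambda>(w, g). F w g) ` (?W \<times> homs A ?X ?Y)"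
    then show "\<theta> \<in> (\<Union>h\<in>ext_maps A X Y. I h)" using into by auto
  next
    fix \<theta> assume "\<theta> \<in> (\<Union>h\<in>ext_maps A X Y. I h)"
    then obtain w g where "w \<in> ?W" "g \<in> homs A ?X ?Y" "\<theta> = F w g" using onto by blast
    then show "\<theta> \<in> (\<lambda>(w, g). F w g) ` (?W \<times> homs A ?X ?Y)" by force
  qed
  then have "card ?W * card (homs A ?X ?Y) = card (\<Union>h\<in>ext_maps A X Y. I h)"
    using card_image[OF inj] by (simp add: card_cartesian_product)
  also have "\<dots> = (\<Sum>h\<in>ext_maps A X Y. card (I h))"
  proof (rule card_UN_disjoint)
    show "finite (ext_maps A X Y)" by (rule finite_ext_maps[OF X Y])
    show "\<forall>h\<in>ext_maps A X Y. finite (I h)"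
      unfolding I_def using X Y Z C1_object_ext_complex finite_C1_iso by blast
    show "\<forall>h\<in>ext_maps A X Y. \<forall>h'\<in>ext_maps A X Y. h \<noteq> h' \<longrightarrow> I h \<inter> I h' = {}"
      using disj by blast
  qed
  finally show ?thesis by (simp add: I_def)
qed

end

section \<open>The twisted Hall algebra and its quotients\<close>

context finite_algebra
begin

text \<open>The square root is the twist, whose Euler form takes its arguments in the order Y, X;
  the other factor is the number of splittings of an exact sequence. Hence the asymmetry in X and
  Y.\<close>

definition hall_factor :: "('a, 'x) cyclic_complex \<Rightarrow> ('a, 'y) cyclic_complex \<Rightarrow> real" where
  "hall_factor X Y = 1 / (sqrt (real (card (homs A (fst Y) (fst X)))) * real (card (homs A (fst X) (fst Y))))"

lemma card_homs_pos:
  assumes "left_module A M" "left_module A N" "finite (carrier M)" "finite (carrier N)"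
  shows "card (homs A M N) > 0"
  using homs_restrict[OF assms(1) mhom_zero_map[OF assms(1,2)]] finite_homs[OF assms(3,4)]
  by (metis card_gt_0_iff empty_iff)

text \<open>|Aut X| |Aut Y| cancels the denominator of the Hall number. In the count of split
  sequences, h contributes the number of isomorphisms from Z(h) to a representative of \<gamma>,
  which is |Aut Z(h)| or 0.\<close>

lemma structure_constant_eq:
  assumes X: "C1_object K A X" and Y: "C1_object K A Y" and \<gamma>: "\<gamma> \<in> isoclasses K A"
  shows "structure_constant K A (isoclass K A X) (isoclass K A Y) \<gamma> *
      (real (card (C1_iso A X X)) * real (card (C1_iso A Y Y))) =
    hall_factor X Y * (\<Sum>h\<in>ext_maps A X Y. if \<gamma> = isoclass K A (ext_complex X Y h)
      then real (card (C1_iso A (ext_complex X Y h) (ext_complex X Y h))) else 0)"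
proof -
  define X' Y' Z where "X' = representative (isoclass K A X)"
    and "Y' = representative (isoclass K A Y)" and "Z = representative \<gamma>"
  have iX: "cpx_iso X X'" and iY: "cpx_iso Y Y'"
    unfolding X'_def Y'_def using cpx_iso_representative[OF X] cpx_iso_representative[OF Y] .
  have Z: "C1_object K A Z" "isoclass K A Z = \<gamma>"
    using representative[OF \<gamma>] by (auto simp: Z_def)
  have X': "C1_object K A X'" and Y': "C1_object K A Y'"
    using iX iY by (auto simp: cpx_iso_def)
  have iso_card: "real (card (C1_iso A (ext_complex X Y h) Z)) =
      (if \<gamma> = isoclass K A (ext_complex X Y h)
       then real (card (C1_iso A (ext_complex X Y h) (ext_complex X Y h))) else 0)"
    if h: "h \<in> ext_maps A X Y" for h
  proof -
    note E = C1_object_ext_complex[OF X Y h]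
    show ?thesis
    proof (cases "\<gamma> = isoclass K A (ext_complex X Y h)")
      case True
      then have "cpx_iso (ext_complex X Y h) Z"
        using isoclass_eq_iff[OF E Z(1)] Z(2) by simp
      from card_C1_iso_aut(1)[OF this] show ?thesis using True by simp
    next
      case False
      then have "\<not> cpx_iso (ext_complex X Y h) Z"
        using isoclass_eq_iff[OF E Z(1)] Z(2) by simp
      then have "C1_iso A (ext_complex X Y h) Z = {}"
        using E Z(1) by (simp add: cpx_iso_def)
      then show ?thesis using False by simp
    qed
  qed
  have N: "real (card (homs A (fst X) (fst Y))) > 0"
    using card_homs_pos C1_objectD[OF X] C1_objectD[OF Y] by simp
  have aut: "real (card (C1_iso A X X)) > 0" "real (card (C1_iso A Y Y)) > 0"
    using card_aut_pos X Y by simp_all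
  have "real (card (short_exact_pairs A X Y Z)) * real (card (homs A (fst X) (fst Y))) =
      (\<Sum>h\<in>ext_maps A X Y. real (card (C1_iso A (ext_complex X Y h) Z)))"
    using card_short_exact_pairs[OF X Y Z(1)] by (metis of_nat_mult of_nat_sum)
  then have W: "real (card (short_exact_pairs A X Y Z)) =
      (\<Sum>h\<in>ext_maps A X Y. if \<gamma> = isoclass K A (ext_complex X Y h)
        then real (card (C1_iso A (ext_complex X Y h) (ext_complex X Y h))) else 0) /
      real (card (homs A (fst X) (fst Y)))"
    using N iso_card by (simp add: field_simps cong: sum.cong)
  have "twisting_parameter K powi (- euler_form K A (fst Y') (fst X')) =
      1 / sqrt (real (card (homs A (fst Y) (fst X))))"
    using twist_eq[OF C1_objectD(1)[OF Y'] C1_objectD(2,3)[OF X']] card_homs_iso[OF iY iX] by simp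
  moreover have "card (short_exact_pairs A X' Y' Z) = card (short_exact_pairs A X Y Z)"
    using card_short_exact_pairs_iso[OF iX iY Z(1)] by simp
  ultimately have "structure_constant K A (isoclass K A X) (isoclass K A Y) \<gamma> =
      1 / sqrt (real (card (homs A (fst Y) (fst X)))) * (real (card (short_exact_pairs A X Y Z)) /
        (real (card (C1_iso A X X)) * real (card (C1_iso A Y Y))))"
    using card_C1_iso_aut(2)[OF iX] card_C1_iso_aut(2)[OF iY]
    by (simp add: structure_constant_def hall_number_def Let_def flip: X'_def Y'_def Z_def)
  then show ?thesis
    using aut by (simp add: W hall_factor_def)
qed

section \<open>The Hall algebra: products in the rescaled basis, bilinearity, ideals\<close>

abbreviation H where "H \<equiv> twisted_hall_algebra K A"

lemma carrier_H: "f \<in> carrier H \<longleftrightarrow> finite {\<gamma>. f \<gamma> \<noteq> 0} \<and> {\<gamma>. f \<gamma> \<noteq> 0} \<subseteq> isoclasses K A"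
  by (simp add: twisted_hall_algebra_def)

lemma H_simps:
  "f \<oplus>\<^bsub>H\<^esub> g = (\<lambda>\<gamma>. f \<gamma> + g \<gamma>)" "c \<odot>\<^bsub>H\<^esub> f = (\<lambda>\<gamma>. c * f \<gamma>)" "\<zero>\<^bsub>H\<^esub> = (\<lambda>\<gamma>. 0)"
  by (simp_all add: twisted_hall_algebra_def)

text \<open>The product is defined by sums over exact supports, which change under addition. Sums
  over larger finite sets, common to all elements involved, make bilinearity a termwise
  check.\<close>

lemma H_mult:
  assumes "finite S" "{\<alpha>. f \<alpha> \<noteq> 0} \<subseteq> S" "finite T" "{\<beta>. g \<beta> \<noteq> 0} \<subseteq> T"
  shows "f \<otimes>\<^bsub>H\<^esub> g = (\<lambda>\<gamma>. if \<gamma> \<in> isoclasses K A then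
    \<Sum>\<alpha>\<in>S. \<Sum>\<beta>\<in>T. f \<alpha> * g \<beta> * complex_of_real (structure_constant K A \<alpha> \<beta> \<gamma>) else 0)"
proof
  fix \<gamma>
  have "(\<Sum>\<alpha>\<in>{\<alpha>. f \<alpha> \<noteq> 0}. \<Sum>\<beta>\<in>{\<beta>. g \<beta> \<noteq> 0}.
      f \<alpha> * g \<beta> * complex_of_real (structure_constant K A \<alpha> \<beta> \<gamma>)) =
    (\<Sum>\<alpha>\<in>S. \<Sum>\<beta>\<in>{\<beta>. g \<beta> \<noteq> 0}. f \<alpha> * g \<beta> * complex_of_real (structure_constant K A \<alpha> \<beta> \<gamma>))"
    using assms by (intro sum.mono_neutral_left) auto
  also have "\<dots> = (\<Sum>\<alpha>\<in>S. \<Sum>\<beta>\<in>T. f \<alpha> * g \<beta> * complex_of_real (structure_constant K A \<alpha> \<beta> \<gamma>))"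
    using assms by (intro sum.cong refl sum.mono_neutral_left) auto
  finally show "(f \<otimes>\<^bsub>H\<^esub> g) \<gamma> = (if \<gamma> \<in> isoclasses K A then
    \<Sum>\<alpha>\<in>S. \<Sum>\<beta>\<in>T. f \<alpha> * g \<beta> * complex_of_real (structure_constant K A \<alpha> \<beta> \<gamma>) else 0)"
    by (simp add: twisted_hall_algebra_def)
qed

definition ebas :: "('a, 'm) cyclic_complex \<Rightarrow> 'a isoclass \<Rightarrow> complex" where
  "ebas X = (\<lambda>\<gamma>. of_nat (card (C1_iso A X X)) * basis_vector K A X \<gamma>)"

lemma basis_vector_H: "C1_object K A X \<Longrightarrow> basis_vector K A X \<in> carrier H"
  using isoclass_in_isoclasses[of X] by (auto simp: carrier_H basis_vector_def)

lemma H_closed: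
  "f \<in> carrier H \<Longrightarrow> g \<in> carrier H \<Longrightarrow> (\<lambda>\<gamma>. f \<gamma> + g \<gamma>) \<in> carrier H"
  "f \<in> carrier H \<Longrightarrow> (\<lambda>\<gamma>. c * f \<gamma>) \<in> carrier H"
  "f \<in> carrier H \<Longrightarrow> g \<in> carrier H \<Longrightarrow> (\<lambda>\<gamma>. f \<gamma> - g \<gamma>) \<in> carrier H"
  "(\<lambda>\<gamma>. 0) \<in> carrier H"
proof -
  assume f: "f \<in> carrier H"
  show "(\<lambda>\<gamma>. c * f \<gamma>) \<in> carrier H"
    using f unfolding carrier_H by (auto elim: rev_finite_subset)
  assume g: "g \<in> carrier H"
  have fin: "finite ({\<gamma>. f \<gamma> \<noteq> 0} \<union> {\<gamma>. g \<gamma> \<noteq> 0})"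
    using f g by (simp add: carrier_H)
  have sub: "{\<gamma>. f \<gamma> \<noteq> 0} \<union> {\<gamma>. g \<gamma> \<noteq> 0} \<subseteq> isoclasses K A"
    using f g by (simp add: carrier_H)
  have "{\<gamma>. f \<gamma> + g \<gamma> \<noteq> 0} \<subseteq> {\<gamma>. f \<gamma> \<noteq> 0} \<union> {\<gamma>. g \<gamma> \<noteq> 0}"
    "{\<gamma>. f \<gamma> - g \<gamma> \<noteq> 0} \<subseteq> {\<gamma>. f \<gamma> \<noteq> 0} \<union> {\<gamma>. g \<gamma> \<noteq> 0}"
    by auto
  note * = this[THEN finite_subset, OF fin] this[THEN subset_trans, OF sub]
  show "(\<lambda>\<gamma>. f \<gamma> + g \<gamma>) \<in> carrier H"
    using * by (simp only: carrier_H)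
  show "(\<lambda>\<gamma>. f \<gamma> - g \<gamma>) \<in> carrier H"
    using * by (simp only: carrier_H)
qed (simp add: carrier_H)

lemma ebas_H: "C1_object K A X \<Longrightarrow> ebas X \<in> carrier H"
  unfolding ebas_def by (intro H_closed basis_vector_H)

lemma ebas_iso: "cpx_iso X Y \<Longrightarrow> ebas X = ebas Y"
  using isoclass_eq_iff[of X Y] card_C1_iso_aut(2)[of X Y]
  by (auto simp: ebas_def basis_vector_def cpx_iso_def)

lemma basis_vector_ebas:
  "C1_object K A X \<Longrightarrow> basis_vector K A X = (\<lambda>\<gamma>. inverse (of_nat (card (C1_iso A X X))) * ebas X \<gamma>)"
  using card_aut_pos[of X] by (simp add: ebas_def field_simps)

text \<open>The weights |Aut X| |Aut Y| and |Aut Z(h)| are those of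
  \<open>structure_constant_eq\<close>; at arguments outside \<open>isoclasses K A\<close> both
  sides vanish.\<close>

lemma ebas_mult:
  assumes X: "C1_object K A X" and Y: "C1_object K A Y"
  shows "ebas X \<otimes>\<^bsub>H\<^esub> ebas Y =
    (\<lambda>\<gamma>. complex_of_real (hall_factor X Y) * (\<Sum>h\<in>ext_maps A X Y. ebas (ext_complex X Y h) \<gamma>))"
proof
  fix \<gamma>
  let ?e = "\<lambda>h. ext_complex X Y h"
  have b: "ebas Z \<gamma> = complex_of_real (if \<gamma> = isoclass K A Z then real (card (C1_iso A Z Z)) else 0)"
    for Z :: "('a, 'm) cyclic_complex"
    by (simp add: ebas_def basis_vector_def)
  show "(ebas X \<otimes>\<^bsub>H\<^esub> ebas Y) \<gamma> =
      complex_of_real (hall_factor X Y) * (\<Sum>h\<in>ext_maps A X Y. ebas (?e h) \<gamma>)"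
  proof (cases "\<gamma> \<in> isoclasses K A")
    case True
    have "(ebas X \<otimes>\<^bsub>H\<^esub> ebas Y) \<gamma> = complex_of_real
        (structure_constant K A (isoclass K A X) (isoclass K A Y) \<gamma> *
          (real (card (C1_iso A X X)) * real (card (C1_iso A Y Y))))"
      using True
      by (subst H_mult[of "{isoclass K A X}" _ "{isoclass K A Y}"])
        (auto simp: ebas_def basis_vector_def)
    also have "\<dots> = complex_of_real (hall_factor X Y) * (\<Sum>h\<in>ext_maps A X Y. ebas (?e h) \<gamma>)"
      unfolding structure_constant_eq[OF X Y True] b by simp
    finally show ?thesis .
  next
    case False
    then have "ebas (?e h) \<gamma> = 0" if "h \<in> ext_maps A X Y" for h
      using isoclass_in_isoclasses[OF C1_object_ext_complex[OF X Y that]] by (auto simp: b)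
    then show ?thesis
      using False by (simp add: twisted_hall_algebra_def)
  qed
qed

text \<open>Only classes of extension complexes of the two representatives can occur, and
  \<open>ext_maps\<close> is finite.\<close>

lemma finite_structure_constant:
  assumes "\<alpha> \<in> isoclasses K A" "\<beta> \<in> isoclasses K A"
  shows "finite {\<gamma> \<in> isoclasses K A. structure_constant K A \<alpha> \<beta> \<gamma> \<noteq> 0}"
proof (rule finite_subset)
  let ?X = "representative \<alpha>" and ?Y = "representative \<beta>"
  note X = representative[OF assms(1)] and Y = representative[OF assms(2)]
  show "finite ((\<lambda>h. isoclass K A (ext_complex ?X ?Y h)) ` ext_maps A ?X ?Y)"
    by (intro finite_imageI finite_ext_maps X Y)
  show "{\<gamma> \<in> isoclasses K A. structure_constant K A \<alpha> \<beta> \<gamma> \<noteq> 0} \<subseteq>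
      (\<lambda>h. isoclass K A (ext_complex ?X ?Y h)) ` ext_maps A ?X ?Y"
  proof clarify
    fix \<gamma> assume g: "\<gamma> \<in> isoclasses K A" "structure_constant K A \<alpha> \<beta> \<gamma> \<noteq> 0"
    have "structure_constant K A \<alpha> \<beta> \<gamma> *
        (real (card (C1_iso A ?X ?X)) * real (card (C1_iso A ?Y ?Y))) \<noteq> 0"
      using g card_aut_pos[OF X(1)] card_aut_pos[OF Y(1)] by simp
    then have "(\<Sum>h\<in>ext_maps A ?X ?Y. if \<gamma> = isoclass K A (ext_complex ?X ?Y h)
        then real (card (C1_iso A (ext_complex ?X ?Y h) (ext_complex ?X ?Y h))) else 0) \<noteq> 0"
      using structure_constant_eq[OF X(1) Y(1) g(1)] by (auto simp: X Y)
    then obtain h where "h \<in> ext_maps A ?X ?Y" "\<gamma> = isoclass K A (ext_complex ?X ?Y h)"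
      by (auto elim!: sum.not_neutral_contains_not_neutral split: if_splits)
    then show "\<gamma> \<in> (\<lambda>h. isoclass K A (ext_complex ?X ?Y h)) ` ext_maps A ?X ?Y"
      by blast
  qed
qed

lemma H_mult_closed:
  assumes f: "f \<in> carrier H" and g: "g \<in> carrier H"
  shows "f \<otimes>\<^bsub>H\<^esub> g \<in> carrier H"
proof -
  let ?S = "{\<gamma>. f \<gamma> \<noteq> 0}" and ?T = "{\<gamma>. g \<gamma> \<noteq> 0}"
  have fin: "finite ?S" "finite ?T" and sub: "?S \<subseteq> isoclasses K A" "?T \<subseteq> isoclasses K A"
    using f g by (auto simp: carrier_H)
  let ?U = "\<Union>\<alpha>\<in>?S. \<Union>\<beta>\<in>?T. {\<gamma> \<in> isoclasses K A. structure_constant K A \<alpha> \<beta> \<gamma> \<noteq> 0}"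
  have "finite ?U"
    using fin sub finite_structure_constant by blast
  moreover have "{\<gamma>. (f \<otimes>\<^bsub>H\<^esub> g) \<gamma> \<noteq> 0} \<subseteq> ?U"
  proof clarify
    fix \<gamma> assume nz: "(f \<otimes>\<^bsub>H\<^esub> g) \<gamma> \<noteq> 0"
    note eq = fun_cong[OF H_mult[OF fin(1) subset_refl fin(2) subset_refl], of \<gamma>]
    have \<gamma>: "\<gamma> \<in> isoclasses K A"
      using nz eq by (auto split: if_splits)
    then have "(\<Sum>\<alpha>\<in>?S. \<Sum>\<beta>\<in>?T. f \<alpha> * g \<beta> * complex_of_real (structure_constant K A \<alpha> \<beta> \<gamma>)) \<noteq> 0"
      using nz eq by simp
    then obtain \<alpha> \<beta> where "\<alpha> \<in> ?S" "\<beta> \<in> ?T"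
        "f \<alpha> * g \<beta> * complex_of_real (structure_constant K A \<alpha> \<beta> \<gamma>) \<noteq> 0"
      by (elim sum.not_neutral_contains_not_neutral)
    then show "\<gamma> \<in> ?U" using \<gamma> by auto
  qed
  moreover have "{\<gamma>. (f \<otimes>\<^bsub>H\<^esub> g) \<gamma> \<noteq> 0} \<subseteq> isoclasses K A"
    by (auto simp: twisted_hall_algebra_def split: if_splits)
  ultimately show ?thesis
    unfolding carrier_H by (blast intro: finite_subset)
qed

lemma H_mult_linear:
  assumes f: "f \<in> carrier H" and g: "g \<in> carrier H" and h: "h \<in> carrier H"
  shows "(\<lambda>\<gamma>. a * f \<gamma> + b * g \<gamma>) \<otimes>\<^bsub>H\<^esub> h = (\<lambda>\<gamma>. a * (f \<otimes>\<^bsub>H\<^esub> h) \<gamma> + b * (g \<otimes>\<^bsub>H\<^esub> h) \<gamma>)"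
    "h \<otimes>\<^bsub>H\<^esub> (\<lambda>\<gamma>. a * f \<gamma> + b * g \<gamma>) = (\<lambda>\<gamma>. a * (h \<otimes>\<^bsub>H\<^esub> f) \<gamma> + b * (h \<otimes>\<^bsub>H\<^esub> g) \<gamma>)"
proof -
  let ?S = "{\<gamma>. f \<gamma> \<noteq> 0} \<union> {\<gamma>. g \<gamma> \<noteq> 0}" and ?T = "{\<gamma>. h \<gamma> \<noteq> 0}"
  have fin: "finite ?S" "finite ?T"
    using f g h by (auto simp: carrier_H)
  have sub: "{\<gamma>. f \<gamma> \<noteq> 0} \<subseteq> ?S" "{\<gamma>. g \<gamma> \<noteq> 0} \<subseteq> ?S" "{\<gamma>. a * f \<gamma> + b * g \<gamma> \<noteq> 0} \<subseteq> ?S"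
    by auto
  note m1 = H_mult[OF fin(1) _ fin(2) subset_refl] and m2 = H_mult[OF fin(2) subset_refl fin(1)]
  show "(\<lambda>\<gamma>. a * f \<gamma> + b * g \<gamma>) \<otimes>\<^bsub>H\<^esub> h = (\<lambda>\<gamma>. a * (f \<otimes>\<^bsub>H\<^esub> h) \<gamma> + b * (g \<otimes>\<^bsub>H\<^esub> h) \<gamma>)"
    unfolding m1[OF sub(1)] m1[OF sub(2)] m1[OF sub(3)]
    by (auto simp: sum_distrib_left sum.distrib[symmetric] algebra_simps intro!: sum.cong)
  show "h \<otimes>\<^bsub>H\<^esub> (\<lambda>\<gamma>. a * f \<gamma> + b * g \<gamma>) = (\<lambda>\<gamma>. a * (h \<otimes>\<^bsub>H\<^esub> f) \<gamma> + b * (h \<otimes>\<^bsub>H\<^esub> g) \<gamma>)"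
    unfolding m2[OF sub(1)] m2[OF sub(2)] m2[OF sub(3)]
    by (auto simp: sum_distrib_left sum.distrib[symmetric] algebra_simps intro!: sum.cong)
qed

lemma H_mult_scale:
  assumes f: "f \<in> carrier H" and h: "h \<in> carrier H"
  shows "(\<lambda>\<gamma>. a * f \<gamma>) \<otimes>\<^bsub>H\<^esub> h = (\<lambda>\<gamma>. a * (f \<otimes>\<^bsub>H\<^esub> h) \<gamma>)"
    "h \<otimes>\<^bsub>H\<^esub> (\<lambda>\<gamma>. a * f \<gamma>) = (\<lambda>\<gamma>. a * (h \<otimes>\<^bsub>H\<^esub> f) \<gamma>)"
  using H_mult_linear[OF f f h, of a 0] by simp_all

lemma abelian_group_H: "abelian_group H"
proof (rule abelian_groupI)
  fix f assume f: "f \<in> carrier H"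
  have "(\<lambda>\<gamma>. - f \<gamma>) \<in> carrier H"
    using H_closed(2)[OF f, of "-1"] by simp
  then show "\<exists>g\<in>carrier H. g \<oplus>\<^bsub>H\<^esub> f = \<zero>\<^bsub>H\<^esub>"
    by (intro bexI[of _ "\<lambda>\<gamma>. - f \<gamma>"]) (simp_all add: H_simps)
qed (simp_all add: H_simps H_closed algebra_simps)

text \<open>Keeps the family intersected in \<open>generated_ideal\<close> nonempty, so that the
  intersection stays inside the carrier.\<close>

lemma two_sided_ideal_carrier: "two_sided_ideal H (carrier H)"
  unfolding two_sided_ideal_def by (auto simp: H_simps H_closed H_mult_closed)

lemma two_sided_ideal_generated:
  assumes "S \<subseteq> carrier H"
  shows "two_sided_ideal H (generated_ideal H S)" "S \<subseteq> generated_ideal H S"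
proof -
  have "generated_ideal H S \<subseteq> carrier H"
    using assms two_sided_ideal_carrier by (auto simp: generated_ideal_def)
  then show "two_sided_ideal H (generated_ideal H S)"
    by (simp add: two_sided_ideal_def generated_ideal_def)
  show "S \<subseteq> generated_ideal H S"
    by (auto simp: generated_ideal_def)
qed

end

section \<open>The quotient of the Hall algebra by an ideal\<close>

locale hall_quotient = finite_algebra K A
  for K :: "'k ring" and A :: "('k, 'a) module" +
  fixes W :: "('a isoclass \<Rightarrow> complex) set"
  assumes ideal_W: "two_sided_ideal (twisted_hall_algebra K A) W"
begin

abbreviation R where "R \<equiv> module_quot H W"
abbreviation Q where "Q x \<equiv> W +>\<^bsub>H\<^esub> x"

lemma W_H: "w \<in> W \<Longrightarrow> w \<in> carrier H"
  using ideal_W by (auto simp: two_sided_ideal_def)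

lemma W_zero: "(\<lambda>\<gamma>. 0) \<in> W"
  using ideal_W by (simp add: two_sided_ideal_def H_simps)

lemma W_add: "w \<in> W \<Longrightarrow> w' \<in> W \<Longrightarrow> (\<lambda>\<gamma>. w \<gamma> + w' \<gamma>) \<in> W"
  using ideal_W by (simp add: two_sided_ideal_def H_simps)

lemma W_scale: "w \<in> W \<Longrightarrow> (\<lambda>\<gamma>. c * w \<gamma>) \<in> W"
  using ideal_W by (simp add: two_sided_ideal_def H_simps)

lemma W_mult: "w \<in> W \<Longrightarrow> h \<in> carrier H \<Longrightarrow> w \<otimes>\<^bsub>H\<^esub> h \<in> W"
  "w \<in> W \<Longrightarrow> h \<in> carrier H \<Longrightarrow> h \<otimes>\<^bsub>H\<^esub> w \<in> W"
  using ideal_W by (auto simp: two_sided_ideal_def)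

text \<open>Relations are computed with elements of H modulo W, and cosets are formed only at the
  end. Carrier membership is included so that congruences can be chained, added and multiplied
  without side conditions.\<close>

definition cong_W (infix \<open>\<approx>\<close> 50) where
  "x \<approx> y \<longleftrightarrow> x \<in> carrier H \<and> y \<in> carrier H \<and> (\<lambda>\<gamma>. x \<gamma> - y \<gamma>) \<in> W"

lemma cong_refl: "x \<in> carrier H \<Longrightarrow> x \<approx> x"
  by (simp add: cong_W_def W_zero)

lemma cong_sym: "x \<approx> y \<Longrightarrow> y \<approx> x"
  using W_scale[of "\<lambda>\<gamma>. x \<gamma> - y \<gamma>" "-1"] by (auto simp: cong_W_def)

lemma cong_trans [trans]: "x \<approx> y \<Longrightarrow> y \<approx> z \<Longrightarrow> x \<approx> z"
  using W_add[of "\<lambda>\<gamma>. x \<gamma> - y \<gamma>" "\<lambda>\<gamma>. y \<gamma> - z \<gamma>"] by (auto simp: cong_W_def)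

lemma cong_add: "x \<approx> y \<Longrightarrow> x' \<approx> y' \<Longrightarrow> (\<lambda>\<gamma>. x \<gamma> + x' \<gamma>) \<approx> (\<lambda>\<gamma>. y \<gamma> + y' \<gamma>)"
  using W_add[of "\<lambda>\<gamma>. x \<gamma> - y \<gamma>" "\<lambda>\<gamma>. x' \<gamma> - y' \<gamma>"]
  by (auto simp: cong_W_def H_closed algebra_simps)

lemma cong_scale: "x \<approx> y \<Longrightarrow> (\<lambda>\<gamma>. c * x \<gamma>) \<approx> (\<lambda>\<gamma>. c * y \<gamma>)"
  using W_scale[of "\<lambda>\<gamma>. x \<gamma> - y \<gamma>" c] by (auto simp: cong_W_def H_closed algebra_simps)

lemma cong_zero: "w \<in> W \<Longrightarrow> w \<approx> (\<lambda>\<gamma>. 0)"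
  by (simp add: cong_W_def W_H H_closed)

lemma cong_sum:
  assumes "finite S" "\<And>i. i \<in> S \<Longrightarrow> f i \<approx> g i"
  shows "(\<lambda>\<gamma>. \<Sum>i\<in>S. f i \<gamma>) \<approx> (\<lambda>\<gamma>. \<Sum>i\<in>S. g i \<gamma>)"
  using assms by (induction S rule: finite_induct) (auto simp: cong_refl H_closed intro: cong_add)

lemma cong_mult:
  assumes "x \<approx> y" "x' \<approx> y'"
  shows "x \<otimes>\<^bsub>H\<^esub> x' \<approx> y \<otimes>\<^bsub>H\<^esub> y'"
proof -
  have c: "x \<in> carrier H" "y \<in> carrier H" "x' \<in> carrier H" "y' \<in> carrier H"
    and w: "(\<lambda>\<gamma>. x \<gamma> - y \<gamma>) \<in> W" "(\<lambda>\<gamma>. x' \<gamma> - y' \<gamma>) \<in> W"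
    using assms by (auto simp: cong_W_def)
  have "(\<lambda>\<gamma>. x \<gamma> - y \<gamma>) \<otimes>\<^bsub>H\<^esub> x' = (\<lambda>\<gamma>. (x \<otimes>\<^bsub>H\<^esub> x') \<gamma> - (y \<otimes>\<^bsub>H\<^esub> x') \<gamma>)"
    using H_mult_linear(1)[OF c(1,2,3), of 1 "-1"] by simp
  then have "x \<otimes>\<^bsub>H\<^esub> x' \<approx> y \<otimes>\<^bsub>H\<^esub> x'"
    using W_mult(1)[OF w(1) c(3)] c by (simp add: cong_W_def H_mult_closed)
  moreover have "y \<otimes>\<^bsub>H\<^esub> (\<lambda>\<gamma>. x' \<gamma> - y' \<gamma>) = (\<lambda>\<gamma>. (y \<otimes>\<^bsub>H\<^esub> x') \<gamma> - (y \<otimes>\<^bsub>H\<^esub> y') \<gamma>)"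
    using H_mult_linear(2)[OF c(3,4,2), of 1 "-1"] by simp
  then have "y \<otimes>\<^bsub>H\<^esub> x' \<approx> y \<otimes>\<^bsub>H\<^esub> y'"
    using W_mult(2)[OF w(2) c(2)] c by (simp add: cong_W_def H_mult_closed)
  ultimately show ?thesis by (rule cong_trans)
qed

sublocale HG: abelian_group H by (rule abelian_group_H)

lemma a_inv_H: "x \<in> carrier H \<Longrightarrow> \<ominus>\<^bsub>H\<^esub> x = (\<lambda>\<gamma>. - x \<gamma>)"
  using H_closed(2)[of x "-1"] by (intro HG.minus_equality) (auto simp: H_simps)

sublocale WG: abelian_subgroup W H
proof (rule abelian_subgroupI3)
  have "subgroup W (add_monoid H)"
  proof (rule HG.add.subgroupI)
    show "W \<subseteq> carrier H" using W_H by blast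
    show "W \<noteq> {}" using W_zero by blast
    fix x assume x: "x \<in> W"
    show "\<ominus>\<^bsub>H\<^esub> x \<in> W"
      using a_inv_H[OF W_H[OF x]] W_scale[OF x, of "-1"] by simp
    fix y assume "y \<in> W"
    then show "x \<oplus>\<^bsub>H\<^esub> y \<in> W"
      using x W_add by (simp add: H_simps)
  qed
  then show "additive_subgroup W H" by (rule additive_subgroup.intro)
qed (rule abelian_group_H)

lemma Q_iff: "z \<in> Q x \<longleftrightarrow> z \<approx> x" if "x \<in> carrier H"
proof
  assume "z \<in> Q x"
  then obtain w where "w \<in> W" "z = (\<lambda>\<gamma>. w \<gamma> + x \<gamma>)"
    by (auto simp: a_r_coset_def r_coset_def H_simps)
  then show "z \<approx> x"
    using that W_H by (simp add: cong_W_def H_closed)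
next
  assume "z \<approx> x"
  then show "z \<in> Q x"
    by (auto simp: a_r_coset_def r_coset_def H_simps cong_W_def
        intro!: bexI[of _ "\<lambda>\<gamma>. z \<gamma> - x \<gamma>"])
qed

lemma Q_eq:
  assumes "x \<approx> y"
  shows "Q x = Q y"
proof (rule Set.set_eqI)
  fix z
  have c: "x \<in> carrier H" "y \<in> carrier H"
    using assms by (auto simp: cong_W_def)
  show "z \<in> Q x \<longleftrightarrow> z \<in> Q y"
    unfolding Q_iff[OF c(1)] Q_iff[OF c(2)]
    using cong_trans[OF _ assms] cong_trans[OF _ cong_sym[OF assms]] by iprover
qed

lemma carrier_R: "carrier R = Q ` carrier H"
  by (auto simp: module_quot_def FactRing_def A_RCOSETS_def RCOSETS_def a_r_coset_def)

lemma Q_carrier: "x \<in> carrier H \<Longrightarrow> Q x \<in> carrier R"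
  by (simp add: carrier_R)

text \<open>The coset product is the union of the cosets of all products of members; by
  \<open>cong_mult\<close> these cosets coincide.\<close>

lemma Q_mult:
  assumes x: "x \<in> carrier H" and y: "y \<in> carrier H"
  shows "Q x \<otimes>\<^bsub>R\<^esub> Q y = Q (x \<otimes>\<^bsub>H\<^esub> y)"
proof -
  have "Q x \<otimes>\<^bsub>R\<^esub> Q y = (\<Union>a\<in>Q x. \<Union>b\<in>Q y. Q (a \<otimes>\<^bsub>H\<^esub> b))"
    by (simp add: module_quot_def FactRing_def rcoset_mult_def)
  also have "\<dots> = (\<Union>a\<in>Q x. \<Union>b\<in>Q y. Q (x \<otimes>\<^bsub>H\<^esub> y))"
    by (intro SUP_cong refl Q_eq cong_mult) (simp_all add: Q_iff x y)
  also have "\<dots> = Q (x \<otimes>\<^bsub>H\<^esub> y)"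
    using Q_iff[OF x] Q_iff[OF y] cong_refl[OF x] cong_refl[OF y] by blast
  finally show ?thesis .
qed

lemma Q_add:
  assumes "x \<in> carrier H" "y \<in> carrier H"
  shows "Q x \<oplus>\<^bsub>R\<^esub> Q y = Q (\<lambda>\<gamma>. x \<gamma> + y \<gamma>)"
  using WG.a_rcos_sum[OF assms] by (simp add: module_quot_def FactRing_def H_simps)

lemma Q_smult:
  assumes x: "x \<in> carrier H"
  shows "c \<odot>\<^bsub>R\<^esub> Q x = Q (\<lambda>\<gamma>. c * x \<gamma>)"
proof -
  have "c \<odot>\<^bsub>R\<^esub> Q x = (\<Union>a\<in>Q x. Q (\<lambda>\<gamma>. c * a \<gamma>))"
    by (simp add: module_quot_def H_simps)
  also have "\<dots> = (\<Union>a\<in>Q x. Q (\<lambda>\<gamma>. c * x \<gamma>))"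
    by (intro SUP_cong refl Q_eq cong_scale) (simp add: Q_iff x)
  also have "\<dots> = Q (\<lambda>\<gamma>. c * x \<gamma>)"
    using Q_iff[OF x] cong_refl[OF x] by blast
  finally show ?thesis .
qed

lemma zero_R: "\<zero>\<^bsub>R\<^esub> = Q (\<lambda>\<gamma>. 0)"
proof -
  have "Q \<zero>\<^bsub>H\<^esub> = W"
    using WG.a_rcos_const[of "\<zero>\<^bsub>H\<^esub>"] W_zero by (simp add: H_simps)
  then show ?thesis
    by (simp add: module_quot_def FactRing_def H_simps)
qed

sublocale RG: abelian_group R
proof (rule abelian_groupI)
  fix u assume "u \<in> carrier R"
  then obtain x where x: "x \<in> carrier H" "u = Q x" by (auto simp: carrier_R)
  have x': "(\<lambda>\<gamma>. - x \<gamma>) \<in> carrier H"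
    using H_closed(2)[OF x(1), of "-1"] by simp
  show "\<zero>\<^bsub>R\<^esub> \<oplus>\<^bsub>R\<^esub> u = u"
    using x by (simp add: zero_R Q_add H_closed)
  show "\<exists>v\<in>carrier R. v \<oplus>\<^bsub>R\<^esub> u = \<zero>\<^bsub>R\<^esub>"
    using x x' by (intro bexI[of _ "Q (\<lambda>\<gamma>. - x \<gamma>)"]) (simp_all add: zero_R Q_add Q_carrier)
qed (auto simp: carrier_R Q_add H_closed zero_R algebra_simps)

lemma Q_minus:
  assumes x: "x \<in> carrier H" and y: "y \<in> carrier H"
  shows "Q x \<ominus>\<^bsub>R\<^esub> Q y = Q (\<lambda>\<gamma>. x \<gamma> - y \<gamma>)"
proof -
  have y': "(\<lambda>\<gamma>. - y \<gamma>) \<in> carrier H"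
    using H_closed(2)[OF y, of "-1"] by simp
  have "Q (\<lambda>\<gamma>. - y \<gamma>) \<oplus>\<^bsub>R\<^esub> Q y = \<zero>\<^bsub>R\<^esub>"
    using y y' by (simp add: Q_add zero_R)
  then have "\<ominus>\<^bsub>R\<^esub> Q y = Q (\<lambda>\<gamma>. - y \<gamma>)"
    using y y' by (intro RG.minus_equality Q_carrier)
  then show ?thesis
    using x y' by (simp add: a_minus_def Q_add)
qed

end

section \<open>The Serre relations for a pair of projectives\<close>

text \<open>Spares the surjectivity of explicit isomorphisms: between finite modules of equal size
  injectivity is enough.\<close>

lemma bij_betw_card_eqI:
  assumes "inj_on f S" "f ` S \<subseteq> T" "finite T" "card S = card T"
  shows "bij_betw f S T"
  using assms by (metis bij_betw_imageI card_image card_subset_eq)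

text \<open>The typical sum over a Hom set: the zero map gives one class, and all other maps give a
  second one.\<close>

lemma sum_const_except:
  fixes F :: "'i \<Rightarrow> 'j \<Rightarrow> complex"
  assumes "finite S" "z \<in> S" "F z = a" "\<And>i. i \<in> S \<Longrightarrow> i \<noteq> z \<Longrightarrow> F i = b"
  shows "(\<Sum>i\<in>S. F i \<gamma>) = a \<gamma> + (of_nat (card S) - 1) * b \<gamma>"
proof -
  have "(\<Sum>i\<in>S. F i \<gamma>) = F z \<gamma> + (\<Sum>i\<in>S - {z}. F i \<gamma>)"
    using assms(1,2) by (rule sum.remove)
  also have "(\<Sum>i\<in>S - {z}. F i \<gamma>) = (\<Sum>i\<in>S - {z}. b \<gamma>)"
    using assms(4) by (intro sum.cong) auto
  also have "\<dots> = (of_nat (card S) - 1) * b \<gamma>"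
  proof -
    have "card S \<ge> 1"
      using assms(1,2) by (metis One_nat_def Suc_leI card_gt_0_iff empty_iff)
    then show ?thesis
      using assms(2) by (simp add: card_Diff_singleton of_nat_diff)
  qed
  finally show ?thesis using assms(3) by simp
qed

lemma homs_direct_sum_split:
  assumes "left_module A M" "left_module A M'" "h \<in> mhom A (direct_sum M M') N"
    "x \<in> carrier M" "y \<in> carrier M'"
  shows "h (x, y) = h (x, \<zero>\<^bsub>M'\<^esub>) \<oplus>\<^bsub>N\<^esub> h (\<zero>\<^bsub>M\<^esub>, y)"
proof -
  interpret M: left_module A M by fact
  interpret M': left_module A M' by fact
  show ?thesis
    using mhom_add[OF assms(3), of "(x, \<zero>\<^bsub>M'\<^esub>)" "(\<zero>\<^bsub>M\<^esub>, y)"] assms by simp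
qed

section \<open>Hom counts for direct sums, and complexes given by one map of projectives\<close>

context finite_algebra
begin

lemma inj1_mhom:
  assumes "left_module A N"
  shows "(\<lambda>x. (x, \<zero>\<^bsub>N\<^esub>)) \<in> mhom A M (direct_sum M N)"
proof -
  interpret left_module A N by fact
  show ?thesis by (intro mhomI) (auto simp: smult_zero_right)
qed

lemma inj2_mhom:
  assumes "left_module A M"
  shows "(\<lambda>y. (\<zero>\<^bsub>M\<^esub>, y)) \<in> mhom A N (direct_sum M N)"
proof -
  interpret left_module A M by fact
  show ?thesis by (intro mhomI) (auto simp: smult_zero_right)
qed

lemma card_homs_direct_sum_left:
  assumes M: "left_module A M" and M': "left_module A M'" and N: "left_module A N"
  shows "card (homs A (direct_sum M M') N) = card (homs A M N) * card (homs A M' N)"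
proof -
  interpret M: left_module A M by fact
  interpret M': left_module A M' by fact
  interpret N: left_module A N by fact
  let ?D = "direct_sum M M'"
  note D = left_module_direct_sum[OF M M']
  let ?F = "\<lambda>h. (\<lambda>x\<in>carrier M. h (x, \<zero>\<^bsub>M'\<^esub>), \<lambda>y\<in>carrier M'. h (\<zero>\<^bsub>M\<^esub>, y))"
  have "bij_betw ?F (homs A ?D N) (homs A M N \<times> homs A M' N)"
  proof (rule bij_betw_imageI)
    show "inj_on ?F (homs A ?D N)"
    proof (rule inj_onI)
      fix h h' assume h: "h \<in> homs A ?D N" "h' \<in> homs A ?D N" and eq: "?F h = ?F h'"
      show "h = h'"
      proof (rule homs_eqI[OF h])
        fix z assume "z \<in> carrier ?D"
        then obtain x y where z: "z = (x, y)" "x \<in> carrier M" "y \<in> carrier M'" by auto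
        have "h (x, \<zero>\<^bsub>M'\<^esub>) = h' (x, \<zero>\<^bsub>M'\<^esub>)"
          using fun_cong[OF arg_cong[OF eq, of fst], of x] z by simp
        moreover have "h (\<zero>\<^bsub>M\<^esub>, y) = h' (\<zero>\<^bsub>M\<^esub>, y)"
          using fun_cong[OF arg_cong[OF eq, of snd], of y] z by simp
        ultimately show "h z = h' z"
          using z homs_direct_sum_split[OF M M' homs_mhom[OF h(1)]]
            homs_direct_sum_split[OF M M' homs_mhom[OF h(2)]] by metis
      qed
    qed
    show "?F ` homs A ?D N = homs A M N \<times> homs A M' N"
    proof (intro equalityI subsetI)
      fix u assume "u \<in> ?F ` homs A ?D N"
      then show "u \<in> homs A M N \<times> homs A M' N"
        using mhom_compose[OF inj1_mhom[OF M'] homs_mhom] mhom_compose[OF inj2_mhom[OF M] homs_mhom]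
        by (auto intro!: homs_restrict M M')
    next
      fix u assume "u \<in> homs A M N \<times> homs A M' N"
      then obtain g g' where u: "u = (g, g')" "g \<in> homs A M N" "g' \<in> homs A M' N" by auto
      note gm = homs_mhom[OF u(2)] homs_mhom[OF u(3)]
      let ?h = "\<lambda>z\<in>carrier ?D. g (fst z) \<oplus>\<^bsub>N\<^esub> g' (snd z)"
      have "(\<lambda>z. g (fst z) \<oplus>\<^bsub>N\<^esub> g' (snd z)) \<in> mhom A ?D N"
        by (intro mhom_add_map D N mhom_compose[OF _ gm(1)] mhom_compose[OF _ gm(2)])
          (auto intro!: mhomI)
      then have hh: "?h \<in> homs A ?D N"
        by (intro homs_restrict D)
      have Fh: "?F ?h = u"
        using u gm mhom_zero[OF M N gm(1)] mhom_zero[OF M' N gm(2)]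
        by (auto simp: mhom_closed homs_def intro!: extensionalityI[of _ "carrier M"] extensionalityI[of _ "carrier M'"])
      show "u \<in> ?F ` homs A ?D N" by (rule image_eqI[where f = ?F and x = ?h, OF Fh[symmetric] hh])
    qed
  qed
  then show ?thesis
    by (simp add: bij_betw_same_card card_cartesian_product)
qed

lemma card_homs_direct_sum_right:
  assumes M: "left_module A M" and M': "left_module A M'" and N: "left_module A N"
  shows "card (homs A N (direct_sum M M')) = card (homs A N M) * card (homs A N M')"
proof -
  let ?D = "direct_sum M M'"
  let ?F = "\<lambda>h. (\<lambda>x\<in>carrier N. fst (h x), \<lambda>x\<in>carrier N. snd (h x))"
  have f: "fst \<in> mhom A ?D M" and s: "snd \<in> mhom A ?D M'"
    by (auto intro!: mhomI)
  have "bij_betw ?F (homs A N ?D) (homs A N M \<times> homs A N M')"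
  proof (rule bij_betw_imageI)
    show "inj_on ?F (homs A N ?D)"
    proof (rule inj_onI)
      fix h h' assume h: "h \<in> homs A N ?D" "h' \<in> homs A N ?D" and eq: "?F h = ?F h'"
      show "h = h'"
      proof (rule homs_eqI[OF h])
        fix x assume "x \<in> carrier N"
        then show "h x = h' x"
          using fun_cong[OF arg_cong[OF eq, of fst], of x] fun_cong[OF arg_cong[OF eq, of snd], of x]
          by (simp add: prod_eq_iff)
      qed
    qed
    show "?F ` homs A N ?D = homs A N M \<times> homs A N M'"
    proof (intro equalityI subsetI)
      fix u assume "u \<in> ?F ` homs A N ?D"
      then show "u \<in> homs A N M \<times> homs A N M'"
        using mhom_compose[OF homs_mhom f] mhom_compose[OF homs_mhom s]
        by (auto intro!: homs_restrict N)
    next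
      fix u assume "u \<in> homs A N M \<times> homs A N M'"
      then obtain g g' where u: "u = (g, g')" "g \<in> homs A N M" "g' \<in> homs A N M'" by auto
      note gm = homs_mhom[OF u(2)] homs_mhom[OF u(3)]
      let ?h = "\<lambda>x\<in>carrier N. (g x, g' x)"
      have "(\<lambda>x. (g x, g' x)) \<in> mhom A N ?D"
        using gm by (intro mhomI) (auto simp: mhom_closed mhom_add mhom_smult)
      then have hh: "?h \<in> homs A N ?D"
        by (intro homs_restrict N)
      have Fh: "?F ?h = u"
        using u by (auto simp: homs_def intro!: extensionalityI[of _ "carrier N"])
      show "u \<in> ?F ` homs A N ?D" by (rule image_eqI[where f = ?F and x = ?h, OF Fh[symmetric] hh])
    qed
  qed
  then show ?thesis
    by (simp add: bij_betw_same_card card_cartesian_product)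
qed

lemma C1_object_C: "projective K A P \<Longrightarrow> C1_object K A (C_complex P)"
  using projectiveD(1)[of P] mhom_zero_map[of A P P] by (simp add: C1_object_def C_complex_def)

lemma C_complex_simps [simp]: "fst (C_complex P) = P" "snd (C_complex P) x = \<zero>\<^bsub>P\<^esub>"
  by (simp_all add: C_complex_def)

lemma K_complex_simps [simp]:
  "fst (K_complex P) = direct_sum P P" "snd (K_complex P) (x, y) = (y, \<zero>\<^bsub>P\<^esub>)"
  by (simp_all add: K_complex_def)

lemma C1_object_K:
  assumes "projective K A P"
  shows "C1_object K A (K_complex P)"
proof -
  interpret left_module A P using projectiveD(1)[OF assms] .
  have "snd (K_complex P) \<in> mhom A (direct_sum P P) (direct_sum P P)"
    by (intro mhomI) (auto simp: smult_zero_right)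
  then show ?thesis
    using projective_direct_sum[OF assms assms] by (auto simp: C1_object_def)
qed

lemma ext_maps_C:
  assumes "left_module A M" "left_module A N"
  shows "ext_maps A (C_complex M) (C_complex N) = homs A M N"
proof -
  interpret N: left_module A N by fact
  have "\<forall>x\<in>carrier M. snd (C_complex N) (h x) \<oplus>\<^bsub>N\<^esub> h (snd (C_complex M) x) = \<zero>\<^bsub>N\<^esub>"
    if "h \<in> homs A M N" for h
    by (simp add: mhom_zero[OF assms homs_mhom[OF that]])
  then show ?thesis
    by (auto simp: ext_maps_def)
qed

abbreviation zero_hom :: "('a, 'm) module \<Rightarrow> ('a, 'n) module \<Rightarrow> 'm \<Rightarrow> 'n" where
  "zero_hom M N \<equiv> (\<lambda>x\<in>carrier M. \<zero>\<^bsub>N\<^esub>)"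

lemma zero_hom_homs: "left_module A M \<Longrightarrow> left_module A N \<Longrightarrow> zero_hom M N \<in> homs A M N"
  by (intro homs_restrict mhom_zero_map)

lemma zero_ext_map:
  assumes "C1_object K A X" "C1_object K A Y"
  shows "zero_hom (fst X) (fst Y) \<in> ext_maps A X Y"
proof -
  note oX = C1_objectD[OF assms(1)] and oY = C1_objectD[OF assms(2)]
  interpret Y: left_module A "fst Y" by (rule oY)
  show ?thesis
    using oX oY zero_hom_homs[OF oX(2) oY(2)] mhom_zero[OF oY(2) oY(2) oY(4)]
    by (simp add: ext_maps_def)
qed

lemma homs_nonzero:
  assumes "h \<in> homs A M N" "left_module A M" "left_module A N" "h \<noteq> zero_hom M N"
  obtains x where "x \<in> carrier M" "h x \<noteq> \<zero>\<^bsub>N\<^esub>"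
  using homs_eqI[OF assms(1) zero_hom_homs[OF assms(2,3)]] assms(4) by auto

lemma homs_trivial:
  assumes "card (homs A M N) = 1" "left_module A M" "left_module A N"
  shows "homs A M N = {zero_hom M N}"
  using assms zero_hom_homs[OF assms(2,3)] by (metis card_1_singletonE singletonD)

text \<open>The complex on N + M, in this order, with differential h on M and zero on N. The
  complexes a and b of the overview have this form.\<close>

abbreviation arrow :: "('a, 'm) module \<Rightarrow> ('a, 'n) module \<Rightarrow> ('m \<Rightarrow> 'n) \<Rightarrow> ('a, 'n \<times> 'm) cyclic_complex" where
  "arrow M N h \<equiv> ext_complex (C_complex M) (C_complex N) h"

lemma C1_object_arrow:
  assumes "projective K A M" "projective K A N" "h \<in> homs A M N"
  shows "C1_object K A (arrow M N h)"
  using assms projectiveD(1)[OF assms(1)] projectiveD(1)[OF assms(2)]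
  by (intro C1_object_ext_complex C1_object_C) (simp_all add: ext_maps_C)

lemma cpx_isoI:
  assumes X: "C1_object K A X" and Y: "C1_object K A Y" and f: "f \<in> mhom A (fst X) (fst Y)"
    "bij_betw f (carrier (fst X)) (carrier (fst Y))"
    and d: "\<And>x. x \<in> carrier (fst X) \<Longrightarrow> f (snd X x) = snd Y (f x)"
  shows "cpx_iso X Y"
  using C1_isoI[OF C1_objectD(2,4)[OF X] f(1) d f(2)] X Y by (auto simp: cpx_iso_def)

text \<open>A commuting square with invertible sides is an isomorphism of complexes. It serves to
  bring differentials to normal form.\<close>

lemma arrow_iso:
  assumes M: "projective K A M" and N: "projective K A N" and M': "projective K A M'" and N': "projective K A N'"
    and h: "h \<in> homs A M N" and h': "h' \<in> homs A M' N'"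
    and \<tau>: "\<tau> \<in> mhom A M M'" "bij_betw \<tau> (carrier M) (carrier M')"
    and \<sigma>: "\<sigma> \<in> mhom A N N'" "bij_betw \<sigma> (carrier N) (carrier N')"
    and eq: "\<And>x. x \<in> carrier M \<Longrightarrow> \<sigma> (h x) = h' (\<tau> x)"
  shows "cpx_iso (arrow M N h) (arrow M' N' h')"
proof (rule cpx_isoI)
  note l = projectiveD(1)[OF M] projectiveD(1)[OF N] projectiveD(1)[OF M'] projectiveD(1)[OF N']
  interpret N: left_module A N by (rule l)
  interpret N': left_module A N' by (rule l)
  show "C1_object K A (arrow M N h)" "C1_object K A (arrow M' N' h')"
    by (fact C1_object_arrow[OF M N h] C1_object_arrow[OF M' N' h'])+
  show "map_prod \<sigma> \<tau> \<in> mhom A (fst (arrow M N h)) (fst (arrow M' N' h'))"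
    using \<tau>(1) \<sigma>(1) by (intro mhomI) (auto simp: mhom_closed mhom_add mhom_smult)
  show "bij_betw (map_prod \<sigma> \<tau>) (carrier (fst (arrow M N h))) (carrier (fst (arrow M' N' h')))"
    using \<tau>(2) \<sigma>(2) by (auto simp: bij_betw_def map_prod_inj_on map_prod_surj_on)
  fix z assume "z \<in> carrier (fst (arrow M N h))"
  then obtain y x where z: "z = (y, x)" "y \<in> carrier N" "x \<in> carrier M" by auto
  then show "map_prod \<sigma> \<tau> (snd (arrow M N h) z) = snd (arrow M' N' h') (map_prod \<sigma> \<tau> z)"
    using mhom_closed[OF homs_mhom[OF h]] mhom_closed[OF homs_mhom[OF h']] mhom_closed[OF \<tau>(1)]
      mhom_zero[OF l(1,3) \<tau>(1)] by (simp add: eq)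
qed

lemma arrow_zero_iso:
  assumes M: "projective K A M" and N: "projective K A N" and L: "projective K A L"
    and \<theta>: "\<theta> \<in> mhom A (direct_sum N M) L" "bij_betw \<theta> (carrier (direct_sum N M)) (carrier L)"
  shows "cpx_iso (arrow M N (zero_hom M N)) (C_complex L)"
proof (rule cpx_isoI)
  note l = projectiveD(1)[OF M] projectiveD(1)[OF N] projectiveD(1)[OF L]
  interpret N: left_module A N by (rule l)
  show "C1_object K A (arrow M N (zero_hom M N))"
    by (intro C1_object_arrow M N zero_hom_homs l)
  show "C1_object K A (C_complex L)" by (rule C1_object_C[OF L])
  show "\<theta> \<in> mhom A (fst (arrow M N (zero_hom M N))) (fst (C_complex L))"
    "bij_betw \<theta> (carrier (fst (arrow M N (zero_hom M N)))) (carrier (fst (C_complex L)))"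
    using \<theta> by simp_all
  fix z assume "z \<in> carrier (fst (arrow M N (zero_hom M N)))"
  then show "\<theta> (snd (arrow M N (zero_hom M N)) z) = snd (C_complex L) (\<theta> z)"
    using mhom_zero[OF left_module_direct_sum[OF l(2,1)] l(3) \<theta>(1)] by auto
qed

text \<open>With zero differential only the underlying module matters, and the swap of the summands
  is an isomorphism. This makes products taken in opposite orders comparable.\<close>

lemma ebas_arrow_zero:
  assumes M: "projective K A M" and N: "projective K A N"
  shows "ebas (arrow M N (zero_hom M N)) = ebas (C_complex (direct_sum N M))"
    "ebas (arrow M N (zero_hom M N)) = ebas (C_complex (direct_sum M N))"
    "ebas (arrow M N (zero_hom M N)) = ebas (arrow N M (zero_hom N M))"
proof -
  have 1: "ebas (arrow M N (zero_hom M N)) = ebas (C_complex (direct_sum N M))"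
    if "projective K A M" "projective K A N" for M :: "('a, 'm) module" and N :: "('a, 'n) module"
    using that by (intro ebas_iso arrow_zero_iso[of _ _ _ "\<lambda>x. x"] projective_direct_sum mhom_id)
      (auto simp: bij_betw_def)
  have 2: "ebas (arrow M N (zero_hom M N)) = ebas (C_complex (direct_sum M N))"
    using M N
    by (intro ebas_iso arrow_zero_iso[of _ _ _ "\<lambda>(x, y). (y, x)"] projective_direct_sum)
      (auto simp: bij_betw_def inj_on_def intro!: mhomI)
  show "ebas (arrow M N (zero_hom M N)) = ebas (C_complex (direct_sum N M))"
    "ebas (arrow M N (zero_hom M N)) = ebas (C_complex (direct_sum M N))"
    "ebas (arrow M N (zero_hom M N)) = ebas (arrow N M (zero_hom N M))"
    using 1[OF M N] 1[OF N M] 2 by simp_all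
qed

lemma ebas_mult_C:
  assumes M: "projective K A M" and N: "projective K A N"
  shows "ebas (C_complex M) \<otimes>\<^bsub>H\<^esub> ebas (C_complex N) =
    (\<lambda>\<gamma>. complex_of_real (1 / (sqrt (real (card (homs A N M))) * real (card (homs A M N)))) *
      (\<Sum>h\<in>homs A M N. ebas (arrow M N h) \<gamma>))"
  using ebas_mult[OF C1_object_C[OF M] C1_object_C[OF N]] 
    ext_maps_C[OF projectiveD(1)[OF M] projectiveD(1)[OF N]]
  by (simp add: hall_factor_def)

lemma ebas_mult_C_trivial:
  assumes M: "projective K A M" and N: "projective K A N" and triv: "card (homs A M N) = 1"
  shows "ebas (C_complex M) \<otimes>\<^bsub>H\<^esub> ebas (C_complex N) =
    (\<lambda>\<gamma>. complex_of_real (1 / sqrt (real (card (homs A N M)))) * ebas (arrow M N (zero_hom M N)) \<gamma>)"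
  using ebas_mult_C[OF M N] homs_trivial[OF triv projectiveD(1)[OF M] projectiveD(1)[OF N]] triv
  by simp

text \<open>The case without a path: the zero map is the only extension map, all factors are 1, and
  the direct sum does not depend on the order.\<close>

lemma ebas_commute:
  assumes M: "projective K A M" and N: "projective K A N"
    and "card (homs A M N) = 1" "card (homs A N M) = 1"
  shows "ebas (C_complex M) \<otimes>\<^bsub>H\<^esub> ebas (C_complex N) = ebas (C_complex N) \<otimes>\<^bsub>H\<^esub> ebas (C_complex M)"
  using assms by (simp add: ebas_mult_C_trivial ebas_arrow_zero(3)[OF M N])

section \<open>Scalars and one-dimensional Hom spaces\<close>

lemma scal_zero: "left_module A M \<Longrightarrow> c \<in> carrier K \<Longrightarrow> scal M c \<zero>\<^bsub>M\<^esub> = \<zero>\<^bsub>M\<^esub>"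
  by (simp add: scal_def left_module.smult_zero_right scalar_closed)

lemma scal_inverse:
  assumes "left_module A M" "c \<in> carrier K" "c \<noteq> \<zero>\<^bsub>K\<^esub>" "x \<in> carrier M"
  shows "scal M (inv\<^bsub>K\<^esub> c) (scal M c x) = x" "scal M c (scal M (inv\<^bsub>K\<^esub> c) x) = x"
    "inv\<^bsub>K\<^esub> c \<in> carrier K"
proof -
  have c: "c \<in> Units K" using assms by (simp add: K.field_Units)
  then have i: "inv\<^bsub>K\<^esub> c \<in> carrier K" by simp
  show "inv\<^bsub>K\<^esub> c \<in> carrier K" by fact
  show "scal M (inv\<^bsub>K\<^esub> c) (scal M c x) = x" "scal M c (scal M (inv\<^bsub>K\<^esub> c) x) = x"
    using assms c i by (simp_all add: scal_one flip: scal_scal)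
qed

lemma scal_cancel:
  assumes "left_module A M" "c \<in> carrier K" "c \<noteq> \<zero>\<^bsub>K\<^esub>" "x \<in> carrier M" "y \<in> carrier M"
    "scal M c x = scal M c y"
  shows "x = y"
  using scal_inverse(1)[OF assms(1-3)] assms(4-6) by metis

lemma scal_inj:
  assumes M: "left_module A M" and c: "c \<in> carrier K" "d \<in> carrier K"
    and x: "x \<in> carrier M" "x \<noteq> \<zero>\<^bsub>M\<^esub>" and eq: "scal M c x = scal M d x"
  shows "c = d"
proof (rule ccontr)
  interpret M: left_module A M by fact
  assume "c \<noteq> d"
  then have nz: "c \<ominus>\<^bsub>K\<^esub> d \<noteq> \<zero>\<^bsub>K\<^esub>"
    using c K.minus_add_cancel[of c d] by auto
  have "scal M (c \<ominus>\<^bsub>K\<^esub> d) x \<oplus>\<^bsub>M\<^esub> scal M d x = scal M ((c \<ominus>\<^bsub>K\<^esub> d) \<oplus>\<^bsub>K\<^esub> d) x"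
    using M c x by (simp add: scal_left_add)
  also have "(c \<ominus>\<^bsub>K\<^esub> d) \<oplus>\<^bsub>K\<^esub> d = c"
    using c by (rule K.minus_add_cancel)
  finally have "scal M (c \<ominus>\<^bsub>K\<^esub> d) x \<oplus>\<^bsub>M\<^esub> scal M d x = scal M d x"
    using eq by simp
  then have "scal M (c \<ominus>\<^bsub>K\<^esub> d) x = \<zero>\<^bsub>M\<^esub>"
    using M c x scal_closed[of M "c \<ominus>\<^bsub>K\<^esub> d" x] scal_closed[of M d x]
    by (simp add: M.add.r_cancel_one)
  also have "\<dots> = scal M (c \<ominus>\<^bsub>K\<^esub> d) \<zero>\<^bsub>M\<^esub>"
    using M c by (simp add: scal_zero)
  finally show False
    using scal_cancel[OF M _ nz, of x "\<zero>\<^bsub>M\<^esub>"] c x by simp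
qed

text \<open>A Hom space with q elements is a line: the map sending c to c f is injective since f is
  nonzero at x0, and both sides have q elements.\<close>

lemma homs_scal:
  assumes M: "left_module A M" and N: "left_module A N"
    and fin: "finite (carrier M)" "finite (carrier N)"
    and f: "f \<in> homs A M N" "x0 \<in> carrier M" "f x0 \<noteq> \<zero>\<^bsub>N\<^esub>"
    and card: "card (homs A M N) = card (carrier K)"
    and h: "h \<in> homs A M N"
  obtains c where "c \<in> carrier K" "\<And>x. x \<in> carrier M \<Longrightarrow> h x = scal N c (f x)"
proof -
  let ?F = "\<lambda>c. \<lambda>x\<in>carrier M. scal N c (f x)"
  have into: "?F ` carrier K \<subseteq> homs A M N"
    using homs_restrict[OF M mhom_compose[OF homs_mhom[OF f(1)] scal_mhom[OF N]]] by blast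
  have "inj_on ?F (carrier K)"
  proof (rule inj_onI)
    fix c d assume c: "c \<in> carrier K" "d \<in> carrier K" and eq: "?F c = ?F d"
    have "scal N c (f x0) = scal N d (f x0)"
      using fun_cong[OF eq, of x0] f(2) by simp
    then show "c = d"
      using scal_inj[OF N c _ f(3)] mhom_closed[OF homs_mhom[OF f(1)] f(2)] by blast
  qed
  then have "?F ` carrier K = homs A M N"
    using into card fin by (metis card_image card_subset_eq finite_homs)
  then obtain c where "c \<in> carrier K" "h = ?F c"
    using h by blast
  then show ?thesis using that by auto
qed

text \<open>The identity takes the role of f; it is nonzero at x0. Consequently a nonzero
  endomorphism is multiplication by a nonzero scalar, which is invertible.\<close>

lemma endo_scal:
  assumes M: "left_module A M" "finite (carrier M)" and x0: "x0 \<in> carrier M" "x0 \<noteq> \<zero>\<^bsub>M\<^esub>"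
    and card: "card (homs A M M) = card (carrier K)" and h: "h \<in> homs A M M"
  obtains c where "c \<in> carrier K" "\<And>x. x \<in> carrier M \<Longrightarrow> h x = scal M c x"
proof -
  have id: "(\<lambda>x\<in>carrier M. x) \<in> homs A M M"
    by (rule homs_restrict[OF M(1) mhom_id])
  show ?thesis
    using homs_scal[OF M(1) M(1) M(2) M(2) id x0(1) _ card h] x0 that by auto
qed

end

section \<open>Contractible summands lie in the ideal\<close>

context hall_quotient
begin

lemma W_scaleD: "(\<lambda>\<gamma>. c * z \<gamma>) \<in> W \<Longrightarrow> c \<noteq> 0 \<Longrightarrow> z \<in> W"
  using W_scale[of "\<lambda>\<gamma>. c * z \<gamma>" "inverse c"] by (simp flip: mult.assoc)

text \<open>Every extension of \<open>K\<^sub>P\<close> by \<open>C\<^sub>M\<close> is isomorphic to the complex \<open>Z\<close>, so \<open>ebas Z\<close> is a non-zero multiple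
  of a product with a factor in the ideal.\<close>

lemma contractible_summand:
  assumes Z: "C1_object K A Z" and M: "projective K A M" and P: "projective K A P"
    and KP: "basis_vector K A (K_complex P) \<in> W"
    and \<theta>: "\<theta> \<in> mhom A (direct_sum M (direct_sum P P)) (fst Z)"
      "bij_betw \<theta> (carrier (direct_sum M (direct_sum P P))) (carrier (fst Z))"
    and d: "\<And>m a b. m \<in> carrier M \<Longrightarrow> a \<in> carrier P \<Longrightarrow> b \<in> carrier P \<Longrightarrow>
      snd Z (\<theta> (m, (a, b))) = \<theta> (\<zero>\<^bsub>M\<^esub>, (b, \<zero>\<^bsub>P\<^esub>))"
  shows "ebas Z \<in> W"
proof -
  note lM = projectiveD[OF M] and lP = projectiveD[OF P]
  interpret M: left_module A M by (rule lM)
  interpret P: left_module A P by (rule lP)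
  let ?K = "K_complex P" and ?C = "C_complex M" and ?PP = "direct_sum P P"
  note oK = C1_object_K[OF P] and oC = C1_object_C[OF M]
  have lPP: "left_module A ?PP" by (rule left_module_direct_sum[OF lP(1) lP(1)])
  have iso: "cpx_iso (ext_complex ?K ?C h) Z" if h: "h \<in> ext_maps A ?K ?C" for h
  proof -
    have hm: "h \<in> mhom A ?PP M"
      using homs_mhom[OF ext_maps_homs[OF h]] by simp
    have hc: "h (a, b) \<in> carrier M" if "a \<in> carrier P" "b \<in> carrier P" for a b
      using mhom_closed[OF hm] that by simp
    \<comment> \<open>As C_M has zero differential, the extension condition says that h vanishes on
      the image of the differential of K_P, which is the first copy of P.\<close>
    have h0: "h (a, \<zero>\<^bsub>P\<^esub>) = \<zero>\<^bsub>M\<^esub>" if "a \<in> carrier P" for a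
    proof -
      have "\<zero>\<^bsub>M\<^esub> \<oplus>\<^bsub>M\<^esub> h (snd ?K (\<zero>\<^bsub>P\<^esub>, a)) = \<zero>\<^bsub>M\<^esub>"
        using h that by (auto simp: ext_maps_def)
      then show ?thesis using hc[OF that P.M.zero_closed] by simp
    qed
    have hs: "h (a, b) = h (\<zero>\<^bsub>P\<^esub>, b)" if "a \<in> carrier P" "b \<in> carrier P" for a b
      using homs_direct_sum_split[OF lP(1) lP(1) hm that] h0[OF that(1)] hc that by simp
    \<comment> \<open>A shear that absorbs h: the differential of the extension sends (m, a, b) to
      (h(0, b), b, 0), and subtracting h(0, a) from the first entry conjugates it to the
      differential of the direct sum of C_M and K_P.\<close>
    let ?f = "\<lambda>(m, a, b). (m \<oplus>\<^bsub>M\<^esub> (\<ominus>\<^bsub>M\<^esub> h (\<zero>\<^bsub>P\<^esub>, a)), a, b)"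
    have f: "?f \<in> mhom A (direct_sum M ?PP) (direct_sum M ?PP)"
    proof (rule mhomI)
      have "h (\<zero>\<^bsub>P\<^esub>, a \<oplus>\<^bsub>P\<^esub> a') = h (\<zero>\<^bsub>P\<^esub>, a) \<oplus>\<^bsub>M\<^esub> h (\<zero>\<^bsub>P\<^esub>, a')"
        if "a \<in> carrier P" "a' \<in> carrier P" for a a'
        using mhom_add[OF hm, of "(\<zero>\<^bsub>P\<^esub>, a)" "(\<zero>\<^bsub>P\<^esub>, a')"] that by simp
      then show "?f (x \<oplus>\<^bsub>direct_sum M ?PP\<^esub> y) = ?f x \<oplus>\<^bsub>direct_sum M ?PP\<^esub> ?f y"
        if "x \<in> carrier (direct_sum M ?PP)" "y \<in> carrier (direct_sum M ?PP)" for x y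
        using that hc by (auto simp: M.M.minus_add M.M.a_ac)
      have "h (\<zero>\<^bsub>P\<^esub>, r \<odot>\<^bsub>P\<^esub> a) = r \<odot>\<^bsub>M\<^esub> h (\<zero>\<^bsub>P\<^esub>, a)" if "r \<in> carrier A" "a \<in> carrier P" for r a
        using mhom_smult[OF hm, of r "(\<zero>\<^bsub>P\<^esub>, a)"] that by (simp add: P.smult_zero_right)
      then show "?f (r \<odot>\<^bsub>direct_sum M ?PP\<^esub> x) = r \<odot>\<^bsub>direct_sum M ?PP\<^esub> ?f x"
        if "r \<in> carrier A" "x \<in> carrier (direct_sum M ?PP)" for r x
        using that hc by (auto simp: M.smult_r_distr M.smult_minus_right)
    qed (use hc in auto)
    have "inj_on ?f (carrier (direct_sum M ?PP))"
      using hc by (auto simp: inj_on_def)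
    then have bf: "bij_betw ?f (carrier (direct_sum M ?PP)) (carrier (direct_sum M ?PP))"
      using lM lP mhom_closed[OF f] by (intro bij_betw_card_eqI) auto
    show ?thesis
    proof (rule cpx_isoI[OF C1_object_ext_complex[OF oK oC h] Z])
      show "(\<lambda>x. \<theta> (?f x)) \<in> mhom A (fst (ext_complex ?K ?C h)) (fst Z)"
        using mhom_compose[OF f \<theta>(1)] by simp
      show "bij_betw (\<lambda>x. \<theta> (?f x)) (carrier (fst (ext_complex ?K ?C h))) (carrier (fst Z))"
        using bij_betw_trans[OF bf \<theta>(2)] by (simp add: comp_def)
      fix x assume "x \<in> carrier (fst (ext_complex ?K ?C h))"
      then obtain m a b where x: "x = (m, a, b)" "m \<in> carrier M" "a \<in> carrier P" "b \<in> carrier P"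
        by auto
      have "?f (snd (ext_complex ?K ?C h) x) = (\<zero>\<^bsub>M\<^esub>, b, \<zero>\<^bsub>P\<^esub>)"
        using x hc hs[OF x(3,4)] by (simp add: M.M.r_neg)
      moreover have "snd Z (\<theta> (?f x)) = \<theta> (\<zero>\<^bsub>M\<^esub>, b, \<zero>\<^bsub>P\<^esub>)"
        using x hc d by simp
      ultimately show "\<theta> (?f (snd (ext_complex ?K ?C h) x)) = snd Z (\<theta> (?f x))"
        by simp
    qed
  qed
  let ?c = "complex_of_real (hall_factor ?K ?C) * of_nat (card (ext_maps A ?K ?C))"
  have "ebas ?K \<otimes>\<^bsub>H\<^esub> ebas ?C = (\<lambda>\<gamma>. ?c * ebas Z \<gamma>)"
    unfolding ebas_mult[OF oK oC] using ebas_iso[OF iso] by (simp add: mult.assoc cong: sum.cong)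
  moreover have "ebas ?K \<otimes>\<^bsub>H\<^esub> ebas ?C \<in> W"
    using W_mult(1)[OF W_scale[OF KP] ebas_H[OF oC]] by (simp add: ebas_def)
  moreover have "?c \<noteq> 0"
  proof -
    have "card (homs A ?PP M) > 0" "card (homs A M ?PP) > 0"
      using card_homs_pos[OF lPP lM(1)] card_homs_pos[OF lM(1) lPP] lM lP by auto
    moreover have "card (ext_maps A ?K ?C) > 0"
      using zero_ext_map[OF oK oC] finite_ext_maps[OF oK oC] by (metis card_gt_0_iff empty_iff)
    ultimately show ?thesis by (simp add: hall_factor_def)
  qed
  ultimately show ?thesis
    using W_scaleD[of ?c "ebas Z"] by simp
qed

end

lemma mhom_inj_bij:
  assumes "f \<in> mhom A M N" "inj_on f (carrier M)" "finite (carrier N)" "card (carrier M) = card (carrier N)"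
  shows "bij_betw f (carrier M) (carrier N)"
  using assms by (intro bij_betw_card_eqI) (auto simp: mhom_closed)

section \<open>Powers of v, the square of a generator, and the cancellation\<close>

context finite_algebra
begin

lemma scal_zero_left:
  assumes "left_module A M" "x \<in> carrier M"
  shows "scal M \<zero>\<^bsub>K\<^esub> x = \<zero>\<^bsub>M\<^esub>"
proof -
  interpret left_module A M by fact
  have "scal M \<zero>\<^bsub>K\<^esub> x \<oplus>\<^bsub>M\<^esub> scal M \<zero>\<^bsub>K\<^esub> x = scal M \<zero>\<^bsub>K\<^esub> x"
    using scal_left_add[OF assms(1), of "\<zero>\<^bsub>K\<^esub>" "\<zero>\<^bsub>K\<^esub>" x] assms by simp
  then show ?thesis
    using scal_closed[OF assms(1) _ assms(2), of "\<zero>\<^bsub>K\<^esub>"] by simp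
qed

definition s :: complex where "s = complex_of_real (twisting_parameter K)"

lemma card_K_gt_1: "card (carrier K) > 1"
proof -
  have "card {\<zero>\<^bsub>K\<^esub>, \<one>\<^bsub>K\<^esub>} \<le> card (carrier K)"
    using finite_K by (intro card_mono) auto
  then show ?thesis by simp
qed

lemma s_nonzero: "s \<noteq> 0"
  using card_K_gt_1 by (simp add: s_def twisting_parameter_def)

lemma s_square: "s * s = of_nat (card (carrier K))"
  by (simp add: s_def twisting_parameter_def flip: of_real_mult)

lemma s_power_3: "s ^ 3 = s * of_nat (card (carrier K))"
  by (simp add: power3_eq_cube mult.assoc s_square)

lemma inverse_s_mult:
  "inverse (s ^ 3) * (inverse (s ^ 2) * u) = inverse (s ^ 5) * u"
  "inverse (s ^ 3) * (inverse (s ^ 4) * u) = inverse (s ^ 7) * u"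
  "inverse s * (inverse (s ^ 5) * u) = inverse (s ^ 6) * u"
  by (simp_all add: eval_nat_numeral)

lemma s_power_4: "s ^ 4 = of_nat (card (carrier K)) * of_nat (card (carrier K))"
proof -
  have "s ^ 4 = (s * s) * (s * s)" by (simp add: power4_eq_xxxx mult.assoc)
  then show ?thesis by (simp only: s_square)
qed

end

context hall_quotient
begin

text \<open>Endomorphisms of P are scalars. The zero map gives P + P without differential; any other
  scalar gives a copy of K_P, which vanishes modulo W. The constant is the inverse of sqrt(q) q =
  v^3.\<close>

lemma ebas_square:
  assumes P: "projective K A P" and KP: "basis_vector K A (K_complex P) \<in> W"
    and card: "card (homs A P P) = card (carrier K)"
  shows "ebas (C_complex P) \<otimes>\<^bsub>H\<^esub> ebas (C_complex P) \<approx>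
    (\<lambda>\<gamma>. inverse (s ^ 3) * ebas (C_complex (direct_sum P P)) \<gamma>)"
proof -
  note l = projectiveD[OF P]
  interpret P: left_module A P by (rule l)
  let ?z = "zero_hom P P" and ?e = "ebas (C_complex (direct_sum P P))"
  have z: "?z \<in> homs A P P" by (rule zero_hom_homs[OF l(1) l(1)])
  have fin: "finite (homs A P P)" by (rule finite_homs[OF l(2) l(2)])
  have eH: "?e \<in> carrier H"
    by (intro ebas_H C1_object_C projective_direct_sum P)
  have "ebas (arrow P P h) \<approx> (\<lambda>\<gamma>. if h = ?z then ?e \<gamma> else 0)" if h: "h \<in> homs A P P" for h
  proof (cases "h = ?z")
    case True
    then show ?thesis
      using ebas_arrow_zero(1)[OF P P] cong_refl[OF eH] by simp
  next
    case False
    note hm = homs_mhom[OF h]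
    obtain x0 where x0: "x0 \<in> carrier P" "h x0 \<noteq> \<zero>\<^bsub>P\<^esub>"
      using homs_nonzero[OF h l(1) l(1) False] by metis
    have "x0 \<noteq> \<zero>\<^bsub>P\<^esub>"
      using x0 mhom_zero[OF l(1) l(1) hm] by auto
    then obtain c where c: "c \<in> carrier K" "\<And>x. x \<in> carrier P \<Longrightarrow> h x = scal P c x"
      using endo_scal[OF l x0(1) _ card h] by metis
    have "c \<noteq> \<zero>\<^bsub>K\<^esub>"
      using c(2)[OF x0(1)] x0 scal_zero_left[OF l(1)] by auto
    then have inj: "inj_on h (carrier P)"
      using scal_cancel[OF l(1) c(1)] by (auto simp: inj_on_def c(2))
    have "cpx_iso (K_complex P) (arrow P P h)"
    proof (rule cpx_isoI[OF C1_object_K[OF P] C1_object_arrow[OF P P h]])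
      \<comment> \<open>The differential of K_P is the identity from the second copy of P to the
        first; applying h to the first copy turns it into h.\<close>
      show m: "map_prod h (\<lambda>x. x) \<in> mhom A (fst (K_complex P)) (fst (arrow P P h))"
        using hm by (intro mhomI) (auto simp: mhom_closed mhom_add mhom_smult)
      show "bij_betw (map_prod h (\<lambda>x. x)) (carrier (fst (K_complex P))) (carrier (fst (arrow P P h)))"
        using m l inj by (intro mhom_inj_bij) (auto simp: inj_on_def)
      fix z assume "z \<in> carrier (fst (K_complex P))"
      then obtain a b where "z = (a, b)" "a \<in> carrier P" "b \<in> carrier P" by auto
      then show "map_prod h (\<lambda>x. x) (snd (K_complex P) z) = snd (arrow P P h) (map_prod h (\<lambda>x. x) z)"
        using mhom_closed[OF hm, of b] by simp
    qed
    then have "ebas (arrow P P h) = ebas (K_complex P)"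
      using ebas_iso by metis
    then have "ebas (arrow P P h) \<in> W"
      using W_scale[OF KP] by (simp add: ebas_def)
    then show ?thesis
      using False cong_zero by simp
  qed
  from cong_sum[where f = "\<lambda>h. ebas (arrow P P h)" and g = "\<lambda>h \<gamma>. if h = ?z then ?e \<gamma> else 0", OF fin this]
  have "(\<lambda>\<gamma>. \<Sum>h\<in>homs A P P. ebas (arrow P P h) \<gamma>) \<approx> ?e"
    using z fin by simp
  note sum = this
  have "complex_of_real (1 / (sqrt (real (card (homs A P P))) * real (card (homs A P P)))) = inverse (s ^ 3)"
    unfolding s_power_3 by (simp add: card s_def twisting_parameter_def inverse_eq_divide)
  then show ?thesis
    using cong_scale[OF sum, of "inverse (s ^ 3)"] unfolding ebas_mult_C[OF P P] by simp
qed

text \<open>Coefficient of a: v^-5 - (v + v^-1) v^-6 + v^-7 = 0. Coefficient of b: (v + v^-1) v^-6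
  (v^2 - 1) = v^-7 (v^4 - 1). Both orders of the outer terms are recorded because x and z change
  places between the two relations.\<close>

lemma serre_combine:
  assumes "x \<approx> (\<lambda>\<gamma>. inverse (s ^ 5) * a \<gamma>)"
    and "y \<approx> (\<lambda>\<gamma>. inverse (s ^ 6) * (a \<gamma> + (s ^ 2 - 1) * b \<gamma>))"
    and "z \<approx> (\<lambda>\<gamma>. inverse (s ^ 7) * (a \<gamma> + (s ^ 4 - 1) * b \<gamma>))"
  shows "(\<lambda>\<gamma>. x \<gamma> - (s + inverse s) * y \<gamma> + z \<gamma>) \<approx> (\<lambda>\<gamma>. 0)"
    "(\<lambda>\<gamma>. z \<gamma> - (s + inverse s) * y \<gamma> + x \<gamma>) \<approx> (\<lambda>\<gamma>. 0)"
proof -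
  have "inverse (s ^ 5) * u + (- (s + inverse s)) * (inverse (s ^ 6) * (u + (s ^ 2 - 1) * w)) +
      inverse (s ^ 7) * (u + (s ^ 4 - 1) * w) = 0" for u w
    using s_nonzero by (simp add: field_simps eval_nat_numeral)
  then have "(\<lambda>\<gamma>. x \<gamma> + (- (s + inverse s)) * y \<gamma> + z \<gamma>) \<approx> (\<lambda>\<gamma>. 0)"
    using cong_add[OF cong_add[OF assms(1) cong_scale[OF assms(2), of "- (s + inverse s)"]] assms(3)]
    by simp
  moreover have "(\<lambda>\<gamma>. x \<gamma> + (- (s + inverse s)) * y \<gamma> + z \<gamma>) = (\<lambda>\<gamma>. x \<gamma> - (s + inverse s) * y \<gamma> + z \<gamma>)"
    by (simp only: mult_minus_left diff_conv_add_uminus)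
  ultimately show "(\<lambda>\<gamma>. x \<gamma> - (s + inverse s) * y \<gamma> + z \<gamma>) \<approx> (\<lambda>\<gamma>. 0)"
    by simp
  then show "(\<lambda>\<gamma>. z \<gamma> - (s + inverse s) * y \<gamma> + x \<gamma>) \<approx> (\<lambda>\<gamma>. 0)"
    by (simp add: algebra_simps)
qed

end

text \<open>To be applied with \<open>M = P\<^sub>j\<close> and \<open>N = P\<^sub>i\<close> for a path from \<open>i\<close> to \<open>j\<close>.\<close>

locale exceptional_pair = hall_quotient K A W
  for K :: "'k ring" and A :: "('k, 'a) module" and W +
  fixes M N :: "('a, 'p) module"
  assumes M: "projective K A M" and N: "projective K A N"
    and KM: "basis_vector K A (K_complex M) \<in> W" and KN: "basis_vector K A (K_complex N) \<in> W"
    and end_M: "card (homs A M M) = card (carrier K)" and end_N: "card (homs A N N) = card (carrier K)"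
    and hom_MN: "card (homs A M N) = card (carrier K)" and hom_NM: "card (homs A N M) = 1"
begin

abbreviation "MM \<equiv> direct_sum M M"
abbreviation "NN \<equiv> direct_sum N N"

lemmas lM = projectiveD(1)[OF M] and lN = projectiveD(1)[OF N]
lemmas fM = projectiveD(2)[OF M] and fN = projectiveD(2)[OF N]

sublocale M: left_module A M by (rule lM)
sublocale N: left_module A N by (rule lN)

lemma lMM: "left_module A MM" and lNN: "left_module A NN"
  and MM: "projective K A MM" and NN: "projective K A NN"
  by (intro left_module_direct_sum lM lN projective_direct_sum M N)+

lemma homs_zero_NM: "h \<in> mhom A N M \<Longrightarrow> x \<in> carrier N \<Longrightarrow> h x = \<zero>\<^bsub>M\<^esub>"
  using homs_restrict[OF lN, of h M] homs_trivial[OF hom_NM lN lM] by (metis restrict_apply' singletonD)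

lemma ex_f: "\<exists>f\<in>homs A M N. \<exists>x\<in>carrier M. f x \<noteq> \<zero>\<^bsub>N\<^esub>"
proof -
  have "homs A M N \<noteq> {zero_hom M N}"
    using hom_MN card_K_gt_1 by auto
  then obtain f where "f \<in> homs A M N" "f \<noteq> zero_hom M N"
    using zero_hom_homs[OF lM lN] by blast
  then show ?thesis
    using homs_nonzero[OF _ lM lN] by metis
qed

text \<open>A basis vector of the line Hom(M, N).\<close>

definition f where "f = (SOME f. f \<in> homs A M N \<and> (\<exists>x\<in>carrier M. f x \<noteq> \<zero>\<^bsub>N\<^esub>))"

lemma f_homs: "f \<in> homs A M N" and f_nonzero: "\<exists>x\<in>carrier M. f x \<noteq> \<zero>\<^bsub>N\<^esub>"
  using someI_ex[of "\<lambda>f. f \<in> homs A M N \<and> (\<exists>x\<in>carrier M. f x \<noteq> \<zero>\<^bsub>N\<^esub>)"] ex_f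
  unfolding f_def by blast+

lemmas f_mhom = homs_mhom[OF f_homs]
lemmas f_closed = mhom_closed[OF f_mhom]

lemma hom_MN_scal:
  assumes "h \<in> mhom A M N"
  obtains c where "c \<in> carrier K" "\<And>x. x \<in> carrier M \<Longrightarrow> h x = scal N c (f x)"
proof -
  obtain x0 where x0: "x0 \<in> carrier M" "f x0 \<noteq> \<zero>\<^bsub>N\<^esub>" using f_nonzero by blast
  obtain c where "c \<in> carrier K" "\<And>x. x \<in> carrier M \<Longrightarrow> restrict h (carrier M) x = scal N c (f x)"
    using homs_scal[OF lM lN fM fN f_homs x0 hom_MN homs_restrict[OF lM assms]] by metis
  then show ?thesis using that by simp
qed

lemma end_M_scal:
  assumes h: "h \<in> mhom A M M" and x0: "x0 \<in> carrier M" "h x0 \<noteq> \<zero>\<^bsub>M\<^esub>"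
  obtains c where "c \<in> carrier K" "c \<noteq> \<zero>\<^bsub>K\<^esub>" "\<And>x. x \<in> carrier M \<Longrightarrow> h x = scal M c x"
proof -
  have "x0 \<noteq> \<zero>\<^bsub>M\<^esub>"
    using x0 mhom_zero[OF lM lM h] by auto
  then obtain c where c: "c \<in> carrier K" "\<And>x. x \<in> carrier M \<Longrightarrow> restrict h (carrier M) x = scal M c x"
    using endo_scal[OF lM fM x0(1) _ end_M homs_restrict[OF lM h]] by metis
  moreover have "c \<noteq> \<zero>\<^bsub>K\<^esub>"
    using c(2)[OF x0(1)] x0 scal_zero_left[OF lM] by auto
  ultimately show ?thesis using that by simp
qed

lemma end_N_scal:
  assumes h: "h \<in> mhom A N N" and x0: "x0 \<in> carrier N" "h x0 \<noteq> \<zero>\<^bsub>N\<^esub>"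
  obtains c where "c \<in> carrier K" "c \<noteq> \<zero>\<^bsub>K\<^esub>" "\<And>x. x \<in> carrier N \<Longrightarrow> h x = scal N c x"
proof -
  have "x0 \<noteq> \<zero>\<^bsub>N\<^esub>"
    using x0 mhom_zero[OF lN lN h] by auto
  then obtain c where c: "c \<in> carrier K" "\<And>x. x \<in> carrier N \<Longrightarrow> restrict h (carrier N) x = scal N c x"
    using endo_scal[OF lN fN x0(1) _ end_N homs_restrict[OF lN h]] by metis
  moreover have "c \<noteq> \<zero>\<^bsub>K\<^esub>"
    using c(2)[OF x0(1)] x0 scal_zero_left[OF lN] by auto
  ultimately show ?thesis using that by simp
qed

lemma scal_inj_on: "left_module A L \<Longrightarrow> c \<in> carrier K \<Longrightarrow> c \<noteq> \<zero>\<^bsub>K\<^esub> \<Longrightarrow> inj_on (scal L c) (carrier L)"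
  by (auto simp: inj_on_def intro: scal_cancel)

text \<open>Normal forms: a nonzero map M^2 -> N is an automorphism of M^2 followed by
  \<open>f2\<close>, and a nonzero map M -> N^2 is \<open>f1\<close> followed by an automorphism of
  N^2.\<close>

definition "f2 = (\<lambda>z\<in>carrier MM. f (snd z))"
definition "f1 = (\<lambda>y\<in>carrier M. (f y, \<zero>\<^bsub>N\<^esub>))"

lemma snd_mhom: "snd \<in> mhom A (direct_sum L L') L'" and fst_mhom: "fst \<in> mhom A (direct_sum L L') L"
  by (auto intro!: mhomI)

lemma f2_homs: "f2 \<in> homs A MM N"
  unfolding f2_def by (intro homs_restrict lMM mhom_compose[OF snd_mhom f_mhom])

lemma f1_homs: "f1 \<in> homs A M NN"
  unfolding f1_def by (intro homs_restrict lM mhom_compose[OF f_mhom inj1_mhom[OF lN]])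

text \<open>A map M^2 -> N is a row (c, d) over k times f, and GL_2(k) is transitive on nonzero
  rows: \<tau> is an invertible matrix with second row (c, d).\<close>

lemma arrow_MM_N:
  assumes h: "h \<in> homs A MM N" "h \<noteq> zero_hom MM N"
  shows "ebas (arrow MM N h) = ebas (arrow MM N f2)"
proof -
  note hm = homs_mhom[OF h(1)]
  obtain c where c: "c \<in> carrier K" "\<And>y. y \<in> carrier M \<Longrightarrow> h (y, \<zero>\<^bsub>M\<^esub>) = scal N c (f y)"
    using hom_MN_scal[OF mhom_compose[OF inj1_mhom[OF lM] hm]] by metis
  obtain d where d: "d \<in> carrier K" "\<And>y. y \<in> carrier M \<Longrightarrow> h (\<zero>\<^bsub>M\<^esub>, y) = scal N d (f y)"
    using hom_MN_scal[OF mhom_compose[OF inj2_mhom[OF lM] hm]] by metis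
  have h_eq: "h (y, y') = scal N c (f y) \<oplus>\<^bsub>N\<^esub> scal N d (f y')" if "y \<in> carrier M" "y' \<in> carrier M" for y y'
    using homs_direct_sum_split[OF lM lM hm that] c d that by simp
  have "\<exists>\<tau>\<in>mhom A MM MM. inj_on \<tau> (carrier MM) \<and> (\<forall>z\<in>carrier MM. h z = f2 (\<tau> z))"
  proof (cases "d = \<zero>\<^bsub>K\<^esub>")
    case False
    let ?\<tau> = "\<lambda>(y, y'). (y, scal M c y \<oplus>\<^bsub>M\<^esub> scal M d y')"
    have "?\<tau> \<in> mhom A MM MM"
      using c d lM
      by (intro mhomI) (auto simp: scal_closed scal_add scal_smult M.smult_r_distr M.smult_closed M.M.a_ac)
    moreover have "inj_on ?\<tau> (carrier MM)"
    proof (rule inj_onI, clarsimp)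
      fix y y' u' assume *: "y \<in> carrier M" "y' \<in> carrier M" "u' \<in> carrier M"
        "scal M c y \<oplus>\<^bsub>M\<^esub> scal M d y' = scal M c y \<oplus>\<^bsub>M\<^esub> scal M d u'"
      then have "scal M d y' = scal M d u'"
        using c(1) d(1) lM by (simp add: scal_closed)
      then show "y' = u'"
        using * scal_cancel[OF lM d(1) False] by blast
    qed
    moreover have "\<forall>z\<in>carrier MM. h z = f2 (?\<tau> z)"
      using c d lM by (auto simp: h_eq f2_def scal_closed mhom_add[OF f_mhom] mhom_scal[OF f_mhom])
    ultimately show ?thesis by blast
  next
    case True
    have "c \<noteq> \<zero>\<^bsub>K\<^esub>"
    proof
      assume "c = \<zero>\<^bsub>K\<^esub>"
      then have "h = zero_hom MM N"
        using True f_closed lN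
        by (intro homs_eqI[OF h(1) zero_hom_homs[OF lMM lN]]) (auto simp: h_eq scal_zero_left)
      then show False using h(2) by simp
    qed
    \<comment> \<open>For d = 0 the first row has to be (0, 1) instead of (1, 0) to keep the matrix
      invertible.\<close>
    let ?\<tau> = "\<lambda>(y, y'). (y', scal M c y)"
    have "?\<tau> \<in> mhom A MM MM"
      using c lM by (intro mhomI) (auto simp: scal_closed scal_add scal_smult)
    moreover have "inj_on ?\<tau> (carrier MM)"
      using scal_cancel[OF lM c(1) \<open>c \<noteq> \<zero>\<^bsub>K\<^esub>\<close>] by (auto simp: inj_on_def)
    moreover have "\<forall>z\<in>carrier MM. h z = f2 (?\<tau> z)"
      using c True lM lN f_closed
      by (auto simp: h_eq f2_def scal_closed scal_zero_left mhom_scal[OF f_mhom])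
    ultimately show ?thesis by blast
  qed
  then obtain \<tau> where \<tau>: "\<tau> \<in> mhom A MM MM" "inj_on \<tau> (carrier MM)" "\<And>z. z \<in> carrier MM \<Longrightarrow> h z = f2 (\<tau> z)"
    by blast
  have "bij_betw \<tau> (carrier MM) (carrier MM)"
    using \<tau> fM by (intro mhom_inj_bij) auto
  then show ?thesis
    using arrow_iso[OF MM N MM N h(1) f2_homs \<tau>(1) _ mhom_id[of A N]] \<tau>(3)
    by (intro ebas_iso) (auto simp: bij_betw_def)
qed

text \<open>The transposed argument: a map M -> N^2 is a column (c, d) over k times f, and \<sigma>
  is an invertible matrix with first column (c, d).\<close>

lemma arrow_M_NN:
  assumes h: "h \<in> homs A M NN" "h \<noteq> zero_hom M NN"
  shows "ebas (arrow M NN h) = ebas (arrow M NN f1)"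
proof -
  note hm = homs_mhom[OF h(1)]
  obtain c where c: "c \<in> carrier K" "\<And>y. y \<in> carrier M \<Longrightarrow> fst (h y) = scal N c (f y)"
    using hom_MN_scal[OF mhom_compose[OF hm fst_mhom]] by metis
  obtain d where d: "d \<in> carrier K" "\<And>y. y \<in> carrier M \<Longrightarrow> snd (h y) = scal N d (f y)"
    using hom_MN_scal[OF mhom_compose[OF hm snd_mhom]] by metis
  have h_eq: "h y = (scal N c (f y), scal N d (f y))" if "y \<in> carrier M" for y
    using c d that by (simp add: prod_eq_iff)
  have "\<exists>\<sigma>\<in>mhom A NN NN. inj_on \<sigma> (carrier NN) \<and> (\<forall>y\<in>carrier M. \<sigma> (f1 y) = h y)"
  proof (cases "c = \<zero>\<^bsub>K\<^esub>")
    case False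
    let ?\<sigma> = "\<lambda>(x, x'). (scal N c x, scal N d x \<oplus>\<^bsub>N\<^esub> x')"
    have "?\<sigma> \<in> mhom A NN NN"
      using c d lN
      by (intro mhomI) (auto simp: scal_closed scal_add scal_smult N.smult_r_distr N.smult_closed N.M.a_ac)
    moreover have "inj_on ?\<sigma> (carrier NN)"
    proof (rule inj_onI, clarsimp)
      fix x x' y y' assume *: "x \<in> carrier N" "x' \<in> carrier N" "y \<in> carrier N" "y' \<in> carrier N"
        "scal N c x = scal N c y" "scal N d x \<oplus>\<^bsub>N\<^esub> x' = scal N d y \<oplus>\<^bsub>N\<^esub> y'"
      then have "x = y" using scal_cancel[OF lN c(1) False] by blast
      then show "x = y \<and> x' = y'" using * d lN by (simp add: scal_closed)
    qed
    moreover have "\<forall>y\<in>carrier M. ?\<sigma> (f1 y) = h y"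
      using c d lN f_closed by (auto simp: h_eq f1_def scal_closed)
    ultimately show ?thesis by blast
  next
    case True
    have dnz: "d \<noteq> \<zero>\<^bsub>K\<^esub>"
    proof
      assume "d = \<zero>\<^bsub>K\<^esub>"
      then have "h = zero_hom M NN"
        using True f_closed lN
        by (intro homs_eqI[OF h(1) zero_hom_homs[OF lM lNN]]) (auto simp: h_eq scal_zero_left)
      then show False using h(2) by simp
    qed
    let ?\<sigma> = "\<lambda>(x, x'). (x', scal N d x)"
    have "?\<sigma> \<in> mhom A NN NN"
      using d lN by (intro mhomI) (auto simp: scal_closed scal_add scal_smult)
    moreover have "inj_on ?\<sigma> (carrier NN)"
      using scal_cancel[OF lN d(1) dnz] by (auto simp: inj_on_def)
    moreover have "\<forall>y\<in>carrier M. ?\<sigma> (f1 y) = h y"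
      using d True lN f_closed by (auto simp: h_eq f1_def scal_closed scal_zero_left)
    ultimately show ?thesis by blast
  qed
  then obtain \<sigma> where \<sigma>: "\<sigma> \<in> mhom A NN NN" "inj_on \<sigma> (carrier NN)" "\<And>y. y \<in> carrier M \<Longrightarrow> \<sigma> (f1 y) = h y"
    by blast
  have "bij_betw \<sigma> (carrier NN) (carrier NN)"
    using \<sigma> fN by (intro mhom_inj_bij) auto
  then have "cpx_iso (arrow M NN f1) (arrow M NN h)"
    using arrow_iso[OF M NN M NN f1_homs h(1) mhom_id[of A M] _ \<sigma>(1)] \<sigma>(3)
    by (auto simp: bij_betw_def)
  then show ?thesis
    using ebas_iso by metis
qed

text \<open>An extension map N + M -> M vanishes on N, as Hom(N, M) = 0, and is a scalar c on M. For
  c = 0 the new M is a direct summand with zero differential; for any other c a K_M splits off. The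
  constant is the inverse of |Hom(M, N + M)|^(1/2) |Hom(N + M, M)| = q q = v^4.\<close>

lemma ext_arrow_M:
  assumes h: "h \<in> homs A M N"
  shows "ebas (arrow M N h) \<otimes>\<^bsub>H\<^esub> ebas (C_complex M) \<approx>
    (\<lambda>\<gamma>. inverse (s ^ 4) * ebas (arrow MM N (\<lambda>z\<in>carrier MM. h (snd z))) \<gamma>)"
proof -
  let ?X = "arrow M N h" and ?Y = "C_complex M" and ?NM = "direct_sum N M"
  let ?h2 = "\<lambda>z\<in>carrier MM. h (snd z)" and ?z = "zero_hom ?NM M"
  note hm = homs_mhom[OF h]
  have hc: "h y \<in> carrier N" if "y \<in> carrier M" for y
    using mhom_closed[OF hm that] .
  note oX = C1_object_arrow[OF M N h] and oY = C1_object_C[OF M]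
  have lNM: "left_module A ?NM" by (rule left_module_direct_sum[OF lN lM])
  have h2: "?h2 \<in> homs A MM N"
    by (intro homs_restrict lMM mhom_compose[OF snd_mhom hm])
  let ?e = "ebas (arrow MM N ?h2)"
  have eH: "?e \<in> carrier H"
    by (intro ebas_H C1_object_arrow MM N h2)
  have zE: "?z \<in> ext_maps A ?X ?Y"
    using zero_ext_map[OF oX oY] by simp
  have "ebas (ext_complex ?X ?Y g) \<approx> (\<lambda>\<gamma>. if g = ?z then ?e \<gamma> else 0)" if g: "g \<in> ext_maps A ?X ?Y" for g
  proof (cases "g = ?z")
    case True
    let ?\<theta> = "\<lambda>(y, x, y'). (x, y, y')"
    have "cpx_iso (ext_complex ?X ?Y ?z) (arrow MM N ?h2)"
    proof (rule cpx_isoI[OF C1_object_ext_complex[OF oX oY zE] C1_object_arrow[OF MM N h2]])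
      show m: "?\<theta> \<in> mhom A (fst (ext_complex ?X ?Y ?z)) (fst (arrow MM N ?h2))"
        by (intro mhomI) auto
      show "bij_betw ?\<theta> (carrier (fst (ext_complex ?X ?Y ?z))) (carrier (fst (arrow MM N ?h2)))"
        using m fM fN by (intro mhom_inj_bij) (auto simp: inj_on_def)
      fix u assume "u \<in> carrier (fst (ext_complex ?X ?Y ?z))"
      then obtain y x y' where "u = (y, x, y')" "y \<in> carrier M" "x \<in> carrier N" "y' \<in> carrier M"
        by auto
      then show "?\<theta> (snd (ext_complex ?X ?Y ?z) u) = snd (arrow MM N ?h2) (?\<theta> u)"
        using hc[of y'] by simp
    qed
    then have "ebas (ext_complex ?X ?Y g) = ?e"
      using True ebas_iso by metis
    then show ?thesis
      using True cong_refl[OF eH] by simp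
  next
    case False
    have gh: "g \<in> homs A ?NM M" using ext_maps_homs[OF g] by simp
    note gm = homs_mhom[OF gh]
    have g1: "g (x, \<zero>\<^bsub>M\<^esub>) = \<zero>\<^bsub>M\<^esub>" if "x \<in> carrier N" for x
      using homs_zero_NM[OF mhom_compose[OF inj1_mhom[OF lM] gm] that] .
    have g_eq: "g (x, y) = g (\<zero>\<^bsub>N\<^esub>, y)" if "x \<in> carrier N" "y \<in> carrier M" for x y
      using homs_direct_sum_split[OF lN lM gm that] g1[OF that(1)] that mhom_closed[OF gm] by simp
    obtain u where "u \<in> carrier ?NM" "g u \<noteq> \<zero>\<^bsub>M\<^esub>"
      using homs_nonzero[OF gh lNM lM False] by metis
    then obtain x0 where x0: "x0 \<in> carrier M" "g (\<zero>\<^bsub>N\<^esub>, x0) \<noteq> \<zero>\<^bsub>M\<^esub>"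
      using g_eq by (metis SigmaE carrier_direct_sum)
    obtain c where c: "c \<in> carrier K" "c \<noteq> \<zero>\<^bsub>K\<^esub>" "\<And>y. y \<in> carrier M \<Longrightarrow> g (\<zero>\<^bsub>N\<^esub>, y) = scal M c y"
      using end_M_scal[OF mhom_compose[OF inj2_mhom[OF lN] gm] x0] by metis
    \<comment> \<open>The second copy of M is the M inside X, and the first copy is its image (c a,
      h a) under the differential. As c is invertible, N remains as a complement of this
      K_M.\<close>
    let ?\<theta> = "\<lambda>(x, a, b). (scal M c a, x \<oplus>\<^bsub>N\<^esub> h a, b)"
    have \<theta>: "?\<theta> \<in> mhom A (direct_sum N MM) (fst (ext_complex ?X ?Y g))"
      using c(1) lM hc
      by (intro mhomI)
        (auto simp: scal_closed scal_add scal_smult mhom_add[OF hm] mhom_smult[OF hm] N.smult_r_distr N.smult_closed N.M.a_ac)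
    have "ebas (ext_complex ?X ?Y g) \<in> W"
    proof (rule contractible_summand[OF C1_object_ext_complex[OF oX oY g] N M KM \<theta>])
      show "bij_betw ?\<theta> (carrier (direct_sum N MM)) (carrier (fst (ext_complex ?X ?Y g)))"
      proof (rule mhom_inj_bij[OF \<theta>])
        show "inj_on ?\<theta> (carrier (direct_sum N MM))"
        proof (rule inj_onI, clarsimp)
          fix x a b x' a' b' assume *: "x \<in> carrier N" "a \<in> carrier M" "x' \<in> carrier N" "a' \<in> carrier M"
            "scal M c a = scal M c a'" "x \<oplus>\<^bsub>N\<^esub> h a = x' \<oplus>\<^bsub>N\<^esub> h a'"
          then have "a = a'" using scal_cancel[OF lM c(1,2)] by blast
          then show "x = x' \<and> a = a'" using * hc by simp
        qed
      qed (use fM fN in auto)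
      fix x a b assume "x \<in> carrier N" "a \<in> carrier M" "b \<in> carrier M"
      then show "snd (ext_complex ?X ?Y g) (?\<theta> (x, a, b)) = ?\<theta> (\<zero>\<^bsub>N\<^esub>, b, \<zero>\<^bsub>M\<^esub>)"
        using hc lM c g_eq[of "x \<oplus>\<^bsub>N\<^esub> h a" b] by (simp add: scal_closed)
    qed
    then show ?thesis
      using False cong_zero by simp
  qed
  from cong_sum[where f = "\<lambda>g. ebas (ext_complex ?X ?Y g)" and g = "\<lambda>g \<gamma>. if g = ?z then ?e \<gamma> else 0",
      OF finite_ext_maps[OF oX oY] this]
  have sum: "(\<lambda>\<gamma>. \<Sum>g\<in>ext_maps A ?X ?Y. ebas (ext_complex ?X ?Y g) \<gamma>) \<approx> ?e"
    using zE finite_ext_maps[OF oX oY] by simp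
  have "complex_of_real (hall_factor ?X ?Y) = inverse (s ^ 4)"
  proof -
    have "hall_factor ?X ?Y = 1 / (real (card (carrier K)) * real (card (carrier K)))"
      by (simp add: hall_factor_def card_homs_direct_sum_left[OF lN lM lM]
        card_homs_direct_sum_right[OF lN lM lM] hom_MN hom_NM end_M)
    then show ?thesis
      by (simp add: s_power_4 inverse_eq_divide)
  qed
  then show ?thesis
    using cong_scale[OF sum, of "complex_of_real (hall_factor ?X ?Y)"] unfolding ebas_mult[OF oX oY] by simp
qed

text \<open>An extension map M + N -> N consists of a map g1 from M and a scalar c on N. For nonzero
  c a K_N splits off. For c = 0 there are q choices of g1: zero gives the first class, and the other
  q - 1 = v^2 - 1 give the second by \<open>arrow_M_NN\<close>. The constant is the inverse of
  |Hom(N, M + N)|^(1/2) |Hom(M + N, N)| = v q^2 = v^5.\<close>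

lemma ext_arrow_N:
  shows "ebas (arrow N M (zero_hom N M)) \<otimes>\<^bsub>H\<^esub> ebas (C_complex N) \<approx>
    (\<lambda>\<gamma>. inverse (s ^ 5) * (ebas (arrow M NN (zero_hom M NN)) \<gamma> + (s ^ 2 - 1) * ebas (arrow M NN f1) \<gamma>))"
proof -
  let ?X = "arrow N M (zero_hom N M)" and ?Y = "C_complex N" and ?MN = "direct_sum M N"
  let ?a = "ebas (arrow M NN (zero_hom M NN))" and ?b = "ebas (arrow M NN f1)"
  let ?z = "zero_hom ?MN N"
  have zNM: "zero_hom N M \<in> homs A N M" by (rule zero_hom_homs[OF lN lM])
  note oX = C1_object_arrow[OF N M zNM] and oY = C1_object_C[OF N]
  have lMN: "left_module A ?MN" by (rule left_module_direct_sum[OF lM lN])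
  have zH: "?z \<in> homs A ?MN N" by (rule zero_hom_homs[OF lMN lN])
  have E: "ext_maps A ?X ?Y = homs A ?MN N"
  proof -
    have "\<forall>x\<in>carrier ?MN. snd ?Y (g x) \<oplus>\<^bsub>N\<^esub> g (snd ?X x) = \<zero>\<^bsub>N\<^esub>" if "g \<in> homs A ?MN N" for g
      using mhom_zero[OF lMN lN homs_mhom[OF that]] by auto
    then show ?thesis by (auto simp: ext_maps_def)
  qed
  have fin: "finite (homs A ?MN N)"
    using fM fN by (intro finite_homs) auto
  \<comment> \<open>The extension maps with scalar c = 0, which are the ones that survive modulo
    W.\<close>
  define E0 where "E0 = {g \<in> homs A ?MN N. \<forall>x\<in>carrier N. g (\<zero>\<^bsub>M\<^esub>, x) = \<zero>\<^bsub>N\<^esub>}"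
  have E0: "finite E0" "E0 \<subseteq> homs A ?MN N" "?z \<in> E0"
    using fin zH by (auto simp: E0_def)
  have E0_eq: "g (y, x) = g (y, \<zero>\<^bsub>N\<^esub>)" if g: "g \<in> E0" and yx: "y \<in> carrier M" "x \<in> carrier N" for g y x
  proof -
    have gm: "g \<in> mhom A ?MN N" and g0: "g (\<zero>\<^bsub>M\<^esub>, x) = \<zero>\<^bsub>N\<^esub>"
      using g yx by (auto simp: E0_def homs_mhom)
    show ?thesis
      using homs_direct_sum_split[OF lM lN gm yx] g0 mhom_closed[OF gm, of "(y, \<zero>\<^bsub>N\<^esub>)"] yx by simp
  qed
  have card_E0: "card E0 = card (carrier K)"
  proof -
    let ?F = "\<lambda>g. \<lambda>y\<in>carrier M. g (y, \<zero>\<^bsub>N\<^esub>)"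
    have "inj_on ?F E0"
    proof (rule inj_onI)
      fix g g' assume g: "g \<in> E0" "g' \<in> E0" and eq: "?F g = ?F g'"
      show "g = g'"
      proof (rule homs_eqI[of g A ?MN N])
        fix u assume "u \<in> carrier ?MN"
        then obtain y x where u: "u = (y, x)" "y \<in> carrier M" "x \<in> carrier N" by auto
        then show "g u = g' u"
          using fun_cong[OF eq, of y] E0_eq[OF g(1) u(2,3)] E0_eq[OF g(2) u(2,3)] by simp
      qed (use g in \<open>auto simp: E0_def\<close>)
    qed
    moreover have "?F ` E0 = homs A M N"
    proof (intro equalityI subsetI)
      fix h assume "h \<in> ?F ` E0"
      then obtain g where "g \<in> E0" and h: "h = ?F g" by blast
      then have g: "g \<in> mhom A ?MN N" by (simp add: E0_def homs_mhom)
      show "h \<in> homs A M N"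
        unfolding h by (intro homs_restrict lM mhom_compose[OF inj1_mhom[OF lN] g])
    next
      fix h assume h: "h \<in> homs A M N"
      let ?g = "\<lambda>z\<in>carrier ?MN. h (fst z)"
      have "?g \<in> homs A ?MN N"
        by (intro homs_restrict lMN mhom_compose[OF fst_mhom homs_mhom[OF h]])
      then have gE: "?g \<in> E0"
        using mhom_zero[OF lM lN homs_mhom[OF h]] by (simp add: E0_def)
      have "h = ?F ?g"
        using h by (intro extensionalityI[of _ "carrier M"]) (auto simp: homs_def)
      then show "h \<in> ?F ` E0"
        using gE by (rule image_eqI)
    qed
    ultimately show ?thesis
      using card_image[of ?F E0] hom_MN by simp
  qed
  have aH: "?a \<in> carrier H" and bH: "?b \<in> carrier H"
    by (intro ebas_H C1_object_arrow M NN zero_hom_homs lM lNN f1_homs)+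
  have arrow_E0: "ebas (ext_complex ?X ?Y g) = (if g = ?z then ?a else ?b)" if g: "g \<in> E0" for g
  proof -
    have gh: "g \<in> homs A ?MN N" using g by (simp add: E0_def)
    note gm = homs_mhom[OF gh]
    \<comment> \<open>The new N is the first summand of N + N and receives the values of g; nothing
      maps to the old N.\<close>
    let ?h = "\<lambda>y\<in>carrier M. (g (y, \<zero>\<^bsub>N\<^esub>), \<zero>\<^bsub>N\<^esub>)"
    have h: "?h \<in> homs A M NN"
      by (intro homs_restrict lM mhom_compose[OF mhom_compose[OF inj1_mhom[OF lN] gm] inj1_mhom[OF lN]])
    have gE: "g \<in> ext_maps A ?X ?Y" using gh E by simp
    have gc: "g (y, x) \<in> carrier N" if "y \<in> carrier M" "x \<in> carrier N" for y x
      using mhom_closed[OF gm] that by simp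
    let ?\<theta> = "\<lambda>(x, y, x'). ((x, x'), y)"
    have "cpx_iso (ext_complex ?X ?Y g) (arrow M NN ?h)"
    proof (rule cpx_isoI[OF C1_object_ext_complex[OF oX oY gE] C1_object_arrow[OF M NN h]])
      show m: "?\<theta> \<in> mhom A (fst (ext_complex ?X ?Y g)) (fst (arrow M NN ?h))"
        by (intro mhomI) auto
      show "bij_betw ?\<theta> (carrier (fst (ext_complex ?X ?Y g))) (carrier (fst (arrow M NN ?h)))"
        using m fM fN by (intro mhom_inj_bij) (auto simp: inj_on_def)
      fix u assume "u \<in> carrier (fst (ext_complex ?X ?Y g))"
      then obtain x y x' where "u = (x, y, x')" "x \<in> carrier N" "y \<in> carrier M" "x' \<in> carrier N"
        by auto
      then show "?\<theta> (snd (ext_complex ?X ?Y g) u) = snd (arrow M NN ?h) (?\<theta> u)"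
        using gc[of y x'] gc[of y "\<zero>\<^bsub>N\<^esub>"] E0_eq[OF g, of y x'] by simp
    qed
    then have eq: "ebas (ext_complex ?X ?Y g) = ebas (arrow M NN ?h)"
      by (rule ebas_iso)
    show ?thesis
    proof (cases "g = ?z")
      case True
      then have "?h = zero_hom M NN" by auto
      then show ?thesis using True eq by simp
    next
      case False
      then obtain u where "u \<in> carrier ?MN" "g u \<noteq> \<zero>\<^bsub>N\<^esub>"
        using homs_nonzero[OF gh lMN lN] by metis
      then obtain y where y: "y \<in> carrier M" "g (y, \<zero>\<^bsub>N\<^esub>) \<noteq> \<zero>\<^bsub>N\<^esub>"
        using E0_eq[OF g] by (metis SigmaE carrier_direct_sum)
      have "?h \<noteq> zero_hom M NN"
      proof
        assume "?h = zero_hom M NN"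
        from fun_cong[OF this, of y] show False using y by simp
      qed
      then show ?thesis
        using False eq arrow_M_NN[OF h] by simp
    qed
  qed
  have "ebas (ext_complex ?X ?Y g) \<approx> (\<lambda>\<gamma>. if g \<in> E0 then ebas (ext_complex ?X ?Y g) \<gamma> else 0)"
    if g: "g \<in> homs A ?MN N" for g
  proof (cases "g \<in> E0")
    case True
    then show ?thesis
      using arrow_E0[OF True] aH bH cong_refl by auto
  next
    case False
    note gm = homs_mhom[OF g]
    have gE: "g \<in> ext_maps A ?X ?Y" using g E by simp
    obtain x0 where x0: "x0 \<in> carrier N" "g (\<zero>\<^bsub>M\<^esub>, x0) \<noteq> \<zero>\<^bsub>N\<^esub>"
      using False g by (auto simp: E0_def)
    obtain c where c: "c \<in> carrier K" "c \<noteq> \<zero>\<^bsub>K\<^esub>" "\<And>x. x \<in> carrier N \<Longrightarrow> g (\<zero>\<^bsub>M\<^esub>, x) = scal N c x"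
      using end_N_scal[OF mhom_compose[OF inj2_mhom[OF lM] gm] x0] by metis
    define g1 where "g1 y = g (y, \<zero>\<^bsub>N\<^esub>)" for y
    have g1: "g1 \<in> mhom A M N"
      unfolding g1_def by (rule mhom_compose[OF inj1_mhom[OF lN] gm])
    note g1c = mhom_closed[OF g1]
    have g_eq: "g (y, x) = g1 y \<oplus>\<^bsub>N\<^esub> scal N c x" if "y \<in> carrier M" "x \<in> carrier N" for y x
      using homs_direct_sum_split[OF lM lN gm that] c that by (simp add: g1_def)
    let ?c' = "inv\<^bsub>K\<^esub> c"
    have c': "?c' \<in> carrier K" by (rule scal_inverse(3)[OF lN c(1,2) N.M.zero_closed])
    \<comment> \<open>The solution t of g(y, t) = g1 y + c t = b. The differential then sends
      \<theta>(y, a, b) to (b, 0, 0), so the entries a and b form a K_N.\<close>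
    let ?t = "\<lambda>z. scal N ?c' (snd (snd z) \<oplus>\<^bsub>N\<^esub> (\<ominus>\<^bsub>N\<^esub> g1 (fst z)))"
    have D: "left_module A (direct_sum M NN)" by (rule left_module_direct_sum[OF lM lNN])
    have t: "?t \<in> mhom A (direct_sum M NN) N"
      by (intro mhom_compose[OF _ scal_mhom[OF lN c']] mhom_add_map mhom_uminus_map D lN
          mhom_compose[OF snd_mhom snd_mhom] mhom_compose[OF fst_mhom g1])
    let ?\<theta> = "\<lambda>z. (fst (snd z), fst z, ?t z)"
    have \<theta>: "?\<theta> \<in> mhom A (direct_sum M NN) (fst (ext_complex ?X ?Y g))"
      using mhom_closed[OF t] mhom_add[OF t] mhom_smult[OF t] by (intro mhomI) auto
    have st: "scal N c (?t (y, a, b)) = b \<oplus>\<^bsub>N\<^esub> (\<ominus>\<^bsub>N\<^esub> g1 y)" if "y \<in> carrier M" "b \<in> carrier N" for y a b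
      using scal_inverse(2)[OF lN c(1,2)] that g1c by simp
    have "ebas (ext_complex ?X ?Y g) \<in> W"
    proof (rule contractible_summand[OF C1_object_ext_complex[OF oX oY gE] M N KN \<theta>])
      show "bij_betw ?\<theta> (carrier (direct_sum M NN)) (carrier (fst (ext_complex ?X ?Y g)))"
      proof (rule mhom_inj_bij[OF \<theta>])
        show "inj_on ?\<theta> (carrier (direct_sum M NN))"
        proof (rule inj_onI)
          fix z z' assume zz: "z \<in> carrier (direct_sum M NN)" "z' \<in> carrier (direct_sum M NN)"
            and eq: "?\<theta> z = ?\<theta> z'"
          obtain y a b where z: "z = (y, a, b)" "y \<in> carrier M" "a \<in> carrier N" "b \<in> carrier N"
            using zz by auto
          obtain y' a' b' where z': "z' = (y', a', b')" "y' \<in> carrier M" "a' \<in> carrier N" "b' \<in> carrier N"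
            using zz by auto
          have tt: "?t z = ?t z'" and "fst (snd z) = fst (snd z')" "fst z = fst z'"
            using eq unfolding prod.inject by blast+
          then have ya: "a = a'" "y = y'"
            using z z' by simp_all
          from tt have "b \<oplus>\<^bsub>N\<^esub> (\<ominus>\<^bsub>N\<^esub> g1 y) = b' \<oplus>\<^bsub>N\<^esub> (\<ominus>\<^bsub>N\<^esub> g1 y)"
            using st[OF z(2,4), of a] st[OF z'(2,4), of a'] unfolding z(1) z'(1) ya by simp
          then have "b = b'"
            using z z' g1c by simp
          then show "z = z'" using z z' ya by simp
        qed
      qed (use fM fN in auto)
      fix y a b assume yab: "y \<in> carrier M" "a \<in> carrier N" "b \<in> carrier N"
      have tc: "?t (y, a, b) \<in> carrier N"
        using mhom_closed[OF t, of "(y, a, b)"] yab by simp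
      have "g (y, ?t (y, a, b)) = g1 y \<oplus>\<^bsub>N\<^esub> (b \<oplus>\<^bsub>N\<^esub> (\<ominus>\<^bsub>N\<^esub> g1 y))"
        using g_eq[OF yab(1) tc] st[OF yab(1,3)] by simp
      also have "\<dots> = b"
        using yab g1c by (simp add: N.M.a_lcomm[of "g1 y" b] N.M.r_neg)
      finally have "g (y, ?t (y, a, b)) = b" .
      have minus0: "\<ominus>\<^bsub>N\<^esub> \<zero>\<^bsub>N\<^esub> = \<zero>\<^bsub>N\<^esub>"
        by (rule N.M.minus_equality) auto
      have "?t (\<zero>\<^bsub>M\<^esub>, b, \<zero>\<^bsub>N\<^esub>) = \<zero>\<^bsub>N\<^esub>"
        by (simp add: mhom_zero[OF lM lN g1] scal_zero[OF lN c'] minus0)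
      with \<open>g (y, ?t (y, a, b)) = b\<close> show "snd (ext_complex ?X ?Y g) (?\<theta> (y, a, b)) = ?\<theta> (\<zero>\<^bsub>M\<^esub>, b, \<zero>\<^bsub>N\<^esub>)"
        using yab tc by simp
    qed
    then show ?thesis
      using False cong_zero by simp
  qed
  from cong_sum[where f = "\<lambda>g. ebas (ext_complex ?X ?Y g)"
      and g = "\<lambda>g \<gamma>. if g \<in> E0 then ebas (ext_complex ?X ?Y g) \<gamma> else 0", OF fin this]
  have "(\<lambda>\<gamma>. \<Sum>g\<in>homs A ?MN N. ebas (ext_complex ?X ?Y g) \<gamma>) \<approx>
      (\<lambda>\<gamma>. \<Sum>g\<in>homs A ?MN N. if g \<in> E0 then ebas (ext_complex ?X ?Y g) \<gamma> else 0)" by simp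
  also have "(\<lambda>\<gamma>. \<Sum>g\<in>homs A ?MN N. if g \<in> E0 then ebas (ext_complex ?X ?Y g) \<gamma> else 0) =
      (\<lambda>\<gamma>. ?a \<gamma> + (s ^ 2 - 1) * ?b \<gamma>)"
  proof
    fix \<gamma>
    have "(\<Sum>g\<in>homs A ?MN N. if g \<in> E0 then ebas (ext_complex ?X ?Y g) \<gamma> else 0) =
        (\<Sum>g\<in>E0. ebas (ext_complex ?X ?Y g) \<gamma>)"
      using fin E0(2) by (simp add: sum.If_cases Int_absorb1)
    also have "\<dots> = ?a \<gamma> + (of_nat (card E0) - 1) * ?b \<gamma>"
    proof (rule sum_const_except[where F = "\<lambda>g. ebas (ext_complex ?X ?Y g)" and a = ?a and b = ?b, OF E0(1,3)])
      show "ebas (ext_complex ?X ?Y ?z) = ?a"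
        unfolding arrow_E0[OF E0(3)] by (rule if_P[OF refl])
      fix g assume g: "g \<in> E0" and ne: "g \<noteq> ?z"
      show "ebas (ext_complex ?X ?Y g) = ?b"
        unfolding arrow_E0[OF g] by (rule if_not_P[OF ne])
    qed
    finally show "(\<Sum>g\<in>homs A ?MN N. if g \<in> E0 then ebas (ext_complex ?X ?Y g) \<gamma> else 0) =
        ?a \<gamma> + (s ^ 2 - 1) * ?b \<gamma>"
      by (simp add: card_E0 power2_eq_square s_square)
  qed
  finally have sum: "(\<lambda>\<gamma>. \<Sum>g\<in>ext_maps A ?X ?Y. ebas (ext_complex ?X ?Y g) \<gamma>) \<approx>
      (\<lambda>\<gamma>. ?a \<gamma> + (s ^ 2 - 1) * ?b \<gamma>)"
    unfolding E .
  have "complex_of_real (hall_factor ?X ?Y) = inverse (s ^ 5)"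
  proof -
    have "hall_factor ?X ?Y = 1 / (twisting_parameter K * (real (card (carrier K)) * real (card (carrier K))))"
      by (simp add: hall_factor_def card_homs_direct_sum_left[OF lM lN lN] twisting_parameter_def
        card_homs_direct_sum_right[OF lM lN lN] hom_MN hom_NM end_N)
    moreover have "s ^ 5 = s * (of_nat (card (carrier K)) * of_nat (card (carrier K)))"
      unfolding s_power_4[symmetric] by (simp add: eval_nat_numeral)
    ultimately show ?thesis
      by (simp add: s_def inverse_eq_divide)
  qed
  then show ?thesis
    using cong_scale[OF sum, of "complex_of_real (hall_factor ?X ?Y)"] unfolding ebas_mult[OF oX oY] by simp
qed

section \<open>The two Serre relations in the Hall algebra, modulo the ideal\<close>

abbreviation "eM \<equiv> ebas (C_complex M)"
abbreviation "eN \<equiv> ebas (C_complex N)"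

lemma eM_H: "eM \<in> carrier H" and eN_H: "eN \<in> carrier H"
  by (intro ebas_H C1_object_C M N)+

lemma card_hom_sums:
  "card (homs A MM N) = card (carrier K) * card (carrier K)" "card (homs A N MM) = 1"
  "card (homs A M NN) = card (carrier K) * card (carrier K)" "card (homs A NN M) = 1"
  by (simp_all add: card_homs_direct_sum_left[OF lM lM lN] card_homs_direct_sum_right[OF lM lM lN]
    card_homs_direct_sum_left[OF lN lN lM] card_homs_direct_sum_right[OF lN lN lM] hom_MN hom_NM)

text \<open>Two factors M and one factor N. The outer products start from the square of M, which
  leaves a single product of M^2 with N. In the middle product the differential f arises when M
  meets N, and the last factor only adds a second M.\<close>

lemma serre_relation_1:
  "(\<lambda>\<gamma>. (eN \<otimes>\<^bsub>H\<^esub> (eM \<otimes>\<^bsub>H\<^esub> eM)) \<gamma> - (s + inverse s) * ((eM \<otimes>\<^bsub>H\<^esub> eN) \<otimes>\<^bsub>H\<^esub> eM) \<gamma> +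
    ((eM \<otimes>\<^bsub>H\<^esub> eM) \<otimes>\<^bsub>H\<^esub> eN) \<gamma>) \<approx> (\<lambda>\<gamma>. 0)"
proof -
  let ?eMM = "ebas (C_complex MM)"
  let ?a = "ebas (arrow MM N (zero_hom MM N))" and ?b = "ebas (arrow MM N f2)"
  have sq: "eM \<otimes>\<^bsub>H\<^esub> eM \<approx> (\<lambda>\<gamma>. inverse (s ^ 3) * ?eMM \<gamma>)"
    by (rule ebas_square[OF M KM end_M])
  have eMM_H: "?eMM \<in> carrier H"
    by (intro ebas_H C1_object_C MM)
  have x: "eN \<otimes>\<^bsub>H\<^esub> (eM \<otimes>\<^bsub>H\<^esub> eM) \<approx> (\<lambda>\<gamma>. inverse (s ^ 5) * ?a \<gamma>)"
  proof -
    \<comment> \<open>Hom(N, M^2) = 0, so no differential arises; the constant is the inverse of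
      |Hom(M^2, N)|^(1/2) = q = v^2.\<close>
    have "eN \<otimes>\<^bsub>H\<^esub> ?eMM = (\<lambda>\<gamma>. inverse (s ^ 2) * ?a \<gamma>)"
      using ebas_mult_C_trivial[OF N MM card_hom_sums(2)] ebas_arrow_zero(3)[OF N MM]
      by (simp add: card_hom_sums power2_eq_square s_square inverse_eq_divide)
    then show ?thesis
      using cong_mult[OF cong_refl[OF eN_H] sq] unfolding H_mult_scale(2)[OF eMM_H eN_H]
      by (simp add: inverse_s_mult)
  qed
  have z: "(eM \<otimes>\<^bsub>H\<^esub> eM) \<otimes>\<^bsub>H\<^esub> eN \<approx> (\<lambda>\<gamma>. inverse (s ^ 7) * (?a \<gamma> + (s ^ 4 - 1) * ?b \<gamma>))"
  proof -
    \<comment> \<open>In this order the twist is 1, and |Hom(M^2, N)| = q^2 = v^4 is both the number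
      of maps and the inverse of the constant.\<close>
    have "(\<Sum>h\<in>homs A MM N. ebas (arrow MM N h) \<gamma>) = ?a \<gamma> + (of_nat (card (homs A MM N)) - 1) * ?b \<gamma>" for \<gamma>
      using fM fN by (intro sum_const_except[where z = "zero_hom MM N"] finite_homs zero_hom_homs lMM lN
        arrow_MM_N) auto
    then have "?eMM \<otimes>\<^bsub>H\<^esub> eN = (\<lambda>\<gamma>. inverse (s ^ 4) * (?a \<gamma> + (s ^ 4 - 1) * ?b \<gamma>))"
      unfolding ebas_mult_C[OF MM N] by (simp add: card_hom_sums s_power_4 inverse_eq_divide)
    then show ?thesis
      using cong_mult[OF sq cong_refl[OF eN_H]] unfolding H_mult_scale(1)[OF eMM_H eN_H]
      by (simp add: inverse_s_mult)
  qed
  let ?e0 = "ebas (arrow M N (zero_hom M N))" and ?e1 = "ebas (arrow M N f)"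
  have eH: "?e0 \<in> carrier H" "?e1 \<in> carrier H"
    by (intro ebas_H C1_object_arrow M N zero_hom_homs lM lN f_homs)+
  \<comment> \<open>Rescaling N by c turns f into h, so all q - 1 nonzero maps give the same
    class.\<close>
  have f1h: "h \<in> homs A M N \<Longrightarrow> h \<noteq> zero_hom M N \<Longrightarrow> ebas (arrow M N h) = ?e1" for h
  proof -
    assume h: "h \<in> homs A M N" "h \<noteq> zero_hom M N"
    obtain c where c: "c \<in> carrier K" "\<And>x. x \<in> carrier M \<Longrightarrow> h x = scal N c (f x)"
      using hom_MN_scal[OF homs_mhom[OF h(1)]] by metis
    have "c \<noteq> \<zero>\<^bsub>K\<^esub>"
    proof
      assume "c = \<zero>\<^bsub>K\<^esub>"
      then have "h = zero_hom M N"
        using c f_closed lN by (intro homs_eqI[OF h(1) zero_hom_homs[OF lM lN]]) (simp add: scal_zero_left)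
      then show False using h(2) by simp
    qed
    then have "bij_betw (scal N c) (carrier N) (carrier N)"
      using fN by (intro mhom_inj_bij[OF scal_mhom[OF lN c(1)] scal_inj_on[OF lN c(1)]]) auto
    then have "cpx_iso (arrow M N f) (arrow M N h)"
      using arrow_iso[OF M N M N f_homs h(1) mhom_id[of A M] _ scal_mhom[OF lN c(1)]] c(2)
      by (auto simp: bij_betw_def)
    then show ?thesis using ebas_iso by metis
  qed
  have MN: "eM \<otimes>\<^bsub>H\<^esub> eN = (\<lambda>\<gamma>. inverse (s ^ 2) * ?e0 \<gamma> + inverse (s ^ 2) * (s ^ 2 - 1) * ?e1 \<gamma>)"
  proof -
    have sum: "(\<Sum>h\<in>homs A M N. ebas (arrow M N h) \<gamma>) = ?e0 \<gamma> + (of_nat (card (homs A M N)) - 1) * ?e1 \<gamma>" for \<gamma>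
      using f1h by (intro sum_const_except[where z = "zero_hom M N"] finite_homs zero_hom_homs lM lN fM fN) auto
    show ?thesis
      unfolding ebas_mult_C[OF M N] sum
      by (simp add: hom_MN hom_NM power2_eq_square s_square divide_inverse algebra_simps)
  qed
  have "(\<lambda>z\<in>carrier MM. zero_hom M N (snd z)) = zero_hom MM N"
    by auto
  then have y0: "?e0 \<otimes>\<^bsub>H\<^esub> eM \<approx> (\<lambda>\<gamma>. inverse (s ^ 4) * ?a \<gamma>)"
    using ext_arrow_M[OF zero_hom_homs[OF lM lN]] by simp
  have y1: "?e1 \<otimes>\<^bsub>H\<^esub> eM \<approx> (\<lambda>\<gamma>. inverse (s ^ 4) * ?b \<gamma>)"
    using ext_arrow_M[OF f_homs] by (simp add: f2_def)
  have y: "(eM \<otimes>\<^bsub>H\<^esub> eN) \<otimes>\<^bsub>H\<^esub> eM \<approx> (\<lambda>\<gamma>. inverse (s ^ 6) * (?a \<gamma> + (s ^ 2 - 1) * ?b \<gamma>))"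
  proof -
    have "inverse (s ^ 2) * (inverse (s ^ 4) * u) + inverse (s ^ 2) * (s ^ 2 - 1) * (inverse (s ^ 4) * w) =
        inverse (s ^ 6) * (u + (s ^ 2 - 1) * w)" for u w
      by (simp add: eval_nat_numeral algebra_simps)
    then show ?thesis
      unfolding MN H_mult_linear(1)[OF eH eM_H]
      using cong_add[OF cong_scale[OF y0, of "inverse (s ^ 2)"] cong_scale[OF y1, of "inverse (s ^ 2) * (s ^ 2 - 1)"]]
      by (simp only:)
  qed
  show ?thesis
    by (rule serre_combine(1)[OF x y z])
qed

text \<open>Two factors N and one factor M. As Hom(N, M) = 0, the product of N with M has no
  differential, and f enters only with the last factor, through \<open>ext_arrow_N\<close>. The
  product without b now ends in M, so the outer terms change places.\<close>

lemma serre_relation_2: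
  "(\<lambda>\<gamma>. (eM \<otimes>\<^bsub>H\<^esub> (eN \<otimes>\<^bsub>H\<^esub> eN)) \<gamma> - (s + inverse s) * ((eN \<otimes>\<^bsub>H\<^esub> eM) \<otimes>\<^bsub>H\<^esub> eN) \<gamma> +
    ((eN \<otimes>\<^bsub>H\<^esub> eN) \<otimes>\<^bsub>H\<^esub> eM) \<gamma>) \<approx> (\<lambda>\<gamma>. 0)"
proof -
  let ?eNN = "ebas (C_complex NN)"
  let ?a = "ebas (arrow M NN (zero_hom M NN))" and ?b = "ebas (arrow M NN f1)"
  have sq: "eN \<otimes>\<^bsub>H\<^esub> eN \<approx> (\<lambda>\<gamma>. inverse (s ^ 3) * ?eNN \<gamma>)"
    by (rule ebas_square[OF N KN end_N])
  have eNN_H: "?eNN \<in> carrier H"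
    by (intro ebas_H C1_object_C NN)
  have x: "(eN \<otimes>\<^bsub>H\<^esub> eN) \<otimes>\<^bsub>H\<^esub> eM \<approx> (\<lambda>\<gamma>. inverse (s ^ 5) * ?a \<gamma>)"
  proof -
    have "?eNN \<otimes>\<^bsub>H\<^esub> eM = (\<lambda>\<gamma>. inverse (s ^ 2) * ?a \<gamma>)"
      using ebas_mult_C_trivial[OF NN M card_hom_sums(4)] ebas_arrow_zero(3)[OF NN M]
      by (simp add: card_hom_sums power2_eq_square s_square inverse_eq_divide)
    then show ?thesis
      using cong_mult[OF sq cong_refl[OF eM_H]] unfolding H_mult_scale(1)[OF eNN_H eM_H]
      by (simp add: inverse_s_mult)
  qed
  have z: "eM \<otimes>\<^bsub>H\<^esub> (eN \<otimes>\<^bsub>H\<^esub> eN) \<approx> (\<lambda>\<gamma>. inverse (s ^ 7) * (?a \<gamma> + (s ^ 4 - 1) * ?b \<gamma>))"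
  proof -
    have "(\<Sum>h\<in>homs A M NN. ebas (arrow M NN h) \<gamma>) = ?a \<gamma> + (of_nat (card (homs A M NN)) - 1) * ?b \<gamma>" for \<gamma>
      using fM fN by (intro sum_const_except[where z = "zero_hom M NN"] finite_homs zero_hom_homs lNN lM
        arrow_M_NN) auto
    then have "eM \<otimes>\<^bsub>H\<^esub> ?eNN = (\<lambda>\<gamma>. inverse (s ^ 4) * (?a \<gamma> + (s ^ 4 - 1) * ?b \<gamma>))"
      unfolding ebas_mult_C[OF M NN] by (simp add: card_hom_sums s_power_4 inverse_eq_divide)
    then show ?thesis
      using cong_mult[OF cong_refl[OF eM_H] sq] unfolding H_mult_scale(2)[OF eNN_H eM_H]
      by (simp add: inverse_s_mult)
  qed
  let ?e0 = "ebas (arrow N M (zero_hom N M))"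
  have e0_H: "?e0 \<in> carrier H"
    by (intro ebas_H C1_object_arrow M N zero_hom_homs lM lN)
  have NM: "eN \<otimes>\<^bsub>H\<^esub> eM = (\<lambda>\<gamma>. inverse s * ?e0 \<gamma>)"
    using ebas_mult_C_trivial[OF N M hom_NM]
    by (simp add: hom_MN s_def twisting_parameter_def inverse_eq_divide)
  have y: "(eN \<otimes>\<^bsub>H\<^esub> eM) \<otimes>\<^bsub>H\<^esub> eN \<approx> (\<lambda>\<gamma>. inverse (s ^ 6) * (?a \<gamma> + (s ^ 2 - 1) * ?b \<gamma>))"
  proof -
    show ?thesis
      unfolding NM H_mult_scale(1)[OF e0_H eN_H]
      using cong_scale[OF ext_arrow_N, of "inverse s"] by (simp only: inverse_s_mult)
  qed
  show ?thesis
    by (rule serre_combine(2)[OF x y z])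
qed

end

section \<open>Paths in Dynkin quivers\<close>

text \<open>Every vertex of a Dynkin diagram is joined to at most one vertex of smaller number. So an arrow
  is determined by its end point of larger number, which is the whole reason why directed paths
  are unique: a path first descends and then ascends, and both parts are deterministic.\<close>

locale ranked_digraph = wf_digraph Q for Q :: "('v, 'e) pre_digraph" +
  fixes \<rho> :: "'v \<Rightarrow> nat"
  assumes rank_neq: "e \<in> arcs Q \<Longrightarrow> \<rho> (tail Q e) \<noteq> \<rho> (head Q e)"
    and inj_top: "inj_on (\<lambda>e. if \<rho> (tail Q e) < \<rho> (head Q e) then head Q e else tail Q e) (arcs Q)"
begin

definition up where "up e \<longleftrightarrow> \<rho> (tail Q e) < \<rho> (head Q e)"

lemma not_up: "e \<in> arcs Q \<Longrightarrow> \<not> up e \<Longrightarrow> \<rho> (head Q e) < \<rho> (tail Q e)"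
  using rank_neq[of e] by (auto simp: up_def)

text \<open>If e' went down, the vertex between e and e' would be the larger end of both, forcing e
  = e'. So a walk that has gone up keeps going up.\<close>

lemma up_down: "e \<in> arcs Q \<Longrightarrow> e' \<in> arcs Q \<Longrightarrow> up e \<Longrightarrow> head Q e = tail Q e' \<Longrightarrow> up e'"
  using inj_onD[OF inj_top, of e e'] by (cases "up e'") (auto simp: up_def)

lemma down_unique:
  "e \<in> arcs Q \<Longrightarrow> e' \<in> arcs Q \<Longrightarrow> \<not> up e \<Longrightarrow> \<not> up e' \<Longrightarrow> tail Q e = tail Q e' \<Longrightarrow> e = e'"
  using inj_onD[OF inj_top, of e e'] by (auto simp: up_def)

lemma up_unique:
  "e \<in> arcs Q \<Longrightarrow> e' \<in> arcs Q \<Longrightarrow> up e \<Longrightarrow> up e' \<Longrightarrow> head Q e = head Q e' \<Longrightarrow> e = e'"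
  using inj_onD[OF inj_top, of e e'] by (auto simp: up_def)

text \<open>By \<open>up_down\<close> every later arrow goes up as well, and the rank grows along
  the walk.\<close>

lemma awalk_up_first:
  "awalk u (e # p) w \<Longrightarrow> up e \<Longrightarrow> up (last (e # p)) \<and> \<rho> u < \<rho> w"
proof (induction p arbitrary: u e)
  case Nil
  then show ?case by (auto simp: awalk_simps up_def)
next
  case (Cons e' p)
  then have e: "e \<in> arcs Q" "u = tail Q e" "awalk (head Q e) (e' # p) w"
    by (auto simp: awalk_Cons_iff)
  then have "up e'"
    using Cons.prems(2) up_down by (auto simp: awalk_Cons_iff)
  with Cons.IH[OF e(3)] show ?case
    using e(2) Cons.prems(2) by (auto simp: up_def)
qed

text \<open>A walk that ends downwards cannot have gone up before, so the rank falls along the whole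
  walk.\<close>

lemma awalk_down_last:
  "awalk u (e # p) w \<Longrightarrow> \<not> up (last (e # p)) \<Longrightarrow> \<rho> w < \<rho> u"
proof (induction p arbitrary: u e)
  case Nil
  then show ?case using not_up by (auto simp: awalk_simps)
next
  case (Cons e' p)
  then have e: "e \<in> arcs Q" "u = tail Q e" "awalk (head Q e) (e' # p) w"
    by (auto simp: awalk_Cons_iff)
  have "\<not> up e"
    using awalk_up_first[OF Cons.prems(1)] Cons.prems(2) by blast
  then have "\<rho> (head Q e) < \<rho> u"
    using not_up e by simp
  moreover have "\<rho> w < \<rho> (head Q e)"
    using Cons.IH[OF e(3)] Cons.prems(2) by simp
  ultimately show ?case by simp
qed

lemma awalk_last:
  assumes "awalk u p w" "p \<noteq> []"
  shows "last p \<in> arcs Q" "head Q (last p) = w" "awalk u (butlast p) (tail Q (last p))"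
proof -
  have "awalk u (butlast p @ [last p]) w"
    using assms by simp
  then show "last p \<in> arcs Q" "head Q (last p) = w" "awalk u (butlast p) (tail Q (last p))"
    unfolding awalk_append_iff by (auto simp: awalk_simps)
qed

text \<open>A nonempty closed walk can neither start upwards nor end downwards, since either would
  change the rank. So its last arrow goes up into u and its first one goes down from u, which
  \<open>up_down\<close> forbids.\<close>

lemma closed_awalk:
  assumes "awalk u p u"
  shows "p = []"
proof (cases p)
  case (Cons e p')
  have w: "awalk u (e # p') u" using assms Cons by simp
  have d: "\<not> up e"
    using awalk_up_first[OF w] by blast
  have l: "up (last p)"
    using awalk_down_last[OF w] unfolding Cons by blast
  have "last p \<in> arcs Q" "head Q (last p) = u" "e \<in> arcs Q" "tail Q e = u"
    using awalk_last[OF assms] w Cons by (auto simp: awalk_Cons_iff)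
  then show ?thesis
    using up_down d l by metis
qed simp

lemma awalk_unique:
  "awalk u p w \<Longrightarrow> awalk u p' w \<Longrightarrow> p = p'"
proof (induction "length p + length p'" arbitrary: u p p' w rule: less_induct)
  case less
  show ?case
  proof (cases "p = [] \<or> p' = []")
    case True
    then have "u = w" using less.prems by (auto simp: awalk_Nil_iff)
    then show ?thesis using closed_awalk less.prems by auto
  next
    case False
    then obtain e r e' r' where p: "p = e # r" "p' = e' # r'"
      by (meson neq_Nil_conv)
    have e: "e \<in> arcs Q" "e' \<in> arcs Q" "tail Q e = u" "tail Q e' = u"
        "awalk (head Q e) r w" "awalk (head Q e') r' w"
      using less.prems by (auto simp: p awalk_Cons_iff)
    have l: "last p \<in> arcs Q" "last p' \<in> arcs Q" "head Q (last p) = w" "head Q (last p') = w"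
        "awalk u (butlast p) (tail Q (last p))" "awalk u (butlast p') (tail Q (last p'))"
      using awalk_last less.prems False by blast+
    \<comment> \<open>If one walk starts upwards, then \<rho> u < \<rho> w, so both walks end
      upwards and share the last arrow. Otherwise both start downwards and share the first arrow.
      Removing the shared arrow gives the induction.\<close>
    consider "\<not> up e" "\<not> up e'" | "up (last p)" "up (last p')"
      using awalk_up_first[OF less.prems(1)[unfolded p]] awalk_up_first[OF less.prems(2)[unfolded p]]
        awalk_down_last[OF less.prems(1)[unfolded p]] awalk_down_last[OF less.prems(2)[unfolded p]]
      unfolding p by fastforce
    then show ?thesis
    proof cases
      case 1
      then have "e = e'" using down_unique e by metis
      moreover have "r = r'"
        using less.hyps[of r r' "head Q e" w] e \<open>e = e'\<close> by (simp add: p)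
      ultimately show ?thesis by (simp add: p)
    next
      case 2
      then have eq: "last p = last p'" using up_unique l by metis
      moreover have "butlast p = butlast p'"
        using less.hyps[of "butlast p" "butlast p'" u "tail Q (last p)"] l eq False
        by (simp add: p)
      ultimately show ?thesis
        using False by (metis append_butlast_last_id)
    qed
  qed
qed

end

section \<open>The numbering of the Dynkin diagrams\<close>

lemma dynkin_diagram_edge:
  assumes "dynkin_diagram n E" "s \<in> E"
  obtains a b where "s = {a, b}" "1 \<le> a" "a < b" "b \<le> n"
proof -
  have A: "\<exists>a b. s = {a, b} \<and> 1 \<le> a \<and> a < b \<and> b \<le> m" if "s \<in> dynkin_A m" for m
    using that unfolding dynkin_A_def by auto
  consider "s \<in> dynkin_A n" | "s \<in> dynkin_A (n - 1)" | "s = {n - 2, n}" "4 \<le> n" | "s = {3, n}" "6 \<le> n"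
    using assms by (auto simp: dynkin_diagram_def dynkin_D_def dynkin_E_def)
  then have "\<exists>a b. s = {a, b} \<and> 1 \<le> a \<and> a < b \<and> b \<le> n"
  proof cases
    case 1 then show ?thesis by (rule A)
  next
    case 2
    from A[OF this] show ?thesis by fastforce
  next
    case 3
    then show ?thesis by (intro exI[of _ "n - 2"] exI[of _ n]) auto
  next
    case 4
    then show ?thesis by (intro exI[of _ 3] exI[of _ n]) auto
  qed
  then show ?thesis using that by blast
qed

text \<open>The lower neighbour of b is b - 1, except for b = n in the branched types, where it is n
  - 2 for D and 3 for E.\<close>

lemma dynkin_diagram_lower_neighbour:
  assumes "dynkin_diagram n E" "{a, b} \<in> E" "{a', b} \<in> E" "a < b" "a' < b"
  shows "a = a'"
proof -
  have A: "a = b - 1 \<and> b \<le> m" if "{a, b} \<in> dynkin_A m" "a < b" for a b m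
    using that by (auto simp: dynkin_A_def doubleton_eq_iff)
  have D: "a = (if b = n then n - 2 else b - 1)" if "{a, b} \<in> dynkin_D n" "4 \<le> n" "a < b" for a
    using that A[of a b "n - 1"] by (auto simp: dynkin_D_def doubleton_eq_iff)
  have E: "a = (if b = n then 3 else b - 1)" if "{a, b} \<in> dynkin_E n" "6 \<le> n" "a < b" for a
    using that A[of a b "n - 1"] by (auto simp: dynkin_E_def doubleton_eq_iff)
  consider "E = dynkin_A n" | "E = dynkin_D n" "4 \<le> n" | "E = dynkin_E n" "6 \<le> n"
    using assms(1) by (auto simp: dynkin_diagram_def)
  then show ?thesis
    by cases (use assms A[of a b n] A[of a' b n] D[of a] D[of a'] E[of a] E[of a'] in auto)
qed

text \<open>Vertices are ranked by their number in the diagram. The larger end of an arrow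
  determines its edge by the preceding lemma, and distinct arrows lie on distinct edges.\<close>

lemma dynkin_quiver_ranked:
  assumes "dynkin_quiver Q"
  shows "\<exists>\<rho>. ranked_digraph Q \<rho>"
proof -
  obtain n E f where fin: "fin_digraph Q" and inj: "inj_on (\<lambda>e. {tail Q e, head Q e}) (arcs Q)"
    and E: "dynkin_diagram n E" and f: "bij_betw f {1..n} (verts Q)"
    and im: "(\<lambda>e. {tail Q e, head Q e}) ` arcs Q = (\<lambda>s. f ` s) ` E"
    using assms by (auto simp: dynkin_quiver_def)
  interpret fin_digraph Q by fact
  define \<rho> where "\<rho> = inv_into {1..n} f"
  have \<rho>f: "\<rho> (f a) = a" if "1 \<le> a" "a \<le> n" for a
    using f that by (simp add: \<rho>_def bij_betw_def)
  let ?top = "\<lambda>e. if \<rho> (tail Q e) < \<rho> (head Q e) then head Q e else tail Q e"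
  have arc: "\<exists>a b. {a, b} \<in> E \<and> 1 \<le> a \<and> a < b \<and> b \<le> n \<and> {tail Q e, head Q e} = {f a, f b} \<and>
      ?top e = f b \<and> \<rho> (tail Q e) \<noteq> \<rho> (head Q e)" if e: "e \<in> arcs Q" for e
  proof -
    obtain s where s: "s \<in> E" "{tail Q e, head Q e} = f ` s"
      using im e by (metis (no_types, lifting) imageE imageI)
    obtain a b where ab: "s = {a, b}" "1 \<le> a" "a < b" "b \<le> n"
      using dynkin_diagram_edge[OF E s(1)] by metis
    have ends: "{tail Q e, head Q e} = {f a, f b}" using s ab by simp
    then consider "tail Q e = f a" "head Q e = f b" | "tail Q e = f b" "head Q e = f a"
      by (auto simp: doubleton_eq_iff)
    then show ?thesis
      using s(1) ab ends \<rho>f[of a] \<rho>f[of b]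
      by cases (intro exI[of _ a] exI[of _ b], simp)+
  qed
  have "inj_on ?top (arcs Q)"
  proof (rule inj_onI)
    fix e e' assume e: "e \<in> arcs Q" "e' \<in> arcs Q" and eq: "?top e = ?top e'"
    obtain a b where ab: "{a, b} \<in> E" "1 \<le> a" "a < b" "b \<le> n" "{tail Q e, head Q e} = {f a, f b}" "?top e = f b"
      using arc[OF e(1)] by blast
    obtain a' b' where ab': "{a', b'} \<in> E" "1 \<le> a'" "a' < b'" "b' \<le> n" "{tail Q e', head Q e'} = {f a', f b'}"
        "?top e' = f b'"
      using arc[OF e(2)] by blast
    have "f b = f b'" using eq ab(6) ab'(6) by simp
    moreover have "1 \<le> b" "1 \<le> b'" using ab(2,3) ab'(2,3) by simp_all
    ultimately have "b = b'" using \<rho>f[of b] \<rho>f[of b'] ab(4) ab'(4) by metis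
    moreover have "a = a'"
      using dynkin_diagram_lower_neighbour[OF E ab(1) _ ab(3)] ab'(1,3) unfolding \<open>b = b'\<close> by blast
    ultimately have "{tail Q e, head Q e} = {tail Q e', head Q e'}" using ab(5) ab'(5) by simp
    then show "e = e'" using inj_onD[OF inj _ e] by simp
  qed
  moreover have "\<rho> (tail Q e) \<noteq> \<rho> (head Q e)" if "e \<in> arcs Q" for e
    using arc[OF that] by blast
  ultimately have "ranked_digraph Q \<rho>"
    by unfold_locales auto
  then show ?thesis by blast
qed

section \<open>The path algebra of a Dynkin quiver\<close>

text \<open>The contribution of the Dynkin condition is uniqueness of paths between two vertices.
  That the path algebra is a ring is assumed here; the theorem extracts it from the module structure
  of a projective cover.\<close>

locale path_alg = field K for K :: "'k ring" +
  fixes Q :: "('v, 'e) pre_digraph"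
  assumes finite_field: "finite (carrier K)" and fin_Q: "fin_digraph Q"
    and paths_unique: "pre_digraph.awalk Q u p w \<Longrightarrow> pre_digraph.awalk Q u p' w \<Longrightarrow> p = p'"
    and ring_path_algebra: "ring (path_algebra K Q)"
begin

sublocale Q: fin_digraph Q by (rule fin_Q)

abbreviation A where "A \<equiv> path_algebra K Q"

sublocale A: ring A by (rule ring_path_algebra)

lemma paths_iff: "(u, p, w) \<in> paths Q \<longleftrightarrow> Q.awalk u p w"
  by (simp add: paths_def)

text \<open>A path is determined by its two ends.\<close>

lemma finite_paths: "finite (paths Q)"
proof -
  have "inj_on (\<lambda>(u, p, w). (u, w)) (paths Q)"
    by (auto simp: inj_on_def paths_iff intro: paths_unique)
  moreover have "(\<lambda>(u, p, w). (u, w)) ` paths Q \<subseteq> verts Q \<times> verts Q"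
    by (auto simp: paths_iff dest: Q.awalk_hd_in_verts Q.awalk_last_in_verts)
  ultimately show ?thesis
    by (meson Q.finite_verts finite_SigmaI inj_on_finite)
qed

lemma carrier_A: "a \<in> carrier A \<longleftrightarrow> (\<forall>r. a r \<in> carrier K) \<and> (\<forall>r. r \<notin> paths Q \<longrightarrow> a r = \<zero>\<^bsub>K\<^esub>)"
proof -
  have "finite {r. a r \<noteq> \<zero>\<^bsub>K\<^esub>}" if "{r. a r \<noteq> \<zero>\<^bsub>K\<^esub>} \<subseteq> paths Q"
    using that finite_paths by (rule finite_subset)
  moreover have "{r. a r \<noteq> \<zero>\<^bsub>K\<^esub>} \<subseteq> paths Q \<longleftrightarrow> (\<forall>r. r \<notin> paths Q \<longrightarrow> a r = \<zero>\<^bsub>K\<^esub>)"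
    by blast
  moreover have "a \<in> carrier A \<longleftrightarrow>
      (\<forall>r. a r \<in> carrier K) \<and> finite {r. a r \<noteq> \<zero>\<^bsub>K\<^esub>} \<and> {r. a r \<noteq> \<zero>\<^bsub>K\<^esub>} \<subseteq> paths Q"
    by (simp only: path_algebra_def partial_object.simps mem_Collect_eq)
  ultimately show ?thesis by blast
qed

lemma A_coeff: "a \<in> carrier A \<Longrightarrow> a r \<in> carrier K"
  unfolding carrier_A by blast

lemma A_simps: "a \<oplus>\<^bsub>A\<^esub> b = (\<lambda>r. a r \<oplus>\<^bsub>K\<^esub> b r)" "\<zero>\<^bsub>A\<^esub> = (\<lambda>r. \<zero>\<^bsub>K\<^esub>)"
  "c \<odot>\<^bsub>A\<^esub> a = (\<lambda>r. c \<otimes>\<^bsub>K\<^esub> a r)"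
  by (simp_all add: path_algebra_def)

lemma finite_carrier_A: "finite (carrier A)"
proof (rule finite_subset)
  let ?g = "\<lambda>f r. if r \<in> paths Q then f r else \<zero>\<^bsub>K\<^esub>"
  show "finite (?g ` (paths Q \<rightarrow>\<^sub>E carrier K))"
    using finite_paths finite_field by (intro finite_imageI finite_PiE)
  show "carrier A \<subseteq> ?g ` (paths Q \<rightarrow>\<^sub>E carrier K)"
  proof
    fix a assume a: "a \<in> carrier A"
    then have "a = ?g (restrict a (paths Q))" by (auto simp: carrier_A)
    moreover have "restrict a (paths Q) \<in> paths Q \<rightarrow>\<^sub>E carrier K" using a by (auto simp: carrier_A)
    ultimately show "a \<in> ?g ` (paths Q \<rightarrow>\<^sub>E carrier K)" by (rule image_eqI)
  qed
qed

text \<open>The combination of trivial paths with coefficients d. Scalars, the unit and the vertex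
  idempotents have this form, so one multiplication rule covers them all.\<close>

definition diag :: "('v \<Rightarrow> 'k) \<Rightarrow> ('v, 'e) qpath \<Rightarrow> 'k" where
  "diag d = (\<lambda>(u, p, w). if p = [] \<and> u = w \<and> u \<in> verts Q then d u else \<zero>\<^bsub>K\<^esub>)"

lemma diag_closed: "(\<And>u. d u \<in> carrier K) \<Longrightarrow> diag d \<in> carrier A"
  by (auto simp: carrier_A diag_def paths_iff Q.awalk_Nil_iff)

lemma finite_factorizations: "finite (path_factorizations Q r)"
  by (rule finite_subset[of _ "paths Q \<times> paths Q"])
    (auto simp: path_factorizations_def finite_paths)

lemma factorizations_not_path:
  assumes "r \<notin> paths Q"
  shows "path_factorizations Q r = {}"
  using assms by (auto simp: path_factorizations_def paths_iff)

lemma A_mult: "(a \<otimes>\<^bsub>A\<^esub> b) r = (\<Oplus>\<^bsub>K\<^esub>pq\<in>path_factorizations Q r. a (fst pq) \<otimes>\<^bsub>K\<^esub> b (snd pq))"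
  by (simp add: path_algebra_def)

text \<open>Only one factorization of the path contributes: the one whose trivial factor sits at the
  source, respectively at the target.\<close>

lemma mult_diag:
  assumes a: "a \<in> carrier A" and d: "\<And>u. d u \<in> carrier K"
  shows "(a \<otimes>\<^bsub>A\<^esub> diag d) (u, p, w) = a (u, p, w) \<otimes>\<^bsub>K\<^esub> d u"
    "(diag d \<otimes>\<^bsub>A\<^esub> a) (u, p, w) = d w \<otimes>\<^bsub>K\<^esub> a (u, p, w)"
proof -
  have c: "diag d r \<in> carrier K" "a r \<in> carrier K" for r
    using diag_closed[OF d] a by (auto simp: A_coeff)
  let ?F = "path_factorizations Q (u, p, w)"
  have *: "(a \<otimes>\<^bsub>A\<^esub> diag d) (u, p, w) = a (u, p, w) \<otimes>\<^bsub>K\<^esub> d u \<and>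
      (diag d \<otimes>\<^bsub>A\<^esub> a) (u, p, w) = d w \<otimes>\<^bsub>K\<^esub> a (u, p, w)"
  proof (cases "(u, p, w) \<in> paths Q")
    case False
    then have "?F = {}" "a (u, p, w) = \<zero>\<^bsub>K\<^esub>"
      using a by (auto simp: factorizations_not_path carrier_A)
    then show ?thesis
      using d by (simp add: A_mult)
  next
    case True
    then have uw: "u \<in> verts Q" "w \<in> verts Q" "Q.awalk u p w"
      by (auto simp: paths_iff dest: Q.awalk_hd_in_verts Q.awalk_last_in_verts)
    let ?x = "((u, p, w), (u, [], u))" and ?y = "((w, [], w), (u, p, w))"
    have mem: "?x \<in> ?F" "?y \<in> ?F"
      using uw by (auto simp: path_factorizations_def paths_iff Q.awalk_Nil_iff)
    have "(a \<otimes>\<^bsub>A\<^esub> diag d) (u, p, w) =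
        (\<Oplus>\<^bsub>K\<^esub>z\<in>?F. if ?x = z then a (fst z) \<otimes>\<^bsub>K\<^esub> diag d (snd z) else \<zero>\<^bsub>K\<^esub>)"
      unfolding A_mult using c
      by (intro finsum_cong') (auto simp: path_factorizations_def diag_def split: if_splits)
    also have "\<dots> = a (u, p, w) \<otimes>\<^bsub>K\<^esub> diag d (u, [], u)"
      using add.finprod_singleton[OF mem(1) finite_factorizations, of "\<lambda>z. a (fst z) \<otimes>\<^bsub>K\<^esub> diag d (snd z)"] c
      by auto
    finally have 1: "(a \<otimes>\<^bsub>A\<^esub> diag d) (u, p, w) = a (u, p, w) \<otimes>\<^bsub>K\<^esub> d u"
      using uw by (simp add: diag_def)
    have "(diag d \<otimes>\<^bsub>A\<^esub> a) (u, p, w) =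
        (\<Oplus>\<^bsub>K\<^esub>z\<in>?F. if ?y = z then diag d (fst z) \<otimes>\<^bsub>K\<^esub> a (snd z) else \<zero>\<^bsub>K\<^esub>)"
      unfolding A_mult using c
      by (intro finsum_cong') (auto simp: path_factorizations_def diag_def split: if_splits)
    also have "\<dots> = diag d (w, [], w) \<otimes>\<^bsub>K\<^esub> a (u, p, w)"
      using add.finprod_singleton[OF mem(2) finite_factorizations, of "\<lambda>z. diag d (fst z) \<otimes>\<^bsub>K\<^esub> a (snd z)"] c
      by auto
    finally show ?thesis
      using uw 1 by (simp add: diag_def)
  qed
  then show "(a \<otimes>\<^bsub>A\<^esub> diag d) (u, p, w) = a (u, p, w) \<otimes>\<^bsub>K\<^esub> d u"
    "(diag d \<otimes>\<^bsub>A\<^esub> a) (u, p, w) = d w \<otimes>\<^bsub>K\<^esub> a (u, p, w)" by simp_all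
qed

lemma scalar_diag: "c \<in> carrier K \<Longrightarrow> c \<odot>\<^bsub>A\<^esub> \<one>\<^bsub>A\<^esub> = diag (\<lambda>_. c)"
  by (auto simp: path_algebra_def diag_def fun_eq_iff)

lemma diag_mult_diag:
  assumes "\<And>u. d u \<in> carrier K" "\<And>u. d' u \<in> carrier K"
  shows "diag d \<otimes>\<^bsub>A\<^esub> diag d' = diag (\<lambda>u. d u \<otimes>\<^bsub>K\<^esub> d' u)"
proof
  fix r :: "('v, 'e) qpath"
  obtain u p w where r: "r = (u, p, w)" by (cases r)
  show "(diag d \<otimes>\<^bsub>A\<^esub> diag d') r = diag (\<lambda>u. d u \<otimes>\<^bsub>K\<^esub> d' u) r"
    unfolding r mult_diag(1)[OF diag_closed[OF assms(1)] assms(2)]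
    using assms by (cases "p = [] \<and> u = w \<and> u \<in> verts Q") (auto simp: diag_def)
qed

lemma finite_algebra: "finite_algebra K A"
proof
  fix c assume c: "c \<in> carrier K"
  show "c \<odot>\<^bsub>A\<^esub> \<one>\<^bsub>A\<^esub> \<in> carrier A"
    using c by (simp add: scalar_diag diag_closed)
  fix d assume d: "d \<in> carrier K"
  show "(c \<oplus>\<^bsub>K\<^esub> d) \<odot>\<^bsub>A\<^esub> \<one>\<^bsub>A\<^esub> = c \<odot>\<^bsub>A\<^esub> \<one>\<^bsub>A\<^esub> \<oplus>\<^bsub>A\<^esub> d \<odot>\<^bsub>A\<^esub> \<one>\<^bsub>A\<^esub>"
    using c d by (auto simp: scalar_diag A_simps(1) diag_def fun_eq_iff)
  show "(c \<otimes>\<^bsub>K\<^esub> d) \<odot>\<^bsub>A\<^esub> \<one>\<^bsub>A\<^esub> = (c \<odot>\<^bsub>A\<^esub> \<one>\<^bsub>A\<^esub>) \<otimes>\<^bsub>A\<^esub> (d \<odot>\<^bsub>A\<^esub> \<one>\<^bsub>A\<^esub>)"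
    using c d by (simp add: scalar_diag diag_mult_diag)
next
  fix c a assume c: "c \<in> carrier K" and a: "a \<in> carrier A"
  show "(c \<odot>\<^bsub>A\<^esub> \<one>\<^bsub>A\<^esub>) \<otimes>\<^bsub>A\<^esub> a = a \<otimes>\<^bsub>A\<^esub> (c \<odot>\<^bsub>A\<^esub> \<one>\<^bsub>A\<^esub>)"
    using c a by (auto simp: scalar_diag mult_diag fun_eq_iff A_coeff m_comm)
next
  show "\<one>\<^bsub>K\<^esub> \<odot>\<^bsub>A\<^esub> \<one>\<^bsub>A\<^esub> = \<one>\<^bsub>A\<^esub>"
    by (auto simp: path_algebra_def)
qed (fact field_axioms finite_field ring_path_algebra finite_carrier_A)+

sublocale FA: finite_algebra K A by (rule finite_algebra)

section \<open>Vertex idempotents, projective covers and the homomorphisms between them\<close>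

definition idem :: "'v \<Rightarrow> ('v, 'e) qpath \<Rightarrow> 'k" where
  "idem i = diag (\<lambda>u. if u = i then \<one>\<^bsub>K\<^esub> else \<zero>\<^bsub>K\<^esub>)"

lemma idem_closed: "idem i \<in> carrier A"
  unfolding idem_def by (intro diag_closed) auto

lemma idem_mult:
  assumes "a \<in> carrier A"
  shows "(a \<otimes>\<^bsub>A\<^esub> idem i) (u, p, w) = (if u = i then a (u, p, w) else \<zero>\<^bsub>K\<^esub>)"
    "(idem i \<otimes>\<^bsub>A\<^esub> a) (u, p, w) = (if w = i then a (u, p, w) else \<zero>\<^bsub>K\<^esub>)"
  unfolding idem_def using assms by (subst mult_diag; simp add: A_coeff)+

lemma idem_idem: "idem i \<otimes>\<^bsub>A\<^esub> idem i = idem i"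
proof -
  have "(\<lambda>u. (if u = i then \<one>\<^bsub>K\<^esub> else \<zero>\<^bsub>K\<^esub>) \<otimes>\<^bsub>K\<^esub> (if u = i then \<one>\<^bsub>K\<^esub> else \<zero>\<^bsub>K\<^esub>)) =
      (\<lambda>u. if u = i then \<one>\<^bsub>K\<^esub> else \<zero>\<^bsub>K\<^esub>)"
    by auto
  then show ?thesis
    by (simp add: idem_def diag_mult_diag)
qed

text \<open>As there is only one path from \<open>i\<close> to \<open>i\<close>, the corner algebra at \<open>i\<close> is the ground field.\<close>

lemma corner:
  assumes b: "b \<in> carrier A" "idem i \<otimes>\<^bsub>A\<^esub> b = b" "b \<otimes>\<^bsub>A\<^esub> idem i = b" and i: "i \<in> verts Q"
    and 1: "b (i, [], i) = \<one>\<^bsub>K\<^esub>"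
  shows "b = idem i"
proof
  fix r :: "('v, 'e) qpath"
  obtain u p w where r: "r = (u, p, w)" by (cases r)
  show "b r = idem i r"
  proof (cases "r \<in> paths Q \<and> u = i \<and> w = i")
    case True
    then have "p = []"
      using paths_unique[of i p i "[]"] i by (auto simp: r paths_iff Q.awalk_Nil_iff)
    then show ?thesis using True 1 i by (simp add: r idem_def diag_def)
  next
    case False
    have "b r = \<zero>\<^bsub>K\<^esub>" if "r \<notin> paths Q"
      using b(1) that unfolding carrier_A by blast
    moreover have "b r = \<zero>\<^bsub>K\<^esub>" if "u \<noteq> i"
      using idem_mult(1)[OF b(1), of i u p w] b(3) that by (simp add: r)
    moreover have "b r = \<zero>\<^bsub>K\<^esub>" if "w \<noteq> i"
      using idem_mult(2)[OF b(1), of i u p w] b(2) that by (simp add: r)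
    ultimately have "b r = \<zero>\<^bsub>K\<^esub>"
      using False by blast
    moreover have "idem i r = \<zero>\<^bsub>K\<^esub>"
      using False i by (auto simp: r idem_def diag_def paths_iff Q.awalk_Nil_iff)
    ultimately show ?thesis by simp
  qed
qed

definition regular :: "(('v, 'e) qpath \<Rightarrow> 'k, ('v, 'e) qpath \<Rightarrow> 'k) module" where
  "regular = \<lparr>carrier = carrier A, mult = mult A, one = one A, zero = zero A, add = add A, smult = mult A\<rparr>"

lemma left_module_regular: "left_module A regular"
proof -
  have "abelian_group regular"
  proof (rule abelian_groupI)
    fix a assume "a \<in> carrier regular"
    then show "\<exists>b\<in>carrier regular. b \<oplus>\<^bsub>regular\<^esub> a = \<zero>\<^bsub>regular\<^esub>"
      by (intro bexI[of _ "\<ominus>\<^bsub>A\<^esub> a"]) (auto simp: regular_def A.l_neg)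
  qed (auto simp: regular_def A.a_ac)
  moreover have "left_module_axioms A regular"
    by unfold_locales (auto simp: regular_def A.l_distr A.r_distr A.m_assoc)
  ultimately show ?thesis
    by (intro left_module.intro ring_path_algebra)
qed

text \<open>A projective cover of the simple module at \<open>i\<close> is isomorphic to \<open>A e\<^sub>i\<close>, with \<open>x\<close> corresponding
  to \<open>e\<^sub>i\<close>.\<close>

lemma projective_cover_generator:
  fixes P :: "(('v, 'e) qpath \<Rightarrow> 'k, 'p) module"
  assumes cov: "projective_cover K A P (simple_module K i)" and i: "i \<in> verts Q"
  obtains x where "x \<in> carrier P" "idem i \<odot>\<^bsub>P\<^esub> x = x"
    "\<And>p. p \<in> carrier P \<Longrightarrow> \<exists>a\<in>carrier A. p = a \<odot>\<^bsub>P\<^esub> x"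
    "\<And>a. a \<in> carrier A \<Longrightarrow> a \<otimes>\<^bsub>A\<^esub> idem i = a \<Longrightarrow> a \<odot>\<^bsub>P\<^esub> x = \<zero>\<^bsub>P\<^esub> \<Longrightarrow> a = \<zero>\<^bsub>A\<^esub>"
    "\<And>(M :: (('v, 'e) qpath \<Rightarrow> 'k, 'p) module) m. left_module A M \<Longrightarrow> m \<in> carrier M \<Longrightarrow>
      idem i \<odot>\<^bsub>M\<^esub> m = m \<Longrightarrow> \<exists>\<phi>\<in>mhom A P M. \<phi> x = m"
proof -
  let ?S = "simple_module K i :: (('v, 'e) qpath \<Rightarrow> 'k, 'k) module"
  have proj: "projective K A P" using cov by (simp add: projective_cover_def)
  note lP = FA.projectiveD[OF proj]
  interpret P: left_module A P by (rule lP)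
  obtain \<pi> where \<pi>: "\<pi> \<in> mhom A P ?S" "\<pi> ` carrier P = carrier ?S"
    and ess: "\<forall>N. left_submodule A N P \<and> N <+>\<^bsub>P\<^esub> a_kernel P ?S \<pi> = carrier P \<longrightarrow> N = carrier P"
    using cov unfolding projective_cover_def by blast
  have S: "carrier ?S = carrier K" "\<zero>\<^bsub>?S\<^esub> = \<zero>\<^bsub>K\<^esub>" "\<And>a y. a \<odot>\<^bsub>?S\<^esub> y = a (i, [], i) \<otimes>\<^bsub>K\<^esub> y"
    "\<And>y z. y \<oplus>\<^bsub>?S\<^esub> z = y \<oplus>\<^bsub>K\<^esub> z"
    by (simp_all add: simple_module_def)
  have \<pi>c: "\<pi> y \<in> carrier K" if "y \<in> carrier P" for y
    using mhom_closed[OF \<pi>(1) that] by (simp add: S)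
  have \<pi>s: "\<pi> (a \<odot>\<^bsub>P\<^esub> y) = a (i, [], i) \<otimes>\<^bsub>K\<^esub> \<pi> y" if "a \<in> carrier A" "y \<in> carrier P" for a y
    using mhom_smult[OF \<pi>(1) that] by (simp add: S)
  have \<pi>a: "\<pi> (y \<oplus>\<^bsub>P\<^esub> z) = \<pi> y \<oplus>\<^bsub>K\<^esub> \<pi> z" if "y \<in> carrier P" "z \<in> carrier P" for y z
    using mhom_add[OF \<pi>(1) that] by (simp add: S)
  have e: "idem i \<in> carrier A" by (rule idem_closed)
  have e1: "idem i (i, [], i) = \<one>\<^bsub>K\<^esub>" using i by (simp add: idem_def diag_def)
  obtain y where y: "y \<in> carrier P" "\<pi> y = \<one>\<^bsub>K\<^esub>"
    using \<pi>(2) S(1) one_closed by (metis imageE)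
  \<comment> \<open>Multiplication by e_i keeps the image 1 under \<pi> and makes x invariant under
    e_i.\<close>
  define x where "x = idem i \<odot>\<^bsub>P\<^esub> y"
  have x: "x \<in> carrier P" using e y by (simp add: x_def P.smult_closed)
  have ex: "idem i \<odot>\<^bsub>P\<^esub> x = x"
    using e y by (simp add: x_def idem_idem flip: P.smult_assoc)
  have \<pi>x: "\<pi> x = \<one>\<^bsub>K\<^esub>"
    using \<pi>s[OF e y(1)] by (simp add: x_def e1 y(2))
  let ?N = "(\<lambda>a. a \<odot>\<^bsub>P\<^esub> x) ` carrier A"
  have N: "left_submodule A ?N P"
    unfolding left_submodule_def
  proof (intro conjI ballI)
    show "?N \<subseteq> carrier P" using x by (auto simp: P.smult_closed)
    show "\<zero>\<^bsub>P\<^esub> \<in> ?N" using x P.smult_zero_left[OF x] by (intro image_eqI[of _ _ "\<zero>\<^bsub>A\<^esub>"]) auto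
    fix p assume "p \<in> ?N"
    then obtain a where a: "a \<in> carrier A" "p = a \<odot>\<^bsub>P\<^esub> x" by blast
    show "p \<oplus>\<^bsub>P\<^esub> p' \<in> ?N" if p': "p' \<in> ?N" for p'
    proof -
      obtain a' where "a' \<in> carrier A" "p' = a' \<odot>\<^bsub>P\<^esub> x" using p' by blast
      then show ?thesis
        using a x by (intro image_eqI[of _ _ "a \<oplus>\<^bsub>A\<^esub> a'"]) (auto simp: P.smult_l_distr)
    qed
  next
    fix b p assume b: "b \<in> carrier A" and "p \<in> ?N"
    then obtain a where "a \<in> carrier A" "p = a \<odot>\<^bsub>P\<^esub> x" by blast
    then show "b \<odot>\<^bsub>P\<^esub> p \<in> ?N"
      using b x by (intro image_eqI[of _ _ "b \<otimes>\<^bsub>A\<^esub> a"]) (auto simp: P.smult_assoc)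
  qed
  \<comment> \<open>The simple module is one-dimensional and \<pi> x = 1, so A x and the kernel of
    \<pi> add up to P. The covering property then gives A x = P.\<close>
  have "?N <+>\<^bsub>P\<^esub> a_kernel P ?S \<pi> = carrier P"
  proof (intro equalityI subsetI)
    fix p assume "p \<in> ?N <+>\<^bsub>P\<^esub> a_kernel P ?S \<pi>"
    then show "p \<in> carrier P"
      using N by (auto simp: set_add_def' a_kernel_eq left_submodule_def)
  next
    fix p assume p: "p \<in> carrier P"
    let ?c = "diag (\<lambda>_. \<pi> p)"
    let ?z = "?c \<odot>\<^bsub>P\<^esub> x"
    have c: "?c \<in> carrier A" using \<pi>c[OF p] by (intro diag_closed)
    have z: "?z \<in> carrier P" using c x by (rule P.smult_closed)
    have "\<pi> ?z = \<pi> p"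
      using \<pi>s[OF c x] \<pi>x \<pi>c[OF p] i by (simp add: diag_def)
    have d: "p \<ominus>\<^bsub>P\<^esub> ?z \<in> carrier P" using p z by simp
    have "\<pi> (p \<ominus>\<^bsub>P\<^esub> ?z) \<oplus>\<^bsub>K\<^esub> \<pi> ?z = \<pi> p"
      using \<pi>a[OF d z] P.M.minus_add_cancel[OF p z] by simp
    then have "\<pi> (p \<ominus>\<^bsub>P\<^esub> ?z) = \<zero>\<^bsub>K\<^esub>"
      unfolding \<open>\<pi> ?z = \<pi> p\<close> using \<pi>c[OF p] \<pi>c[OF d] by simp
    then have "p \<ominus>\<^bsub>P\<^esub> ?z \<in> a_kernel P ?S \<pi>"
      using d by (simp add: a_kernel_eq S)
    moreover have "p = ?z \<oplus>\<^bsub>P\<^esub> (p \<ominus>\<^bsub>P\<^esub> ?z)"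
      using P.M.minus_add_cancel[OF p z] d z by (simp add: P.M.a_comm)
    ultimately show "p \<in> ?N <+>\<^bsub>P\<^esub> a_kernel P ?S \<pi>"
      using c unfolding set_add_def' by blast
  qed
  with N ess have gen: "?N = carrier P" by blast
  have g: "(\<lambda>a. a \<odot>\<^bsub>P\<^esub> x) \<in> mhom A regular P"
    using x by (intro mhomI) (auto simp: regular_def P.smult_closed P.smult_l_distr P.smult_assoc)
  have gs: "(\<lambda>a. a \<odot>\<^bsub>P\<^esub> x) ` carrier regular = carrier P"
    using gen by (simp add: regular_def)
  have fr: "finite (carrier regular)"
    using finite_carrier_A by (simp add: regular_def)
  obtain s where s: "s \<in> mhom A P regular" "\<And>p. p \<in> carrier P \<Longrightarrow> s p \<odot>\<^bsub>P\<^esub> x = p"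
    using FA.projective_split[OF proj left_module_regular fr g gs] by metis
  have sc: "s p \<in> carrier A" if "p \<in> carrier P" for p
    using mhom_closed[OF s(1) that] by (simp add: regular_def)
  have ss: "s (a \<odot>\<^bsub>P\<^esub> p) = a \<otimes>\<^bsub>A\<^esub> s p" if "a \<in> carrier A" "p \<in> carrier P" for a p
    using mhom_smult[OF s(1) that] by (simp add: regular_def)
  have sa: "s (p \<oplus>\<^bsub>P\<^esub> p') = s p \<oplus>\<^bsub>A\<^esub> s p'" if "p \<in> carrier P" "p' \<in> carrier P" for p p'
    using mhom_add[OF s(1) that] by (simp add: regular_def)
  have s0: "s \<zero>\<^bsub>P\<^esub> = \<zero>\<^bsub>A\<^esub>"
    using mhom_zero[OF lP(1) left_module_regular s(1)] by (simp add: regular_def)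
  have t: "s x \<in> carrier A" "s x \<odot>\<^bsub>P\<^esub> x = x" "idem i \<otimes>\<^bsub>A\<^esub> s x = s x"
    using sc[OF x] s(2)[OF x] ss[OF e x] by (simp_all add: ex)
  \<comment> \<open>s(x) e_i lies in e_i A e_i, which consists of the multiples of e_i. Its
    coefficient is 1 because it fixes x and \<pi> x = 1.\<close>
  have te: "s x \<otimes>\<^bsub>A\<^esub> idem i = idem i"
  proof (rule corner)
    have b: "s x \<otimes>\<^bsub>A\<^esub> idem i \<in> carrier A" using t e by simp
    then show "s x \<otimes>\<^bsub>A\<^esub> idem i \<in> carrier A" .
    show "idem i \<otimes>\<^bsub>A\<^esub> (s x \<otimes>\<^bsub>A\<^esub> idem i) = s x \<otimes>\<^bsub>A\<^esub> idem i"
      using t e by (simp flip: A.m_assoc)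
    show "s x \<otimes>\<^bsub>A\<^esub> idem i \<otimes>\<^bsub>A\<^esub> idem i = s x \<otimes>\<^bsub>A\<^esub> idem i"
      using t e by (simp add: A.m_assoc idem_idem)
    have "\<pi> ((s x \<otimes>\<^bsub>A\<^esub> idem i) \<odot>\<^bsub>P\<^esub> x) = \<pi> x"
      using t e x ex by (simp add: P.smult_assoc)
    then show "(s x \<otimes>\<^bsub>A\<^esub> idem i) (i, [], i) = \<one>\<^bsub>K\<^esub>"
      using \<pi>s[OF b x] \<pi>x A_coeff[OF b] by simp
  qed (rule i)
  show ?thesis
  proof
    show "x \<in> carrier P" "idem i \<odot>\<^bsub>P\<^esub> x = x" by (fact x ex)+
    show "\<exists>a\<in>carrier A. p = a \<odot>\<^bsub>P\<^esub> x" if "p \<in> carrier P" for p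
      using that gen by blast
    \<comment> \<open>Applying s to a x = 0 gives a s(x) = 0; multiplication by e_i on the right
      turns this into a e_i = 0.\<close>
    show "a = \<zero>\<^bsub>A\<^esub>" if a: "a \<in> carrier A" "a \<otimes>\<^bsub>A\<^esub> idem i = a" "a \<odot>\<^bsub>P\<^esub> x = \<zero>\<^bsub>P\<^esub>" for a
    proof -
      have "a \<otimes>\<^bsub>A\<^esub> s x = \<zero>\<^bsub>A\<^esub>"
        using ss[OF a(1) x] a(3) s0 by simp
      then have "a \<otimes>\<^bsub>A\<^esub> (s x \<otimes>\<^bsub>A\<^esub> idem i) = \<zero>\<^bsub>A\<^esub>"
        using a(1) t(1) e by (simp flip: A.m_assoc)
      then show ?thesis using te a(2) by simp
    qed
    show "\<exists>\<phi>\<in>mhom A P M. \<phi> x = m"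
      if M: "left_module A M" and m: "m \<in> carrier M" "idem i \<odot>\<^bsub>M\<^esub> m = m"
      for M :: "(('v, 'e) qpath \<Rightarrow> 'k, 'p) module" and m
    proof -
      interpret M: left_module A M by fact
      show ?thesis
      proof (rule bexI)
        \<comment> \<open>This map sends x to s(x) m = s(x) e_i m = e_i m = m.\<close>
        show "(\<lambda>p. s p \<odot>\<^bsub>M\<^esub> m) \<in> mhom A P M"
          using m by (intro mhomI) (auto simp: sc ss sa M.smult_closed M.smult_l_distr M.smult_assoc)
        show "s x \<odot>\<^bsub>M\<^esub> m = m"
          using M.smult_assoc[OF t(1) e m(1)] te m by simp
      qed
    qed
  qed
qed

text \<open>Evaluation at the generator x identifies Hom(P, P') with e_i P', and multiplication onto
  x' identifies e_i A e_j with e_i P'. The elements of e_i A e_j are the multiples of the unique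
  path from j to i, if there is one, and otherwise only 0.\<close>

lemma card_homs_projective_cover:
  fixes P P' :: "(('v, 'e) qpath \<Rightarrow> 'k, 'p) module"
  assumes cov: "projective_cover K A P (simple_module K i)" and i: "i \<in> verts Q"
    and cov': "projective_cover K A P' (simple_module K j)" and j: "j \<in> verts Q"
  shows "card (homs A P P') = (if \<exists>p. Q.awalk j p i then card (carrier K) else 1)"
proof -
  have lP: "left_module A P" and lP': "left_module A P'"
    using cov cov' FA.projectiveD(1) by (auto simp: projective_cover_def)
  interpret P: left_module A P by (rule lP)
  interpret P': left_module A P' by (rule lP')
  have e: "idem i \<in> carrier A" "idem j \<in> carrier A" by (rule idem_closed)+
  obtain x where x: "x \<in> carrier P" "idem i \<odot>\<^bsub>P\<^esub> x = x"
      "\<And>p. p \<in> carrier P \<Longrightarrow> \<exists>a\<in>carrier A. p = a \<odot>\<^bsub>P\<^esub> x"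
      "\<And>m. m \<in> carrier P' \<Longrightarrow> idem i \<odot>\<^bsub>P'\<^esub> m = m \<Longrightarrow> \<exists>\<phi>\<in>mhom A P P'. \<phi> x = m"
    using projective_cover_generator[OF cov i] lP' by metis
  obtain x' where x': "x' \<in> carrier P'" "idem j \<odot>\<^bsub>P'\<^esub> x' = x'"
      "\<And>p. p \<in> carrier P' \<Longrightarrow> \<exists>a\<in>carrier A. p = a \<odot>\<^bsub>P'\<^esub> x'"
      "\<And>a. a \<in> carrier A \<Longrightarrow> a \<otimes>\<^bsub>A\<^esub> idem j = a \<Longrightarrow> a \<odot>\<^bsub>P'\<^esub> x' = \<zero>\<^bsub>P'\<^esub> \<Longrightarrow> a = \<zero>\<^bsub>A\<^esub>"
    using projective_cover_generator[OF cov' j] by metis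
  let ?M = "{m \<in> carrier P'. idem i \<odot>\<^bsub>P'\<^esub> m = m}"
  let ?B = "{a \<in> carrier A. idem i \<otimes>\<^bsub>A\<^esub> a = a \<and> a \<otimes>\<^bsub>A\<^esub> idem j = a}"
  have "bij_betw (\<lambda>\<phi>. \<phi> x) (homs A P P') ?M"
  proof (rule bij_betw_imageI)
    show "inj_on (\<lambda>\<phi>. \<phi> x) (homs A P P')"
    proof (rule inj_onI)
      fix \<phi> \<psi> assume h: "\<phi> \<in> homs A P P'" "\<psi> \<in> homs A P P'" and eq: "\<phi> x = \<psi> x"
      show "\<phi> = \<psi>"
      proof (rule homs_eqI[OF h])
        fix p assume "p \<in> carrier P"
        then obtain a where "a \<in> carrier A" "p = a \<odot>\<^bsub>P\<^esub> x" using x(3) by blast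
        then show "\<phi> p = \<psi> p"
          using mhom_smult[OF homs_mhom[OF h(1)]] mhom_smult[OF homs_mhom[OF h(2)]] x(1) eq by simp
      qed
    qed
    show "(\<lambda>\<phi>. \<phi> x) ` homs A P P' = ?M"
    proof (intro equalityI subsetI)
      fix m assume "m \<in> (\<lambda>\<phi>. \<phi> x) ` homs A P P'"
      then obtain \<phi> where "\<phi> \<in> homs A P P'" and m: "m = \<phi> x" by blast
      then have "\<phi> \<in> mhom A P P'" by (simp add: homs_mhom)
      then show "m \<in> ?M"
        using x(1,2) e mhom_smult[of \<phi> A P P' "idem i" x] mhom_closed[of \<phi> A P P' x] by (simp add: m)
    next
      fix m assume "m \<in> ?M"
      then obtain \<phi> where "\<phi> \<in> mhom A P P'" "\<phi> x = m" using x(4) by blast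
      then show "m \<in> (\<lambda>\<phi>. \<phi> x) ` homs A P P'"
        using x(1) homs_restrict[OF lP] by (intro image_eqI[of _ _ "restrict \<phi> (carrier P)"]) auto
    qed
  qed
  then have c1: "card (homs A P P') = card ?M" by (rule bij_betw_same_card)
  have "bij_betw (\<lambda>a. a \<odot>\<^bsub>P'\<^esub> x') ?B ?M"
  proof (rule bij_betw_imageI)
    show "inj_on (\<lambda>a. a \<odot>\<^bsub>P'\<^esub> x') ?B"
    proof (rule inj_onI)
      fix a b assume a: "a \<in> ?B" and b: "b \<in> ?B" and eq: "a \<odot>\<^bsub>P'\<^esub> x' = b \<odot>\<^bsub>P'\<^esub> x'"
      have "(a \<ominus>\<^bsub>A\<^esub> b) \<odot>\<^bsub>P'\<^esub> x' = \<zero>\<^bsub>P'\<^esub>"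
        using a b x'(1) eq
        by (simp add: a_minus_def P'.smult_l_distr P'.smult_minus_left P'.smult_closed P'.M.r_neg)
      moreover have "(a \<ominus>\<^bsub>A\<^esub> b) \<otimes>\<^bsub>A\<^esub> idem j = a \<ominus>\<^bsub>A\<^esub> b"
        using a b e by (simp add: a_minus_def A.l_distr A.l_minus)
      ultimately have "a \<ominus>\<^bsub>A\<^esub> b = \<zero>\<^bsub>A\<^esub>"
        using a b by (intro x'(4)) auto
      then show "a = b"
        using A.minus_add_cancel[of a b] a b by simp
    qed
    show "(\<lambda>a. a \<odot>\<^bsub>P'\<^esub> x') ` ?B = ?M"
    proof (intro equalityI subsetI)
      fix m assume "m \<in> (\<lambda>a. a \<odot>\<^bsub>P'\<^esub> x') ` ?B"
      then show "m \<in> ?M"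
        using x'(1) e by (auto simp: P'.smult_closed simp flip: P'.smult_assoc)
    next
      fix m assume m: "m \<in> ?M"
      then obtain a where a: "a \<in> carrier A" "m = a \<odot>\<^bsub>P'\<^esub> x'" using x'(3) by blast
      \<comment> \<open>Cutting a down to e_i A e_j does not change its product with x', because e_j
        x' = x' and e_i m = m.\<close>
      let ?b = "idem i \<otimes>\<^bsub>A\<^esub> a \<otimes>\<^bsub>A\<^esub> idem j"
      have "idem i \<otimes>\<^bsub>A\<^esub> ?b = (idem i \<otimes>\<^bsub>A\<^esub> idem i) \<otimes>\<^bsub>A\<^esub> a \<otimes>\<^bsub>A\<^esub> idem j"
        "?b \<otimes>\<^bsub>A\<^esub> idem j = idem i \<otimes>\<^bsub>A\<^esub> a \<otimes>\<^bsub>A\<^esub> (idem j \<otimes>\<^bsub>A\<^esub> idem j)"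
        using a e by (simp_all add: A.m_assoc)
      then have "?b \<in> ?B"
        using a e by (simp add: idem_idem)
      moreover have "?b \<odot>\<^bsub>P'\<^esub> x' = m"
        using a e x' m by (simp add: P'.smult_assoc P'.smult_closed)
      ultimately show "m \<in> (\<lambda>a. a \<odot>\<^bsub>P'\<^esub> x') ` ?B" by blast
    qed
  qed
  then have c2: "card ?B = card ?M" by (rule bij_betw_same_card)
  have B: "a \<in> ?B \<longleftrightarrow> a \<in> carrier A \<and> (\<forall>u p w. u \<noteq> j \<or> w \<noteq> i \<longrightarrow> a (u, p, w) = \<zero>\<^bsub>K\<^esub>)" for a
  proof (cases "a \<in> carrier A")
    case True
    have "idem i \<otimes>\<^bsub>A\<^esub> a = a \<longleftrightarrow> (\<forall>u p w. w \<noteq> i \<longrightarrow> a (u, p, w) = \<zero>\<^bsub>K\<^esub>)"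
      "a \<otimes>\<^bsub>A\<^esub> idem j = a \<longleftrightarrow> (\<forall>u p w. u \<noteq> j \<longrightarrow> a (u, p, w) = \<zero>\<^bsub>K\<^esub>)"
      by (auto simp: fun_eq_iff idem_mult[OF True])
    then show ?thesis using True by auto
  qed simp
  show ?thesis
  proof (cases "\<exists>p. Q.awalk j p i")
    case True
    then obtain p where p: "Q.awalk j p i" by blast
    have supp: "a (u, q, w) = \<zero>\<^bsub>K\<^esub>" if "a \<in> ?B" "(u, q, w) \<noteq> (j, p, i)" for a u q w
    proof (cases "u = j \<and> w = i")
      case True
      then have "\<not> Q.awalk j q i" using that(2) paths_unique[OF p] by auto
      then show ?thesis using that(1) True by (auto simp: B carrier_A paths_iff)
    next
      case False
      then show ?thesis using that(1) unfolding B by blast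
    qed
    have "bij_betw (\<lambda>a. a (j, p, i)) ?B (carrier K)"
    proof (rule bij_betw_imageI)
      show "inj_on (\<lambda>a. a (j, p, i)) ?B"
      proof (rule inj_onI)
        fix a b assume ab: "a \<in> ?B" "b \<in> ?B" and eq: "a (j, p, i) = b (j, p, i)"
        show "a = b"
        proof
          fix r :: "('v, 'e) qpath"
          obtain u q w where r: "r = (u, q, w)" by (cases r)
          show "a r = b r"
            using supp[OF ab(1), of u q w] supp[OF ab(2), of u q w] eq unfolding r by metis
        qed
      qed
      show "(\<lambda>a. a (j, p, i)) ` ?B = carrier K"
      proof (intro equalityI subsetI)
        fix c assume c: "c \<in> carrier K"
        let ?a = "\<lambda>r. if r = (j, p, i) then c else \<zero>\<^bsub>K\<^esub>"
        have "?a \<in> ?B"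
          unfolding B using c p by (auto simp: carrier_A paths_iff)
        then show "c \<in> (\<lambda>a. a (j, p, i)) ` ?B"
          by (rule image_eqI[rotated]) simp
      qed (auto simp: A_coeff)
    qed
    then have "card ?B = card (carrier K)" by (rule bij_betw_same_card)
    then show ?thesis
      using True c1 c2 by simp
  next
    case False
    have "?B = {\<zero>\<^bsub>A\<^esub>}"
    proof (intro equalityI subsetI)
      fix a assume a: "a \<in> ?B"
      have "a (u, q, w) = \<zero>\<^bsub>K\<^esub>" for u q w
        using a False unfolding B by (cases "u = j \<and> w = i") (auto simp: carrier_A paths_iff)
      then have "a = (\<lambda>r. \<zero>\<^bsub>K\<^esub>)" by (auto simp: fun_eq_iff)
      then show "a \<in> {\<zero>\<^bsub>A\<^esub>}" by (simp add: A_simps)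
    qed (use e in auto)
    then show ?thesis using False c1 c2 by simp
  qed
qed

end

section \<open>Passage to the reduced Hall algebra, and the theorem\<close>

context hall_quotient
begin

text \<open>Returning from the rescaled basis to the classes [X] multiplies x and y by constants.
  Each term has degree one in x and two in y, so all three acquire the same factor \<alpha>
  \<beta>^2.\<close>

lemma serre_quotient:
  fixes c \<alpha> \<beta> :: complex
  assumes x: "x \<in> carrier H" and y: "y \<in> carrier H"
    and rel: "(\<lambda>\<gamma>. (x \<otimes>\<^bsub>H\<^esub> (y \<otimes>\<^bsub>H\<^esub> y)) \<gamma> - c * ((y \<otimes>\<^bsub>H\<^esub> x) \<otimes>\<^bsub>H\<^esub> y) \<gamma> +
      ((y \<otimes>\<^bsub>H\<^esub> y) \<otimes>\<^bsub>H\<^esub> x) \<gamma>) \<approx> (\<lambda>\<gamma>. 0)"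
  defines "X \<equiv> Q (\<lambda>\<gamma>. \<alpha> * x \<gamma>)" and "Y \<equiv> Q (\<lambda>\<gamma>. \<beta> * y \<gamma>)"
  shows "X \<otimes>\<^bsub>R\<^esub> (Y \<otimes>\<^bsub>R\<^esub> Y) \<ominus>\<^bsub>R\<^esub> c \<odot>\<^bsub>R\<^esub> (Y \<otimes>\<^bsub>R\<^esub> X \<otimes>\<^bsub>R\<^esub> Y) \<oplus>\<^bsub>R\<^esub> (Y \<otimes>\<^bsub>R\<^esub> Y) \<otimes>\<^bsub>R\<^esub> X = \<zero>\<^bsub>R\<^esub>"
proof -
  note cl = x y H_closed H_mult_closed
  let ?k = "\<alpha> * \<beta> * \<beta>"
  have "X \<otimes>\<^bsub>R\<^esub> (Y \<otimes>\<^bsub>R\<^esub> Y) = Q (\<lambda>\<gamma>. ?k * (x \<otimes>\<^bsub>H\<^esub> (y \<otimes>\<^bsub>H\<^esub> y)) \<gamma>)"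
    unfolding X_def Y_def by (simp add: Q_mult H_mult_scale cl mult.assoc)
  moreover have "c \<odot>\<^bsub>R\<^esub> (Y \<otimes>\<^bsub>R\<^esub> X \<otimes>\<^bsub>R\<^esub> Y) = Q (\<lambda>\<gamma>. ?k * (c * ((y \<otimes>\<^bsub>H\<^esub> x) \<otimes>\<^bsub>H\<^esub> y) \<gamma>))"
    unfolding X_def Y_def by (simp add: Q_mult Q_smult H_mult_scale cl mult_ac)
  moreover have "(Y \<otimes>\<^bsub>R\<^esub> Y) \<otimes>\<^bsub>R\<^esub> X = Q (\<lambda>\<gamma>. ?k * ((y \<otimes>\<^bsub>H\<^esub> y) \<otimes>\<^bsub>H\<^esub> x) \<gamma>)"
    unfolding X_def Y_def by (simp add: Q_mult H_mult_scale cl mult_ac)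
  ultimately have "X \<otimes>\<^bsub>R\<^esub> (Y \<otimes>\<^bsub>R\<^esub> Y) \<ominus>\<^bsub>R\<^esub> c \<odot>\<^bsub>R\<^esub> (Y \<otimes>\<^bsub>R\<^esub> X \<otimes>\<^bsub>R\<^esub> Y) \<oplus>\<^bsub>R\<^esub> (Y \<otimes>\<^bsub>R\<^esub> Y) \<otimes>\<^bsub>R\<^esub> X =
      Q (\<lambda>\<gamma>. ?k * ((x \<otimes>\<^bsub>H\<^esub> (y \<otimes>\<^bsub>H\<^esub> y)) \<gamma> - c * ((y \<otimes>\<^bsub>H\<^esub> x) \<otimes>\<^bsub>H\<^esub> y) \<gamma> + ((y \<otimes>\<^bsub>H\<^esub> y) \<otimes>\<^bsub>H\<^esub> x) \<gamma>))"
    by (simp add: Q_minus Q_add cl algebra_simps)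
  also have "\<dots> = Q (\<lambda>\<gamma>. 0)"
    using Q_eq[OF cong_scale[OF rel, of ?k]] by simp
  finally show ?thesis by (simp add: zero_R)
qed

end

context exceptional_pair
begin

lemma serre_relations:
  defines "m \<equiv> Q (basis_vector K A (C_complex M))" and "n \<equiv> Q (basis_vector K A (C_complex N))"
  shows "n \<otimes>\<^bsub>R\<^esub> (m \<otimes>\<^bsub>R\<^esub> m) \<ominus>\<^bsub>R\<^esub> (s + inverse s) \<odot>\<^bsub>R\<^esub> (m \<otimes>\<^bsub>R\<^esub> n \<otimes>\<^bsub>R\<^esub> m) \<oplus>\<^bsub>R\<^esub> (m \<otimes>\<^bsub>R\<^esub> m) \<otimes>\<^bsub>R\<^esub> n = \<zero>\<^bsub>R\<^esub>"
    "m \<otimes>\<^bsub>R\<^esub> (n \<otimes>\<^bsub>R\<^esub> n) \<ominus>\<^bsub>R\<^esub> (s + inverse s) \<odot>\<^bsub>R\<^esub> (n \<otimes>\<^bsub>R\<^esub> m \<otimes>\<^bsub>R\<^esub> n) \<oplus>\<^bsub>R\<^esub> (n \<otimes>\<^bsub>R\<^esub> n) \<otimes>\<^bsub>R\<^esub> m = \<zero>\<^bsub>R\<^esub>"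
  unfolding m_def n_def basis_vector_ebas[OF C1_object_C[OF M]] basis_vector_ebas[OF C1_object_C[OF N]]
  by (rule serre_quotient[OF eN_H eM_H serre_relation_1] serre_quotient[OF eM_H eN_H serre_relation_2])+

end

theorem proposition7p5:
  fixes K :: "'k ring"
    and Q :: "(nat, 'e) pre_digraph"
    and P :: "nat \<Rightarrow> ((nat, 'e) qpath \<Rightarrow> 'k, 'p) module"
    and n i j :: nat
  assumes "field K" and "finite (carrier K)"
    and "dynkin_quiver Q" and "verts Q = {1..n}"
    and "\<And>l. l \<in> {1..n} \<Longrightarrow> projective_cover K (path_algebra K Q) (P l) (simple_module K l)"
    and "i \<in> {1..n}" and "j \<in> {1..n}" and "i \<noteq> j"
  shows "let A = path_algebra K Q;
             R = reduced_hall_algebra K A n P;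
             C = (\<lambda>l. reduced_class K A n P (C_complex (P l)));
             v = complex_of_real (twisting_parameter K)
         in (path_matrix Q i j = 0 \<longrightarrow> C i \<otimes>\<^bsub>R\<^esub> C j = C j \<otimes>\<^bsub>R\<^esub> C i) \<and>
            (\<bar>path_matrix Q i j\<bar> = 1 \<longrightarrow>
              C i \<otimes>\<^bsub>R\<^esub> (C j \<otimes>\<^bsub>R\<^esub> C j)
                \<ominus>\<^bsub>R\<^esub> (v + inverse v) \<odot>\<^bsub>R\<^esub> (C j \<otimes>\<^bsub>R\<^esub> C i \<otimes>\<^bsub>R\<^esub> C j)
                \<oplus>\<^bsub>R\<^esub> (C j \<otimes>\<^bsub>R\<^esub> C j) \<otimes>\<^bsub>R\<^esub> C i = \<zero>\<^bsub>R\<^esub> \<and>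
              C j \<otimes>\<^bsub>R\<^esub> (C i \<otimes>\<^bsub>R\<^esub> C i)
                \<ominus>\<^bsub>R\<^esub> (v + inverse v) \<odot>\<^bsub>R\<^esub> (C i \<otimes>\<^bsub>R\<^esub> C j \<otimes>\<^bsub>R\<^esub> C i)
                \<oplus>\<^bsub>R\<^esub> (C i \<otimes>\<^bsub>R\<^esub> C i) \<otimes>\<^bsub>R\<^esub> C j = \<zero>\<^bsub>R\<^esub>)"
proof -
  let ?A = "path_algebra K Q"
  note cov = assms(5)
  obtain \<rho> where "ranked_digraph Q \<rho>"
    using dynkin_quiver_ranked[OF assms(3)] by blast
  then interpret rk: ranked_digraph Q \<rho> .
  \<comment> \<open>A left module carries with it that its algebra is a ring, so the given
    projective cover supplies the ring axioms of the path algebra.\<close>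
  have "left_module ?A (P i)"
    using cov[OF assms(6)] by (simp add: projective_cover_def projective_def fd_module_def)
  then have "ring ?A" by (rule left_module.axioms(1))
  moreover have "fin_digraph Q"
    using assms(3) by (simp add: dynkin_quiver_def)
  ultimately interpret pa: path_alg K Q
    using assms(1,2) rk.awalk_unique by (intro path_alg.intro path_alg_axioms.intro) auto
  define W where "W = contractible_ideal K ?A n P"
  have proj: "projective K ?A (P l)" if "l \<in> {1..n}" for l
    using cov[OF that] by (simp add: projective_cover_def)
  have "(\<lambda>l. basis_vector K ?A (K_complex (P l))) ` {1..n} \<subseteq> carrier (twisted_hall_algebra K ?A)"
    using proj pa.FA.basis_vector_H[OF pa.FA.C1_object_K] by blast
  note W = pa.FA.two_sided_ideal_generated[OF this, folded contractible_ideal_def, folded W_def]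
  interpret hq: hall_quotient K ?A W
    by (intro hall_quotient.intro pa.finite_algebra hall_quotient_axioms.intro W(1))
  have KW: "basis_vector K ?A (K_complex (P l)) \<in> W" if "l \<in> {1..n}" for l
    using W(2) that by blast
  have card_homs: "card (homs ?A (P a) (P b)) = (if b \<rightarrow>\<^sup>*\<^bsub>Q\<^esub> a then card (carrier K) else 1)"
    if "a \<in> {1..n}" "b \<in> {1..n}" for a b
    using pa.card_homs_projective_cover[OF cov[OF that(1)] _ cov[OF that(2)]] that
    by (simp add: assms(4) rk.reachable_awalk)
  have refl: "a \<rightarrow>\<^sup>*\<^bsub>Q\<^esub> a" if "a \<in> {1..n}" for a
    using that rk.reachable_refl by (simp add: assms(4))
  \<comment> \<open>Paths in both directions would compose to a closed walk, which is empty.\<close>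
  have antisym: "\<not> b \<rightarrow>\<^sup>*\<^bsub>Q\<^esub> a" if ab: "a \<rightarrow>\<^sup>*\<^bsub>Q\<^esub> b" "a \<noteq> b" for a b
  proof
    assume "b \<rightarrow>\<^sup>*\<^bsub>Q\<^esub> a"
    then obtain p q where pq: "rk.awalk a p b" "rk.awalk b q a"
      using ab(1) by (auto simp: rk.reachable_awalk)
    then have "p @ q = []"
      using rk.closed_awalk[of a "p @ q"] rk.awalk_appendI by blast
    then show False using pq ab(2) by (simp add: rk.awalk_Nil_iff)
  qed
  \<comment> \<open>A path from a to b makes Hom(P b, P a) a line and Hom(P a, P b) zero, so P b
    plays the part of M and P a that of N.\<close>
  have pair: "exceptional_pair K ?A W (P b) (P a)"
    if "a \<in> {1..n}" "b \<in> {1..n}" "a \<noteq> b" "a \<rightarrow>\<^sup>*\<^bsub>Q\<^esub> b" for a b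
    using that card_homs refl antisym proj KW
    by (intro exceptional_pair.intro hq.hall_quotient_axioms exceptional_pair_axioms.intro) auto
  define C where "C l = reduced_class K ?A n P (C_complex (P l))" for l
  define R where "R = reduced_hall_algebra K ?A n P"
  define v where "v = complex_of_real (twisting_parameter K)"
  have C: "C l = W +>\<^bsub>twisted_hall_algebra K ?A\<^esub> basis_vector K ?A (C_complex (P l))" for l
    by (simp add: C_def reduced_class_def W_def)
  have R: "R = module_quot (twisted_hall_algebra K ?A) W"
    by (simp add: R_def reduced_hall_algebra_def W_def)
  have v: "v = pa.FA.s"
    by (simp add: v_def pa.FA.s_def)
  have rel: "C a \<otimes>\<^bsub>R\<^esub> (C b \<otimes>\<^bsub>R\<^esub> C b) \<ominus>\<^bsub>R\<^esub> (v + inverse v) \<odot>\<^bsub>R\<^esub> (C b \<otimes>\<^bsub>R\<^esub> C a \<otimes>\<^bsub>R\<^esub> C b)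
        \<oplus>\<^bsub>R\<^esub> (C b \<otimes>\<^bsub>R\<^esub> C b) \<otimes>\<^bsub>R\<^esub> C a = \<zero>\<^bsub>R\<^esub>"
      "C b \<otimes>\<^bsub>R\<^esub> (C a \<otimes>\<^bsub>R\<^esub> C a) \<ominus>\<^bsub>R\<^esub> (v + inverse v) \<odot>\<^bsub>R\<^esub> (C a \<otimes>\<^bsub>R\<^esub> C b \<otimes>\<^bsub>R\<^esub> C a)
        \<oplus>\<^bsub>R\<^esub> (C a \<otimes>\<^bsub>R\<^esub> C a) \<otimes>\<^bsub>R\<^esub> C b = \<zero>\<^bsub>R\<^esub>"
    if "a \<in> {1..n}" "b \<in> {1..n}" "a \<noteq> b" "a \<rightarrow>\<^sup>*\<^bsub>Q\<^esub> b" for a b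
    unfolding C R v
    by (fact exceptional_pair.serre_relations[OF pair[OF that]])+
  have "C i \<otimes>\<^bsub>R\<^esub> C j = C j \<otimes>\<^bsub>R\<^esub> C i" if "path_matrix Q i j = 0"
  proof -
    have "\<not> i \<rightarrow>\<^sup>*\<^bsub>Q\<^esub> j" "\<not> j \<rightarrow>\<^sup>*\<^bsub>Q\<^esub> i"
      using that assms(8) by (auto simp: path_matrix_def split: if_splits)
    then have "card (homs ?A (P i) (P j)) = 1" "card (homs ?A (P j) (P i)) = 1"
      using card_homs assms(6,7) by auto
    note comm = pa.FA.ebas_commute[OF proj[OF assms(6)] proj[OF assms(7)] this]
    note o = pa.FA.C1_object_C[OF proj[OF assms(6)]] pa.FA.C1_object_C[OF proj[OF assms(7)]]
    note b = pa.FA.basis_vector_H[OF o(1)] pa.FA.basis_vector_H[OF o(2)]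
    have "basis_vector K ?A (C_complex (P i)) \<otimes>\<^bsub>twisted_hall_algebra K ?A\<^esub> basis_vector K ?A (C_complex (P j)) =
        basis_vector K ?A (C_complex (P j)) \<otimes>\<^bsub>twisted_hall_algebra K ?A\<^esub> basis_vector K ?A (C_complex (P i))"
      unfolding pa.FA.basis_vector_ebas[OF o(1)] pa.FA.basis_vector_ebas[OF o(2)]
      by (simp add: pa.FA.H_mult_scale pa.FA.H_closed pa.FA.ebas_H o comm)
        (simp add: mult.left_commute)
    then show ?thesis
      unfolding C R hq.Q_mult[OF b] hq.Q_mult[OF b(2,1)] by (rule arg_cong)
  qed
  moreover have "C i \<otimes>\<^bsub>R\<^esub> (C j \<otimes>\<^bsub>R\<^esub> C j) \<ominus>\<^bsub>R\<^esub> (v + inverse v) \<odot>\<^bsub>R\<^esub> (C j \<otimes>\<^bsub>R\<^esub> C i \<otimes>\<^bsub>R\<^esub> C j)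
        \<oplus>\<^bsub>R\<^esub> (C j \<otimes>\<^bsub>R\<^esub> C j) \<otimes>\<^bsub>R\<^esub> C i = \<zero>\<^bsub>R\<^esub> \<and>
      C j \<otimes>\<^bsub>R\<^esub> (C i \<otimes>\<^bsub>R\<^esub> C i) \<ominus>\<^bsub>R\<^esub> (v + inverse v) \<odot>\<^bsub>R\<^esub> (C i \<otimes>\<^bsub>R\<^esub> C j \<otimes>\<^bsub>R\<^esub> C i)
        \<oplus>\<^bsub>R\<^esub> (C i \<otimes>\<^bsub>R\<^esub> C i) \<otimes>\<^bsub>R\<^esub> C j = \<zero>\<^bsub>R\<^esub>" if "\<bar>path_matrix Q i j\<bar> = 1"
  proof -
    \<comment> \<open>The sign of the entry tells which of i and j is the source of the path. Each
      case yields both relations, in one order or the other.\<close>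
    from that assms(8) consider "i \<rightarrow>\<^sup>*\<^bsub>Q\<^esub> j" | "j \<rightarrow>\<^sup>*\<^bsub>Q\<^esub> i"
      by (auto simp: path_matrix_def split: if_splits)
    then show ?thesis
    proof cases
      case 1
      from rel[OF assms(6,7,8) this] show ?thesis by (rule conjI)
    next
      case 2
      from rel[OF assms(7,6) assms(8)[symmetric] this] show ?thesis by (intro conjI)
    qed
  qed
  ultimately show ?thesis
    unfolding Let_def C_def R_def v_def by blast
qed

end
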